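(* Let $M$ be a von Neumann algebra (with separable predual) with a faithful normal tracial state $\tau$, and let $a=a^*$, $b=b^*\in M$ be such that $\mu_a$ and $\mu_b$ are non-atomic. Then for all $s\in[0,1)$, $$\int_0^s X_{a+b}\,dm\ \ge\ \int_0^s (X_a+X_b)\,dm .$$ Moreover, $$\int_0^1 X_{a+b}\,dm=\int_0^1 (X_a+X_b)\,dm .$$
   Context: All von Neumann algebras are assumed to have separable predual. For a self-adjoint $c\in M$, the distribution of $c$ is the compactly supported Borel probability measure $\mu_c$ on $\mathbb{R}$ given by $\mu_c(E)=\tau(1_E(c))$. Its (left-continuous) distribution function is $F_c(t)=\mu_c((-\infty,t))$, $t\in\mathbb{R}$, and its quantile function is $X_c:[0,1)\to\mathbb{R}$, $X_c(s)=\inf\{t\in\mathbb{R}: F_c(t)>s\}$, which is nondecreasing, right-continuous and bounded. $m$ is Lebesgue measure on $[0,1)$. *)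

theory Defs
  imports "HOL-Analysis.Analysis"
begin

text \<open>
  A complex Hilbert space, presented over its underlying real Hilbert space: the complex inner
  product (linear in the first argument) has the real one as its real part, so that it induces
  the given norm, and completeness comes from the sort \<open>complete_space\<close>.
\<close>

class complex_hilbert = real_inner + complete_space +
  fixes scaleC :: "complex \<Rightarrow> 'a \<Rightarrow> 'a"  (infixr "*\<^sub>C" 75)
    and cinner :: "'a \<Rightarrow> 'a \<Rightarrow> complex"
  assumes scaleC_add_right: "z *\<^sub>C (x + y) = z *\<^sub>C x + z *\<^sub>C y"
    and scaleC_add_left: "(z + w) *\<^sub>C x = z *\<^sub>C x + w *\<^sub>C x"
    and scaleC_scaleC: "z *\<^sub>C (w *\<^sub>C x) = (z * w) *\<^sub>C x"
    and scaleC_of_real: "complex_of_real r *\<^sub>C x = r *\<^sub>R x"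
    and cinner_commute: "cinner x y = cnj (cinner y x)"
    and cinner_add_left: "cinner (x + y) u = cinner x u + cinner y u"
    and cinner_scaleC_left: "cinner (w *\<^sub>C x) y = w * cinner x y"
    and Re_cinner: "Re (cinner x y) = inner x y"

lemma cinner_self: "cinner x x = complex_of_real ((norm x)\<^sup>2)"
  using Re_cinner[of x x] cinner_commute[of x x]
  by (auto simp: complex_eq_iff power2_norm_eq_inner)

lemma norm_scaleC: "norm (z *\<^sub>C x) = cmod z * norm x"
proof -
  have "cinner (z *\<^sub>C x) (z *\<^sub>C x) = z * cnj z * cinner x x"
    by (metis cinner_commute cinner_scaleC_left complex_cnj_mult mult.assoc mult.commute)
  also have "\<dots> = complex_of_real ((cmod z * norm x)\<^sup>2)"
    by (simp only: cinner_self complex_norm_square[symmetric] power_mult_distrib of_real_mult)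
  finally have "(norm (z *\<^sub>C x))\<^sup>2 = (cmod z * norm x)\<^sup>2"
    by (simp only: cinner_self of_real_eq_iff)
  then show ?thesis
    by (simp add: power2_eq_iff_nonneg)
qed

lemma bounded_linear_scaleC: "bounded_linear (\<lambda>x::'h::complex_hilbert. z *\<^sub>C x)"
proof
  fix r and x y :: 'h
  show "z *\<^sub>C (x + y) = z *\<^sub>C x + z *\<^sub>C y"
    by (rule scaleC_add_right)
  show "z *\<^sub>C (r *\<^sub>R x) = r *\<^sub>R (z *\<^sub>C x)"
    by (metis mult.commute scaleC_of_real scaleC_scaleC)
  show "\<exists>K. \<forall>x::'h. norm (z *\<^sub>C x) \<le> norm x * K"
    by (metis norm_scaleC mult.commute order_refl)
qed


section \<open>Von Neumann algebras\<close>

text \<open>\<open>'h \<Rightarrow>\<^sub>L 'h\<close> consists of the real-linear bounded operators; B(H) is its complex-linear part.\<close>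

definition bounded_ops :: "('h::complex_hilbert \<Rightarrow>\<^sub>L 'h) set" where
  "bounded_ops = {A :: 'h \<Rightarrow>\<^sub>L 'h. \<forall>z x. A (z *\<^sub>C x) = z *\<^sub>C A x}"

lift_definition scaleC_op ::
  "complex \<Rightarrow> ('h::complex_hilbert \<Rightarrow>\<^sub>L 'h) \<Rightarrow> ('h \<Rightarrow>\<^sub>L 'h)" is "\<lambda>z A x. z *\<^sub>C A x"
  by (rule bounded_linear_compose[OF bounded_linear_scaleC])

definition is_adjoint ::
  "('h::complex_hilbert \<Rightarrow>\<^sub>L 'h) \<Rightarrow> ('h \<Rightarrow>\<^sub>L 'h) \<Rightarrow> bool" where
  \<comment> \<open>\<open>B = A\<^sup>*\<close>; such a \<open>B\<close> is unique\<close>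
  "is_adjoint A B \<longleftrightarrow> (\<forall>x y. cinner (A x) y = cinner x (B y))"

definition self_adjoint :: "('h::complex_hilbert \<Rightarrow>\<^sub>L 'h) \<Rightarrow> bool" where
  "self_adjoint A \<longleftrightarrow> is_adjoint A A"

definition commutant :: "('h::complex_hilbert \<Rightarrow>\<^sub>L 'h) set \<Rightarrow> ('h \<Rightarrow>\<^sub>L 'h) set" where
  "commutant S = {T \<in> bounded_ops. \<forall>A\<in>S. T o\<^sub>L A = A o\<^sub>L T}"

text \<open>A bicommutant is automatically a unital complex subalgebra of B(H).\<close>

definition von_neumann_algebra :: "('h::complex_hilbert \<Rightarrow>\<^sub>L 'h) set \<Rightarrow> bool" where
  "von_neumann_algebra M \<longleftrightarrow>
     (\<forall>A\<in>M. \<exists>B\<in>M. is_adjoint A B) \<and> commutant (commutant M) = M"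

text \<open>
  The predual, i.e. the ultraweakly continuous linear functionals on \<open>M\<close>, which are the functionals
  \<open>A \<mapsto> \<Sum>n. \<langle>A \<xi>\<^sub>n, \<eta>\<^sub>n\<rangle>\<close> with square-summable \<open>\<xi>\<close>, \<open>\<eta>\<close>. Functionals are total HOL functions
  of which only the restriction to \<open>M\<close> matters.
\<close>

definition predual ::
  "('h::complex_hilbert \<Rightarrow>\<^sub>L 'h) set \<Rightarrow> (('h \<Rightarrow>\<^sub>L 'h) \<Rightarrow> complex) set" where
  "predual M = {\<phi>. \<exists>\<xi> \<eta> :: nat \<Rightarrow> 'h.
      summable (\<lambda>n. (norm (\<xi> n))\<^sup>2) \<and> summable (\<lambda>n. (norm (\<eta> n))\<^sup>2) \<and>
      (\<forall>A\<in>M. \<phi> A = (\<Sum>n. cinner (blinfun_apply A (\<xi> n)) (\<eta> n)))}"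

definition separable_predual :: "('h::complex_hilbert \<Rightarrow>\<^sub>L 'h) set \<Rightarrow> bool" where
  \<comment> \<open>separability for the norm of functionals on \<open>M\<close>\<close>
  "separable_predual M \<longleftrightarrow>
     (\<exists>D. countable D \<and> D \<subseteq> predual M \<and>
       (\<forall>\<phi>\<in>predual M. \<forall>e>0. \<exists>\<psi>\<in>D. \<forall>A\<in>M. norm A \<le> 1 \<longrightarrow> cmod (\<phi> A - \<psi> A) \<le> e))"

definition faithful_normal_tracial_state ::
  "('h::complex_hilbert \<Rightarrow>\<^sub>L 'h) set \<Rightarrow> (('h \<Rightarrow>\<^sub>L 'h) \<Rightarrow> complex) \<Rightarrow> bool" where
  "faithful_normal_tracial_state M \<tau> \<longleftrightarrow>
     (\<forall>A\<in>M. \<forall>B\<in>M. \<tau> (A + B) = \<tau> A + \<tau> B) \<and>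
     (\<forall>z. \<forall>A\<in>M. \<tau> (scaleC_op z A) = z * \<tau> A) \<and>
     (\<forall>A\<in>M. \<forall>B\<in>M. is_adjoint A B \<longrightarrow> \<tau> (B o\<^sub>L A) \<in> \<real>\<^sub>\<ge>\<^sub>0) \<and>
     \<tau> id_blinfun = 1 \<and>
     (\<forall>A\<in>M. \<forall>B\<in>M. is_adjoint A B \<longrightarrow> \<tau> (B o\<^sub>L A) = 0 \<longrightarrow> A = 0) \<and>
     \<tau> \<in> predual M \<and>
     (\<forall>A\<in>M. \<forall>B\<in>M. \<tau> (A o\<^sub>L B) = \<tau> (B o\<^sub>L A))"


section \<open>Spectral projections\<close>

text \<open>Only the values on Borel sets matter.\<close>

definition projection_valued_measure ::
  "(real set \<Rightarrow> ('h::complex_hilbert \<Rightarrow>\<^sub>L 'h)) \<Rightarrow> bool" where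
  "projection_valued_measure P \<longleftrightarrow>
     (\<forall>E\<in>sets borel. P E \<in> bounded_ops \<and> self_adjoint (P E) \<and> P E o\<^sub>L P E = P E) \<and>
     P UNIV = id_blinfun \<and>
     (\<forall>E\<in>sets borel. \<forall>F\<in>sets borel. P (E \<inter> F) = P E o\<^sub>L P F) \<and>
     (\<forall>E :: nat \<Rightarrow> real set. range E \<subseteq> sets borel \<longrightarrow> disjoint_family E \<longrightarrow>
        (\<forall>x. (\<lambda>n. P (E n) x) sums P (\<Union>n. E n) x))"

definition scalar_spectral_measure ::
  "(real set \<Rightarrow> ('h::complex_hilbert \<Rightarrow>\<^sub>L 'h)) \<Rightarrow> 'h \<Rightarrow> real measure" where
  "scalar_spectral_measure P x =
     measure_of UNIV (sets borel) (\<lambda>E. ennreal (Re (cinner (P E x) x)))"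

text \<open>\<open>P\<close> is compactly supported and \<open>c = \<integral> t dP(t)\<close>, the integral being taken weakly.\<close>

definition is_spectral_measure ::
  "('h::complex_hilbert \<Rightarrow>\<^sub>L 'h) \<Rightarrow> (real set \<Rightarrow> ('h \<Rightarrow>\<^sub>L 'h)) \<Rightarrow> bool" where
  "is_spectral_measure c P \<longleftrightarrow>
     projection_valued_measure P \<and>
     (\<exists>K. compact K \<and> P K = id_blinfun) \<and>
     (\<forall>x. cinner (c x) x = complex_of_real (\<integral>t. t \<partial>scalar_spectral_measure P x))"

text \<open>
  The projection \<open>1\<^sub>E(c)\<close> of the Borel functional calculus, for self-adjoint \<open>c\<close> and Borel \<open>E\<close>;
  the spectral theorem says that the description is proper.
\<close>

definition spectral_projection ::
  "('h::complex_hilbert \<Rightarrow>\<^sub>L 'h) \<Rightarrow> real set \<Rightarrow> ('h \<Rightarrow>\<^sub>L 'h)" where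
  "spectral_projection c E = (THE p. \<exists>P. is_spectral_measure c P \<and> p = P E)"


section \<open>Distributions and quantile functions\<close>

definition distribution ::
  "(('h::complex_hilbert \<Rightarrow>\<^sub>L 'h) \<Rightarrow> complex) \<Rightarrow> ('h \<Rightarrow>\<^sub>L 'h) \<Rightarrow> real measure" where
  "distribution \<tau> c =
     measure_of UNIV (sets borel) (\<lambda>E. ennreal (Re (\<tau> (spectral_projection c E))))"

definition non_atomic :: "'a measure \<Rightarrow> bool" where
  "non_atomic N \<longleftrightarrow>
     \<not> (\<exists>A\<in>sets N. emeasure N A > 0 \<and>
          (\<forall>B\<in>sets N. B \<subseteq> A \<longrightarrow> emeasure N B = 0 \<or> emeasure N (A - B) = 0))"

text \<open>Left-continuous, unlike the \<open>cdf\<close> of the library.\<close>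

definition distribution_function ::
  "(('h::complex_hilbert \<Rightarrow>\<^sub>L 'h) \<Rightarrow> complex) \<Rightarrow> ('h \<Rightarrow>\<^sub>L 'h) \<Rightarrow> real \<Rightarrow> real" where
  "distribution_function \<tau> c t = measure (distribution \<tau> c) {..<t}"

text \<open>Meaningful for \<open>0 \<le> s < 1\<close> only.\<close>

definition quantile ::
  "(('h::complex_hilbert \<Rightarrow>\<^sub>L 'h) \<Rightarrow> complex) \<Rightarrow> ('h \<Rightarrow>\<^sub>L 'h) \<Rightarrow> real \<Rightarrow> real" where
  "quantile \<tau> c s = Inf {t. distribution_function \<tau> c t > s}"

end

theory Submission
  imports Defs "HOL-Probability.Probability"
begin

text \<open>
  For self-adjoint \<open>c \<in> M\<close> put \<open>h\<^sub>c(t) = \<integral> max 0 (t - u) d\<mu>\<^sub>c(u)\<close>, the shortfall of \<open>c\<close> below \<open>t\<close>. Under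
  \<open>X\<^sub>c\<close> Lebesgue measure on \<open>[0,1)\<close> becomes \<open>\<mu>\<^sub>c\<close>, so \<open>h\<^sub>c(t)\<close> is also the integral of \<open>max 0 (t - X\<^sub>c)\<close> over
  \<open>[0,1)\<close>. Since \<open>X\<^sub>c\<close> is nondecreasing, the integral of \<open>X\<^sub>c\<close> over \<open>[0,s)\<close> is the Legendre transform
  \<open>max\<^sub>t (s t - h\<^sub>c(t))\<close>, attained at \<open>t = X\<^sub>c(s)\<close> (lemmas \<open>integral_quantile_fun_ge\<close> and
  \<open>integral_quantile_fun_eq\<close>). The inequality thus amounts to \<open>h\<^sub>a\<^sub>+\<^sub>b(s + t) \<le> h\<^sub>a(s) + h\<^sub>b(t)\<close>.

  On the operator side \<open>h\<^sub>c(t) = \<tau>((t - c) 1\<^bsub>(-\<infinity>,t]\<^esub>(c))\<close>, and this is the largest value of \<open>\<tau>((t - c) p)\<close> over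
  all projections \<open>p \<in> M\<close> (lemmas \<open>shortfall_trace\<close> and \<open>shortfall_variational\<close>): the trace property turns
  \<open>\<tau>(y p)\<close> with \<open>y \<ge> 0\<close> into \<open>\<tau>(p y p) \<ge> 0\<close>. If \<open>p\<close> is the optimal projection for \<open>a + b\<close> at \<open>s + t\<close>, then
  \<open>\<tau>((s + t - a - b) p) = \<tau>((s - a) p) + \<tau>((t - b) p)\<close>, and the two summands are at most \<open>h\<^sub>a(s)\<close> and
  \<open>h\<^sub>b(t)\<close>. The equality over \<open>[0,1)\<close> holds because both sides are \<open>\<tau>(a + b) = \<tau>(a) + \<tau>(b)\<close>.

  The distribution of \<open>c\<close> is defined through its spectral projections, so the spectral theorem for bounded
  self-adjoint operators is needed, existence and uniqueness alike. It is proved for symmetric operators on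
  real Hilbert spaces, with all operators kept in the bicommutant of \<open>c\<close>. Complex linearity (commuting
  with the multiplication by \<open>\<i>\<close>) and membership in \<open>M\<close> come for free in this way.
  A positive operator has a positive square root, which gives \<open>\<bar>c\<bar> = sqrt (c\<^sup>2)\<close>. The projection onto
  the kernel of \<open>\<bar>c\<bar> + c\<close> cuts the space into a part where \<open>c \<le> 0\<close> and a part where \<open>c \<ge> 0\<close>. Doing this
  for every \<open>c - t\<close> gives a monotone, right-continuous family of projections, whose quadratic forms are
  distribution functions of measures on the line. A Dynkin class argument then supplies a projection for
  every Borel set. The operator is recovered as an integral from the bounds \<open>s \<le> c \<le> t\<close> on the spectral
  subspace of \<open>(s,t]\<close> alone, and the same argument yields \<open>\<tau>(c 1\<^bsub>(-\<infinity>,t]\<^esub>(c))\<close>. Uniqueness follows as any two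
  families of spectral cuts of \<open>c\<close> that commute interlace.
\<close>

section \<open>Symmetric operators and bicommutants\<close>

definition symmetric_op :: "('h::real_inner \<Rightarrow>\<^sub>L 'h) \<Rightarrow> bool" where
  "symmetric_op A \<longleftrightarrow> (\<forall>x y. A x \<bullet> y = x \<bullet> A y)"

definition positive_op :: "('h::real_inner \<Rightarrow>\<^sub>L 'h) \<Rightarrow> bool" where
  "positive_op A \<longleftrightarrow> symmetric_op A \<and> (\<forall>x. 0 \<le> A x \<bullet> x)"

definition ortho_proj :: "('h::real_inner \<Rightarrow>\<^sub>L 'h) \<Rightarrow> bool" where
  "ortho_proj p \<longleftrightarrow> symmetric_op p \<and> (\<forall>x. p (p x) = p x)"

text \<open>
  The commutant is taken among all real-linear bounded operators. On a complex space, it therefore contains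
  the multiplications by scalars as soon as \<open>c\<close> is complex linear, and every element of the bicommutant
  is then complex linear as well.
\<close>

definition bicomm :: "('h::real_inner \<Rightarrow>\<^sub>L 'h) \<Rightarrow> ('h \<Rightarrow>\<^sub>L 'h) set" where
  "bicomm c = {T :: 'h \<Rightarrow>\<^sub>L 'h. \<forall>S :: 'h \<Rightarrow>\<^sub>L 'h. (\<forall>x. S (c x) = c (S x)) \<longrightarrow> (\<forall>x. S (T x) = T (S x))}"

lemma symmetric_opD:
  fixes A :: "'a::real_inner \<Rightarrow>\<^sub>L 'a"
  shows "symmetric_op A \<Longrightarrow> A x \<bullet> y = x \<bullet> A y"
  by (simp add: symmetric_op_def)

lemma symmetric_op_add: "symmetric_op A \<Longrightarrow> symmetric_op B \<Longrightarrow> symmetric_op (A + B)"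
  and symmetric_op_diff: "symmetric_op A \<Longrightarrow> symmetric_op B \<Longrightarrow> symmetric_op (A - B)"
  and symmetric_op_scaleR: "symmetric_op A \<Longrightarrow> symmetric_op (r *\<^sub>R A)"
  and symmetric_op_id: "symmetric_op id_blinfun"
  and symmetric_op_zero: "symmetric_op 0"
  by (auto simp: symmetric_op_def blinfun.bilinear_simps inner_simps)

lemma bicommI:
  fixes c T :: "'h::real_inner \<Rightarrow>\<^sub>L 'h"
  assumes "\<And>(S :: 'h \<Rightarrow>\<^sub>L 'h) x. (\<And>y. S (c y) = c (S y)) \<Longrightarrow> S (T x) = T (S x)"
  shows "T \<in> bicomm c"
  using assms unfolding bicomm_def by blast

lemma bicommD:
  fixes c T S :: "'h::real_inner \<Rightarrow>\<^sub>L 'h"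
  assumes "T \<in> bicomm c" "\<And>y. S (c y) = c (S y)"
  shows "S (T x) = T (S x)"
  using assms unfolding bicomm_def by blast

lemma bicomm_self: "c \<in> bicomm c"
  and bicomm_id: "id_blinfun \<in> bicomm c"
  and bicomm_zero: "0 \<in> bicomm c"
  by (simp_all add: bicomm_def)

lemma bicomm_add: "A \<in> bicomm c \<Longrightarrow> B \<in> bicomm c \<Longrightarrow> A + B \<in> bicomm c"
  and bicomm_diff: "A \<in> bicomm c \<Longrightarrow> B \<in> bicomm c \<Longrightarrow> A - B \<in> bicomm c"
  and bicomm_scaleR: "A \<in> bicomm c \<Longrightarrow> r *\<^sub>R A \<in> bicomm c"
  by (rule bicommI; simp add: blinfun.bilinear_simps bicommD[of A c] bicommD[of B c])+

lemma bicomm_compose: "A \<in> bicomm c \<Longrightarrow> B \<in> bicomm c \<Longrightarrow> A o\<^sub>L B \<in> bicomm c"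
  by (rule bicommI) (metis bicommD blinfun_apply_blinfun_compose)

lemma bicomm_trans: "A \<in> bicomm B \<Longrightarrow> B \<in> bicomm c \<Longrightarrow> A \<in> bicomm c"
  by (rule bicommI) (blast intro: bicommD)

lemma bicomm_limit:
  fixes A :: "nat \<Rightarrow> 'a::real_inner \<Rightarrow>\<^sub>L 'a" and T :: "'a \<Rightarrow>\<^sub>L 'a"
  assumes "\<And>n. A n \<in> bicomm c" "\<And>x. (\<lambda>n. A n x) \<longlonglongrightarrow> T x"
  shows "T \<in> bicomm c"
  unfolding bicomm_def mem_Collect_eq
proof (intro allI impI)
  fix S :: "'a \<Rightarrow>\<^sub>L 'a" and x assume S: "\<forall>x. S (c x) = c (S x)"
  have "(\<lambda>n. S (A n x)) \<longlonglongrightarrow> S (T x)"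
    by (intro tendsto_intros assms)
  moreover have "S (A n x) = A n (S x)" for n
    using bicommD[OF assms(1)[of n]] S by blast
  ultimately show "S (T x) = T (S x)"
    using assms(2)[of "S x"] LIMSEQ_unique by auto
qed

lemma symmetric_op_limit:
  fixes A :: "nat \<Rightarrow> 'a::real_inner \<Rightarrow>\<^sub>L 'a" and T :: "'a \<Rightarrow>\<^sub>L 'a"
  assumes "\<And>n. symmetric_op (A n)" "\<And>x. (\<lambda>n. A n x) \<longlonglongrightarrow> T x"
  shows "symmetric_op T"
  unfolding symmetric_op_def
proof (intro allI)
  fix x y
  have "(\<lambda>n. A n x \<bullet> y) \<longlonglongrightarrow> T x \<bullet> y" "(\<lambda>n. x \<bullet> A n y) \<longlonglongrightarrow> x \<bullet> T y"
    by (intro tendsto_intros assms)+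
  then show "T x \<bullet> y = x \<bullet> T y"
    using assms(1) LIMSEQ_unique by (auto simp: symmetric_op_def)
qed

text \<open>
  \<open>A\<close> commutes with \<open>c\<close>, because \<open>c\<close> commutes with itself. Hence \<open>B\<close> commutes with \<open>A\<close>.
\<close>

lemma bicomm_commute:
  fixes A B :: "'a::real_inner \<Rightarrow>\<^sub>L 'a"
  assumes "A \<in> bicomm c" "B \<in> bicomm c"
  shows "A (B x) = B (A x)"
  by (rule bicommD[OF assms(2)], rule bicommD[OF assms(1), symmetric]) simp

lemma bicomm_commute_self:
  fixes A c :: "'a::real_inner \<Rightarrow>\<^sub>L 'a"
  shows "A \<in> bicomm c \<Longrightarrow> A (c x) = c (A x)"
  using bicomm_commute bicomm_self by blast

lemma strong_limit:
  fixes A :: "nat \<Rightarrow> 'h::{real_inner,complete_space} \<Rightarrow>\<^sub>L 'h"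
  assumes bd: "\<And>n. norm (A n) \<le> K" and C: "\<And>x. Cauchy (\<lambda>n. A n x)"
  obtains T :: "'h \<Rightarrow>\<^sub>L 'h" where "\<And>x. (\<lambda>n. A n x) \<longlonglongrightarrow> T x" "norm T \<le> K"
proof -
  have "\<forall>x. \<exists>y. (\<lambda>n. A n x) \<longlonglongrightarrow> y"
    using C Cauchy_convergent convergent_def by blast
  then obtain g where g: "\<And>x. (\<lambda>n. A n x) \<longlonglongrightarrow> g x" by metis
  have K: "0 \<le> K" using bd[of 0] norm_ge_zero order_trans by blast
  have gb: "norm (g x) \<le> norm x * K" for x
  proof (rule LIMSEQ_le_const2[OF tendsto_norm[OF g]])
    show "\<exists>N. \<forall>n\<ge>N. norm (A n x) \<le> norm x * K"
      using norm_blinfun[of "A _" x] mult_right_mono[OF bd norm_ge_zero] 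
      by (metis mult.commute order_trans)
  qed
  have "bounded_linear g"
  proof (rule bounded_linear_intro[where K=K])
    show "g (x + y) = g x + g y" for x y
      using LIMSEQ_unique[OF g[of "x+y"]] tendsto_add[OF g[of x] g[of y]]
      by (simp add: blinfun.bilinear_simps)
    show "g (r *\<^sub>R x) = r *\<^sub>R g x" for r x
      using LIMSEQ_unique[OF g[of "r *\<^sub>R x"]] tendsto_scaleR[OF tendsto_const g[of x], of r]
      by (simp add: blinfun.bilinear_simps)
  qed (rule gb)
  then have app: "blinfun_apply (Blinfun g) = g" by (rule bounded_linear_Blinfun_apply)
  show ?thesis
    by (rule that[of "Blinfun g"])
      (auto simp: app g intro!: norm_blinfun_bound K gb[unfolded mult.commute[of "norm _"]])
qed

section \<open>Square roots of positive operators\<close>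

lemma contraction_square_le:
  fixes B :: "'h::real_inner \<Rightarrow>\<^sub>L 'h"
  assumes sym: "symmetric_op B" and B0: "\<And>x. 0 \<le> B x \<bullet> x" and B1: "\<And>x. B x \<bullet> x \<le> x \<bullet> x"
  shows "B x \<bullet> B x \<le> B x \<bullet> x"
proof -
  let ?y = "x - B x"
  \<comment> \<open>\<open>B - B\<^sup>2 = B (1 - B) B + (1 - B) B (1 - B) \<ge> 0\<close>\<close>
  have "0 \<le> (B x \<bullet> B x - B (B x) \<bullet> B x) + B ?y \<bullet> ?y"
    using B0[of ?y] B1[of "B x"] by simp
  also have "\<dots> = B x \<bullet> x - B x \<bullet> B x"
    using sym by (simp add: symmetric_op_def blinfun.bilinear_simps inner_simps inner_commute)
  finally show ?thesis by simp
qed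

lemma contraction_from_form:
  fixes B :: "'h::real_inner \<Rightarrow>\<^sub>L 'h"
  assumes "symmetric_op B" "\<And>x. 0 \<le> B x \<bullet> x" "\<And>x. B x \<bullet> x \<le> x \<bullet> x"
  shows "norm B \<le> 1"
proof (rule norm_blinfun_bound)
  fix x
  have "(norm (B x))\<^sup>2 \<le> (norm x)\<^sup>2"
    using contraction_square_le[OF assms, of x] assms(3)[of x] by (simp add: power2_norm_eq_inner)
  then show "norm (B x) \<le> 1 * norm x"
    by (simp add: power2_le_iff_abs_le)
qed simp

text \<open>
  If \<open>0 \<le> B \<le> 1\<close>, the fixed points \<open>Y\<close> of the iteration satisfy \<open>(1 - Y)\<^sup>2 = 1 - B\<close>. So the limit is
  \<open>1 - sqrt (1 - B)\<close>.
\<close>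

primrec sqrt_iter :: "('h::real_inner \<Rightarrow>\<^sub>L 'h) \<Rightarrow> nat \<Rightarrow> ('h \<Rightarrow>\<^sub>L 'h)" where
  "sqrt_iter B 0 = 0"
| "sqrt_iter B (Suc n) = (1/2) *\<^sub>R (B + (sqrt_iter B n o\<^sub>L sqrt_iter B n))"

text \<open>
  This is the same iteration for the number 1. The coefficients of the iterates, as polynomials in \<open>B\<close>, and of
  their successive differences are nonnegative, so that the norms for \<open>\<parallel>B\<parallel> \<le> 1\<close> are bounded by the values
  at 1.
\<close>

primrec sqrt_majorant :: "nat \<Rightarrow> real" where
  "sqrt_majorant 0 = 0"
| "sqrt_majorant (Suc n) = (1 + (sqrt_majorant n)\<^sup>2) / 2"

lemma sqrt_majorant_bounds: "0 \<le> sqrt_majorant n \<and> sqrt_majorant n \<le> 1"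
  by (induction n) (auto simp: power2_eq_square mult_le_one)

lemma sqrt_majorant_mono: "sqrt_majorant n \<le> sqrt_majorant (Suc n)"
  using zero_le_power2[of "sqrt_majorant n - 1"] by (simp add: power2_eq_square algebra_simps)

lemma sqrt_majorant_Cauchy: "Cauchy sqrt_majorant"
proof (rule convergent_Cauchy, rule Bseq_monoseq_convergent)
  show "Bseq sqrt_majorant"
    using sqrt_majorant_bounds by (intro BseqI'[of _ 1]) auto
  show "monoseq sqrt_majorant"
    using sqrt_majorant_mono by (simp add: monoseq_Suc)
qed

lemma sqrt_iter_bicomm: "sqrt_iter B n \<in> bicomm B"
  by (induction n) (auto intro!: bicomm_zero bicomm_scaleR bicomm_add bicomm_compose bicomm_self)

lemma sqrt_iter_symmetric: "symmetric_op B \<Longrightarrow> symmetric_op (sqrt_iter B n)"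
  by (induction n)
    (auto simp: symmetric_op_zero symmetric_op_scaleR symmetric_op_def blinfun.bilinear_simps inner_simps)

lemma sqrt_iter_norm:
  assumes "norm B \<le> 1"
  shows "norm (sqrt_iter B n) \<le> sqrt_majorant n"
proof (induction n)
  case (Suc n)
  have "norm (sqrt_iter B n o\<^sub>L sqrt_iter B n) \<le> (sqrt_majorant n)\<^sup>2"
    using norm_blinfun_compose[of "sqrt_iter B n" "sqrt_iter B n"]
      mult_mono[OF Suc Suc] sqrt_majorant_bounds[of n]
    by (simp add: power2_eq_square)
  then have "norm (B + (sqrt_iter B n o\<^sub>L sqrt_iter B n)) \<le> 1 + (sqrt_majorant n)\<^sup>2"
    using assms norm_triangle_le by (metis add_mono)
  then show ?case by simp
qed simp

text \<open>
  The difference of consecutive iterates factors as \<open>(Y\<^sup>2 - Z\<^sup>2)/2 = (Y + Z)(Y - Z)/2\<close>, because \<open>Y\<close> and \<open>Z\<close> are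
  polynomials in \<open>B\<close>. The real sequence obeys the same recursion with equality.
\<close>

lemma sqrt_iter_step:
  assumes "norm B \<le> 1"
  shows "norm (sqrt_iter B (Suc n) - sqrt_iter B n) \<le> sqrt_majorant (Suc n) - sqrt_majorant n"
proof (induction n)
  case 0
  then show ?case using assms by simp
next
  case (Suc n)
  let ?Y = "sqrt_iter B (Suc n)" and ?Z = "sqrt_iter B n"
  let ?y = "sqrt_majorant (Suc n)" and ?z = "sqrt_majorant n"
  have comm: "?Y (?Z x) = ?Z (?Y x)" for x
    by (rule bicomm_commute[OF sqrt_iter_bicomm sqrt_iter_bicomm])
  have "sqrt_iter B (Suc (Suc n)) - ?Y = (1/2) *\<^sub>R ((?Y + ?Z) o\<^sub>L (?Y - ?Z))"
  proof (rule blinfun_eqI)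
    fix x
    have "sqrt_iter B (Suc (Suc n)) x - ?Y x = (1/2) *\<^sub>R (?Y (?Y x) - ?Z (?Z x))"
      by (subst (1 2) sqrt_iter.simps(2))
        (simp add: blinfun.bilinear_simps scaleR_diff_right del: sqrt_iter.simps,
         simp add: blinfun.bilinear_simps scaleR_right_distrib)
    then show "(sqrt_iter B (Suc (Suc n)) - ?Y) x = ((1/2) *\<^sub>R ((?Y + ?Z) o\<^sub>L (?Y - ?Z))) x"
      using comm[of x] by (simp add: blinfun.bilinear_simps del: sqrt_iter.simps)
  qed
  moreover have "norm ((?Y + ?Z) o\<^sub>L (?Y - ?Z)) \<le> (?y + ?z) * (?y - ?z)"
  proof (rule order_trans[OF norm_blinfun_compose], rule mult_mono[OF _ Suc])
    show "norm (?Y + ?Z) \<le> ?y + ?z"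
      by (intro norm_triangle_mono sqrt_iter_norm[OF assms])
    show "0 \<le> ?y + ?z"
      by (intro add_nonneg_nonneg) (use sqrt_majorant_bounds in blast)+
  qed simp
  moreover have "sqrt_majorant (Suc (Suc n)) - ?y = (?y + ?z) * (?y - ?z) / 2"
  proof -
    have "sqrt_majorant (Suc (Suc n)) - ?y = (1 + ?y\<^sup>2) / 2 - (1 + ?z\<^sup>2) / 2"
      by (rule arg_cong2[where f="(-)"]; rule sqrt_majorant.simps)
    also have "\<dots> = (?y\<^sup>2 - ?z\<^sup>2) / 2"
      by (simp add: diff_divide_distrib add_divide_distrib del: sqrt_majorant.simps)
    finally show ?thesis
      by (simp only: square_diff_square_factored power2_eq_square)
  qed
  ultimately show ?case by (simp del: sqrt_iter.simps sqrt_majorant.simps)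
qed

lemma sqrt_iter_Cauchy:
  fixes B :: "'h::real_inner \<Rightarrow>\<^sub>L 'h"
  assumes "norm B \<le> 1"
  shows "Cauchy (\<lambda>n. sqrt_iter B n x)"
proof -
  have inc: "norm (sqrt_iter B (n + k) x - sqrt_iter B n x)
      \<le> (sqrt_majorant (n + k) - sqrt_majorant n) * norm x" for n k
  proof (induction k)
    case (Suc k)
    let ?d = "sqrt_iter B (Suc (n + k)) - sqrt_iter B (n + k)"
    have "norm (?d x) \<le> (sqrt_majorant (Suc (n + k)) - sqrt_majorant (n + k)) * norm x"
      by (rule order_trans[OF norm_blinfun mult_right_mono[OF sqrt_iter_step[OF assms]]]) simp
    moreover have "sqrt_iter B (n + Suc k) x - sqrt_iter B n x
        = ?d x + (sqrt_iter B (n + k) x - sqrt_iter B n x)"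
      by (simp add: blinfun.diff_left)
    ultimately show ?case
      using Suc norm_triangle_ineq[of "?d x" "sqrt_iter B (n + k) x - sqrt_iter B n x"]
      by (simp add: algebra_simps del: sqrt_iter.simps sqrt_majorant.simps)
  qed simp
  show ?thesis
  proof (rule metric_CauchyI)
    fix e :: real assume "e > 0"
    then have "e / (norm x + 1) > 0" by (simp add: add_nonneg_pos)
    with sqrt_majorant_Cauchy obtain N where
      N: "\<And>m n. m \<ge> N \<Longrightarrow> n \<ge> N \<Longrightarrow> dist (sqrt_majorant m) (sqrt_majorant n) < e / (norm x + 1)"
      unfolding Cauchy_def by meson
    have main: "dist (sqrt_iter B m x) (sqrt_iter B n x) < e" if "m \<ge> n" "n \<ge> N" for m n
    proof -
      obtain k where m: "m = n + k" using \<open>m \<ge> n\<close> le_Suc_ex by blast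
      have "sqrt_majorant m - sqrt_majorant n < e / (norm x + 1)"
        using N[of m n] that by (simp add: dist_real_def)
      then have "(sqrt_majorant m - sqrt_majorant n) * norm x \<le> e / (norm x + 1) * norm x"
        by (intro mult_right_mono) auto
      also have "\<dots> < e"
        using \<open>e > 0\<close> by (simp add: divide_simps add_nonneg_pos)
      finally show ?thesis using inc[of n k] by (simp add: m dist_norm)
    qed
    show "\<exists>M. \<forall>m\<ge>M. \<forall>n\<ge>M. dist (sqrt_iter B m x) (sqrt_iter B n x) < e"
      using main by (metis dist_commute nle_le)
  qed
qed

text \<open>
  After scaling, \<open>A = k (1 - B)\<close> with \<open>0 \<le> B \<le> 1\<close>, and the square root is \<open>sqrt k (1 - Y)\<close> with the limit \<open>Y\<close>
  of the iteration. It is positive because \<open>\<parallel>Y\<parallel> \<le> 1\<close>.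
\<close>

lemma positive_op_sqrt:
  fixes A :: "'h::{real_inner,complete_space} \<Rightarrow>\<^sub>L 'h"
  assumes A: "positive_op A"
  obtains S :: "'h \<Rightarrow>\<^sub>L 'h" where "positive_op S" "S \<in> bicomm A" "S o\<^sub>L S = A"
proof -
  define k where "k = norm A + 1"
  have k: "k > 0" by (simp add: k_def add_nonneg_pos)
  define B where "B = id_blinfun - (1/k) *\<^sub>R A"
  have sA: "symmetric_op A" and A0: "\<And>x. 0 \<le> A x \<bullet> x" using A by (auto simp: positive_op_def)
  have sB: "symmetric_op B"
    unfolding B_def by (intro symmetric_op_diff symmetric_op_id symmetric_op_scaleR sA)
  have BA: "B \<in> bicomm A"
    unfolding B_def by (intro bicomm_diff bicomm_id bicomm_scaleR bicomm_self)
  have B1: "B x \<bullet> x \<le> x \<bullet> x" for x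
    using A0[of x] k by (simp add: B_def blinfun.bilinear_simps inner_simps)
  have B0: "0 \<le> B x \<bullet> x" for x
  proof -
    have "A x \<bullet> x \<le> norm A * norm x * norm x"
      by (rule order_trans[OF norm_cauchy_schwarz mult_right_mono[OF norm_blinfun]]) simp
    also have "\<dots> \<le> k * (x \<bullet> x)"
      by (simp add: k_def power2_norm_eq_inner[symmetric] power2_eq_square algebra_simps)
    finally show ?thesis
      using k by (simp add: B_def blinfun.bilinear_simps inner_simps field_simps)
  qed
  have nB: "norm B \<le> 1" by (rule contraction_from_form[OF sB B0 B1])
  have nY: "norm (sqrt_iter B n) \<le> 1" for n
    using sqrt_iter_norm[OF nB, of n] sqrt_majorant_bounds[of n] by linarith
  obtain Y :: "'h \<Rightarrow>\<^sub>L 'h" where Y: "\<And>x. (\<lambda>n. sqrt_iter B n x) \<longlonglongrightarrow> Y x" and Y1: "norm Y \<le> 1"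
    using strong_limit[OF nY sqrt_iter_Cauchy[OF nB]] by blast
  have sY: "symmetric_op Y"
    by (rule symmetric_op_limit[OF sqrt_iter_symmetric[OF sB] Y])
  have YB: "Y \<in> bicomm B"
    by (rule bicomm_limit[OF sqrt_iter_bicomm Y])
  have fixpt: "2 *\<^sub>R Y x = B x + Y (Y x)" for x
  proof -
    have "(\<lambda>n. sqrt_iter B n (sqrt_iter B n x)) \<longlonglongrightarrow> Y (Y x)"
    proof -
      have "(\<lambda>n. sqrt_iter B n (sqrt_iter B n x - Y x)) \<longlonglongrightarrow> 0"
      proof (rule Lim_null_comparison)
        show "\<forall>\<^sub>F n in sequentially. norm (sqrt_iter B n (sqrt_iter B n x - Y x))
            \<le> norm (sqrt_iter B n x - Y x)"
        proof (intro always_eventually allI)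
          fix n
          show "norm (sqrt_iter B n (sqrt_iter B n x - Y x)) \<le> norm (sqrt_iter B n x - Y x)"
            by (rule order_trans[OF norm_blinfun])
              (use mult_right_mono[OF nY norm_ge_zero] in fastforce)
        qed
        show "(\<lambda>n. norm (sqrt_iter B n x - Y x)) \<longlonglongrightarrow> 0"
          using Y[of x] by (simp add: tendsto_norm_zero LIM_zero)
      qed
      from tendsto_add[OF this Y[of "Y x"]] show ?thesis
        by (simp add: blinfun.bilinear_simps)
    qed
    from tendsto_add[OF tendsto_const[of "B x"] this]
    have "(\<lambda>n. 2 *\<^sub>R sqrt_iter B (Suc n) x) \<longlonglongrightarrow> B x + Y (Y x)"
      by (simp add: blinfun.bilinear_simps)
    moreover have "(\<lambda>n. 2 *\<^sub>R sqrt_iter B (Suc n) x) \<longlonglongrightarrow> 2 *\<^sub>R Y x"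
      by (rule tendsto_scaleR[OF tendsto_const LIMSEQ_Suc[OF Y]])
    ultimately show ?thesis using LIMSEQ_unique by blast
  qed
  define S where "S = sqrt k *\<^sub>R (id_blinfun - Y)"
  show ?thesis
  proof (rule that[of S])
    have "0 \<le> S x \<bullet> x" for x
    proof -
      have "Y x \<bullet> x \<le> norm Y * norm x * norm x"
        by (rule order_trans[OF norm_cauchy_schwarz mult_right_mono[OF norm_blinfun]]) simp
      also have "\<dots> \<le> x \<bullet> x"
        using mult_right_mono[OF Y1, of "norm x * norm x"]
        by (simp add: power2_norm_eq_inner[symmetric] power2_eq_square mult.assoc)
      finally show ?thesis using k by (simp add: S_def blinfun.bilinear_simps inner_simps)
    qed
    then show "positive_op S"
      by (auto simp: positive_op_def S_def intro!: symmetric_op_scaleR symmetric_op_diff symmetric_op_id sY)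
    show "S \<in> bicomm A"
      unfolding S_def by (intro bicomm_scaleR bicomm_diff bicomm_id bicomm_trans[OF YB BA])
    show "S o\<^sub>L S = A"
    proof (rule blinfun_eqI)
      fix x
      have "(S o\<^sub>L S) x = k *\<^sub>R (x - 2 *\<^sub>R Y x + Y (Y x))"
        using k by (simp add: S_def blinfun.bilinear_simps scaleR_2 algebra_simps)
      also have "\<dots> = k *\<^sub>R (x - B x)" by (simp add: fixpt)
      also have "\<dots> = A x" using k by (simp add: B_def blinfun.bilinear_simps)
      finally show "(S o\<^sub>L S) x = A x" .
    qed
  qed
qed

section \<open>Orthogonal projections\<close>

lemma inner_self_nonpos: "(x::'a::real_inner) \<bullet> x \<le> 0 \<Longrightarrow> x = 0"
  by (metis antisym inner_eq_zero_iff inner_ge_zero)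

text \<open>
  Polarization. On a real space it needs the symmetry of both operators: the quadratic form of a
  skew-symmetric operator is 0.
\<close>

lemma symmetric_op_form_eqI:
  fixes p q :: "'h::real_inner \<Rightarrow>\<^sub>L 'h"
  assumes p: "symmetric_op p" and q: "symmetric_op q" and form: "\<And>x. p x \<bullet> x = q x \<bullet> x"
  shows "p = q"
proof (rule blinfun_eqI)
  fix x
  have polar: "p x \<bullet> y = q x \<bullet> y" for y
    using form[of "x + y"] form[of x] form[of y] p q
    by (simp add: symmetric_op_def blinfun.bilinear_simps inner_simps inner_commute)
  have "(p x - q x) \<bullet> (p x - q x) = 0"
    using polar[of "p x - q x"] by (simp add: inner_simps)
  then show "p x = q x" by simp
qed

lemma ortho_projD:
  fixes p :: "'h::real_inner \<Rightarrow>\<^sub>L 'h"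
  assumes "ortho_proj p"
  shows "p (p x) = p x" "p x \<bullet> y = x \<bullet> p y" "p x \<bullet> x = p x \<bullet> p x"
  using assms by (auto simp: ortho_proj_def symmetric_op_def inner_commute)

lemma ortho_projI:
  fixes p :: "'h::real_inner \<Rightarrow>\<^sub>L 'h"
  assumes "symmetric_op p" "\<And>x. p (p x) = p x"
  shows "ortho_proj p"
  using assms by (simp add: ortho_proj_def)

lemma ortho_proj_compl: "ortho_proj p \<Longrightarrow> ortho_proj (id_blinfun - p)"
  by (auto simp: ortho_proj_def blinfun.bilinear_simps intro: symmetric_op_diff symmetric_op_id)

lemma ortho_proj_zero: "ortho_proj 0"
  by (simp add: ortho_proj_def symmetric_op_zero)

lemma ortho_proj_form_le:
  fixes p :: "'h::real_inner \<Rightarrow>\<^sub>L 'h"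
  assumes "ortho_proj p" 
  shows "p x \<bullet> x \<le> x \<bullet> x"
proof -
  have "0 \<le> (x - p x) \<bullet> (x - p x)" by simp
  then show ?thesis using ortho_projD(3)[OF assms, of x] by (simp add: inner_simps inner_commute)
qed

lemma ortho_proj_form_ge: "ortho_proj p \<Longrightarrow> 0 \<le> blinfun_apply p x \<bullet> x"
  by (subst ortho_projD(3)) auto

lemma ortho_proj_norm:
  fixes p :: "'h::real_inner \<Rightarrow>\<^sub>L 'h"
  assumes "ortho_proj p"
  shows "norm p \<le> 1"
  using assms ortho_proj_form_le[OF assms] ortho_proj_form_ge[OF assms]
  by (intro contraction_from_form) (auto simp: ortho_proj_def)

lemma ortho_proj_absorb:
  fixes p q :: "'h::real_inner \<Rightarrow>\<^sub>L 'h"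
  assumes "ortho_proj p" "ortho_proj q" "\<And>x. q (p x) = p x"
  shows "p (q x) = p x"
proof -
  have "(p (q x) - p x) \<bullet> y = 0" for y
    using assms by (simp add: inner_diff_left ortho_projD(2))
  then show ?thesis by (metis inner_eq_zero_iff eq_iff_diff_eq_0)
qed

lemma ortho_proj_limit:
  fixes q :: "nat \<Rightarrow> 'h::real_inner \<Rightarrow>\<^sub>L 'h" and T :: "'h \<Rightarrow>\<^sub>L 'h"
  assumes q: "\<And>n. ortho_proj (q n)" and lim: "\<And>x. (\<lambda>n. q n x) \<longlonglongrightarrow> T x"
  shows "ortho_proj T"
proof -
  have sym: "symmetric_op T"
    using symmetric_op_limit[OF _ lim] q by (auto simp: ortho_proj_def)
  moreover have "T x \<bullet> y = T (T x) \<bullet> y" for x y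
  proof -
    have "(\<lambda>n. q n x \<bullet> q n y) \<longlonglongrightarrow> T x \<bullet> T y"
      by (intro tendsto_intros lim)
    moreover have "q n x \<bullet> q n y = q n x \<bullet> y" for n
      using ortho_projD(1,2)[OF q] by metis
    moreover have "(\<lambda>n. q n x \<bullet> y) \<longlonglongrightarrow> T x \<bullet> y"
      by (intro tendsto_intros lim)
    ultimately have "T x \<bullet> T y = T x \<bullet> y" using LIMSEQ_unique by fastforce
    then show ?thesis using sym by (simp add: symmetric_op_def)
  qed
  then have "T (T x) = T x" for x by (metis vector_eq_rdot)
  ultimately show ?thesis by (rule ortho_projI)
qed

text \<open>
  For \<open>m \<le> n\<close>, Pythagoras gives \<open>\<parallel>q\<^sub>n x - q\<^sub>m x\<parallel>\<^sup>2 = \<parallel>q\<^sub>n x\<parallel>\<^sup>2 - \<parallel>q\<^sub>m x\<parallel>\<^sup>2\<close>, and the bounded monotone sequence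
  \<open>\<parallel>q\<^sub>n x\<parallel>\<^sup>2\<close> is Cauchy.
\<close>

lemma increasing_projections_limit:
  fixes q :: "nat \<Rightarrow> 'h::{real_inner,complete_space} \<Rightarrow>\<^sub>L 'h"
  assumes q: "\<And>n. ortho_proj (q n)" and inc: "\<And>m n x. m \<le> n \<Longrightarrow> q n (q m x) = q m x"
  obtains T :: "'h \<Rightarrow>\<^sub>L 'h" where "ortho_proj T" "\<And>x. (\<lambda>n. q n x) \<longlonglongrightarrow> T x"
proof -
  have dist: "(norm (q n x - q m x))\<^sup>2 = q n x \<bullet> x - q m x \<bullet> x" if "m \<le> n" for m n x
  proof -
    have "q m (q n x) = q m x" by (rule ortho_proj_absorb[OF q q inc[OF that]])
    then have "q n x \<bullet> q m x = q m x \<bullet> x"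
      using ortho_projD(2)[OF q, of m "q n x" x] ortho_projD(1,2)[OF q]
      by (metis inner_commute)
    then show ?thesis
      using ortho_projD(3)[OF q] by (simp add: power2_norm_eq_inner inner_simps inner_commute)
  qed
  have C: "Cauchy (\<lambda>n. q n x)" for x
  proof -
    have "Cauchy (\<lambda>n. q n x \<bullet> x)"
    proof (rule convergent_Cauchy, rule Bseq_monoseq_convergent)
      show "Bseq (\<lambda>n. q n x \<bullet> x)"
        using ortho_proj_form_le[OF q, of _ x] ortho_proj_form_ge[OF q, of _ x]
        by (intro BseqI'[of _ "x \<bullet> x"]) auto
      show "monoseq (\<lambda>n. q n x \<bullet> x)"
        unfolding monoseq_def using dist zero_le_power2 by (metis diff_ge_0_iff_ge)
    qed
    then have small: "\<exists>M. \<forall>m\<ge>M. \<forall>n\<ge>M. \<bar>q m x \<bullet> x - q n x \<bullet> x\<bar> < e\<^sup>2" if "e > 0" for e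
      using that unfolding Cauchy_def dist_real_def by simp
    show ?thesis
    proof (rule metric_CauchyI)
      fix e :: real assume "e > 0"
      with small obtain M where M: "\<And>m n. m \<ge> M \<Longrightarrow> n \<ge> M \<Longrightarrow> \<bar>q m x \<bullet> x - q n x \<bullet> x\<bar> < e\<^sup>2"
        by blast
      have "dist (q m x) (q n x) < e" if "m \<le> n" "m \<ge> M" "n \<ge> M" for m n
        using dist[OF that(1), of x] M[OF that(2,3)] \<open>e > 0\<close>
        by (metis abs_minus_commute abs_of_nonneg dist_commute dist_norm less_imp_le
            power2_less_imp_less zero_le_power2)
      then show "\<exists>M. \<forall>m\<ge>M. \<forall>n\<ge>M. dist (q m x) (q n x) < e"
        by (metis dist_commute nle_le)
    qed
  qed
  obtain T :: "'h \<Rightarrow>\<^sub>L 'h" where T: "\<And>x. (\<lambda>n. q n x) \<longlonglongrightarrow> T x"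
    using strong_limit[OF ortho_proj_norm[OF q] C] by blast
  show ?thesis by (rule that[OF ortho_proj_limit[OF q T] T])
qed

primrec op_power :: "('h::real_inner \<Rightarrow>\<^sub>L 'h) \<Rightarrow> nat \<Rightarrow> ('h \<Rightarrow>\<^sub>L 'h)" where
  "op_power B 0 = id_blinfun"
| "op_power B (Suc n) = B o\<^sub>L op_power B n"

lemma op_power_add:
  fixes B :: "'h::real_inner \<Rightarrow>\<^sub>L 'h"
  shows "op_power B (m + n) x = op_power B m (op_power B n x)"
  by (induction m) auto

lemma op_power_bicomm: "op_power B n \<in> bicomm B"
  by (induction n) (auto intro: bicomm_id bicomm_compose bicomm_self)

lemma op_power_symmetric:
  assumes "symmetric_op B"
  shows "symmetric_op (op_power B n)"
proof (induction n)
  case (Suc n)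
  have "B (op_power B n x) = op_power B n (B x)" for x
    by (rule bicomm_commute[OF bicomm_self op_power_bicomm])
  then show ?case using Suc assms by (simp add: symmetric_op_def)
qed (simp add: symmetric_op_id)

text \<open>
  The numbers \<open>a\<^sub>n = \<langle>B\<^sup>n x, x\<rangle>\<close> are nonnegative and decreasing, and
  \<open>\<parallel>B\<^sup>m x - B\<^sup>n x\<parallel>\<^sup>2 = a\<^sub>2\<^sub>m - 2 a\<^sub>m\<^sub>+\<^sub>n + a\<^sub>2\<^sub>n\<close>.
\<close>

lemma powers_of_contraction_limit:
  fixes B :: "'h::{real_inner,complete_space} \<Rightarrow>\<^sub>L 'h"
  assumes sym: "symmetric_op B" and B0: "\<And>x. 0 \<le> B x \<bullet> x" and B1: "\<And>x. B x \<bullet> x \<le> x \<bullet> x"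
  obtains E :: "'h \<Rightarrow>\<^sub>L 'h" where "\<And>x. (\<lambda>n. op_power B n x) \<longlonglongrightarrow> E x"
proof -
  let ?P = "op_power B"
  have nP: "norm (?P n) \<le> 1" for n
  proof (induction n)
    case (Suc n)
    have "norm (B o\<^sub>L ?P n) \<le> 1 * 1"
      by (rule order_trans[OF norm_blinfun_compose mult_mono])
        (use Suc contraction_from_form[OF sym B0 B1] in auto)
    then show ?case by simp
  qed (simp add: norm_blinfun_id_le)
  have split: "?P (m + n) x \<bullet> x = ?P m x \<bullet> ?P n x" for m n x
    using symmetric_opD[OF op_power_symmetric[OF sym], of m "?P n x" x] op_power_add[of B m n x]
    by (metis inner_commute)
  have dec: "?P (Suc n) x \<bullet> x \<le> ?P n x \<bullet> x" and nonneg: "0 \<le> ?P n x \<bullet> x" for n x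
  proof -
    \<comment> \<open>\<open>\<langle>B\<^sup>n x, x\<rangle>\<close> is \<open>\<parallel>B\<^sup>k x\<parallel>\<^sup>2\<close> for \<open>n = 2k\<close> and \<open>\<langle>B y, y\<rangle>\<close> with \<open>y = B\<^sup>k x\<close> for \<open>n = 2k + 1\<close>\<close>
    obtain k where k: "n = k + k \<or> n = Suc k + k"
      by (metis add_Suc evenE mult_2 oddE add.commute Suc_eq_plus1)
    have *: "?P (Suc k + k) x \<bullet> x = B (?P k x) \<bullet> ?P k x"
      by (subst split) simp
    have "?P (Suc k + Suc k) x \<bullet> x = B (?P k x) \<bullet> B (?P k x)"
      by (subst split) simp
    with * k show "?P (Suc n) x \<bullet> x \<le> ?P n x \<bullet> x"
      using B1[of "?P k x"] contraction_square_le[OF sym B0 B1, of "?P k x"] split[of k k x]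
      by (auto simp del: op_power.simps)
    from * k show "0 \<le> ?P n x \<bullet> x"
      using B0[of "?P k x"] split[of k k x] by (auto simp del: op_power.simps)
  qed
  have C: "Cauchy (\<lambda>n. ?P n x)" for x
  proof -
    have decseq: "decseq (\<lambda>n. ?P n x \<bullet> x)"
      using dec by (simp add: decseq_Suc_iff del: op_power.simps)
    obtain L where L: "(\<lambda>n. ?P n x \<bullet> x) \<longlonglongrightarrow> L"
      by (rule decseq_convergent[OF decseq, of 0]) (use nonneg that in auto)
    show ?thesis
    proof (rule metric_CauchyI)
      fix e :: real assume "e > 0"
      then have "e\<^sup>2 / 4 > 0" by simp
      with L obtain N where N: "\<And>n. n \<ge> N \<Longrightarrow> \<bar>?P n x \<bullet> x - L\<bar> < e\<^sup>2 / 4"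
        unfolding LIMSEQ_def dist_real_def by blast
      have "dist (?P m x) (?P n x) < e" if "m \<ge> N" "n \<ge> N" for m n
      proof -
        have "(dist (?P m x) (?P n x))\<^sup>2 = ?P (m + m) x \<bullet> x - 2 * (?P (m + n) x \<bullet> x) + ?P (n + n) x \<bullet> x"
          by (simp only: split) (simp add: dist_norm power2_norm_eq_inner inner_simps inner_commute)
        also have "\<dots> < e\<^sup>2"
          using N[of "m + m"] N[of "m + n"] N[of "n + n"] that by linarith
        finally show ?thesis using \<open>e > 0\<close> by (simp add: power2_less_imp_less)
      qed
      then show "\<exists>M. \<forall>m\<ge>M. \<forall>n\<ge>M. dist (?P m x) (?P n x) < e" by blast
    qed
  qed
  show ?thesis using strong_limit[OF nP C] that by blast
qed

text \<open>
  The powers of \<open>1 - D\<^sup>2/k\<close> converge strongly to the projection onto the kernel of \<open>D\<close>. The last property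
  says that an operator which vanishes on the range of \<open>D\<close> vanishes on the orthogonal complement of
  the kernel.
\<close>

lemma projection_onto_kernel:
  fixes D :: "'h::{real_inner,complete_space} \<Rightarrow>\<^sub>L 'h"
  assumes D: "symmetric_op D"
  obtains E :: "'h \<Rightarrow>\<^sub>L 'h" where "ortho_proj E" "E \<in> bicomm D"
    "\<And>x. D (E x) = 0" "\<And>x. D x = 0 \<Longrightarrow> E x = x"
    "\<And>(C :: 'h \<Rightarrow>\<^sub>L 'h) x. (\<And>y. C (D y) = 0) \<Longrightarrow> C (E x) = C x"
proof -
  \<comment> \<open>\<open>k \<ge> \<parallel>D\<parallel>\<^sup>2\<close> ensures \<open>0 \<le> 1 - D\<^sup>2/k \<le> 1\<close>; adding 1 keeps \<open>k\<close> positive when \<open>D = 0\<close>\<close>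
  define k where "k = (norm D)\<^sup>2 + 1"
  have k: "k > 0" by (simp add: k_def add_nonneg_pos)
  define B where "B = id_blinfun - (1/k) *\<^sub>R (D o\<^sub>L D)"
  have B: "B x = x - (1/k) *\<^sub>R D (D x)" for x
    by (simp add: B_def blinfun.bilinear_simps)
  have form: "B x \<bullet> x = x \<bullet> x - (D x \<bullet> D x) / k" for x
    using D by (simp add: B inner_simps symmetric_op_def)
  have sym: "symmetric_op B"
    using D by (simp add: B symmetric_op_def inner_simps)
  have BD: "B \<in> bicomm D"
    unfolding B_def by (intro bicomm_diff bicomm_id bicomm_scaleR bicomm_compose bicomm_self)
  have B1: "B x \<bullet> x \<le> x \<bullet> x" for x using k by (simp add: form)
  have B0: "0 \<le> B x \<bullet> x" for x
  proof -
    have "D x \<bullet> D x \<le> (norm D * norm x)\<^sup>2"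
      using norm_blinfun[of D x] by (simp add: power2_norm_eq_inner[symmetric] power_mono)
    also have "\<dots> \<le> k * (x \<bullet> x)"
      by (simp add: k_def power_mult_distrib power2_norm_eq_inner[symmetric] algebra_simps)
    finally show ?thesis using k by (simp add: form field_simps)
  qed
  obtain E :: "'h \<Rightarrow>\<^sub>L 'h" where E: "\<And>x. (\<lambda>n. op_power B n x) \<longlonglongrightarrow> E x"
    by (rule powers_of_contraction_limit[OF sym B0 B1]) blast
  have fixed: "E x = x" if "B x = x" for x
  proof -
    have "op_power B n x = x" for n by (induction n) (auto simp: that)
    then show ?thesis using E[of x] by (simp add: LIMSEQ_const_iff)
  qed
  have BE: "B (E x) = E x" for x
  proof -
    have "(\<lambda>n. B (op_power B n x)) \<longlonglongrightarrow> B (E x)" by (intro tendsto_intros E)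
    moreover have "(\<lambda>n. B (op_power B n x)) \<longlonglongrightarrow> E x" using LIMSEQ_Suc[OF E[of x]] by simp
    ultimately show ?thesis by (rule LIMSEQ_unique)
  qed
  show ?thesis
  proof (rule that)
    show "ortho_proj E"
      by (rule ortho_projI[OF symmetric_op_limit[OF op_power_symmetric[OF sym] E] fixed[OF BE]])
    show "E \<in> bicomm D"
      by (rule bicomm_trans[OF bicomm_limit[OF op_power_bicomm E] BD])
    show "D (E x) = 0" for x
    proof -
      have "D (D (E x)) = 0" using BE[of x] k by (simp add: B)
      then have "D (E x) \<bullet> D (E x) = 0" using D by (simp add: symmetric_op_def)
      then show ?thesis by simp
    qed
    show "E x = x" if "D x = 0" for x
      by (rule fixed) (simp add: B that)
    show "C (E x) = C x" if "\<And>y. C (D y) = 0" for C :: "'h \<Rightarrow>\<^sub>L 'h" and x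
    proof -
      have "C (op_power B n x) = C x" for n
        by (induction n) (simp_all add: B blinfun.bilinear_simps that)
      moreover have "(\<lambda>n. C (op_power B n x)) \<longlonglongrightarrow> C (E x)" by (intro tendsto_intros E)
      ultimately show ?thesis by (simp add: LIMSEQ_const_iff)
    qed
  qed
qed

section \<open>Spectral cuts and the spectral family\<close>

text \<open>
  Let \<open>S = \<bar>c\<bar> = sqrt (c\<^sup>2)\<close> and let \<open>E\<close> be the projection onto the kernel of \<open>S + c\<close>, which is twice the positive
  part of \<open>c\<close>. Then \<open>c = -S\<close> on the range of \<open>E\<close>. On the complement \<open>c = S\<close>, because \<open>(S - c)(S + c) = 0\<close>.
\<close>

lemma spectral_cut_zero:
  fixes c :: "'h::{real_inner,complete_space} \<Rightarrow>\<^sub>L 'h"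
  assumes c: "symmetric_op c"
  obtains E :: "'h \<Rightarrow>\<^sub>L 'h" where "ortho_proj E" "E \<in> bicomm c"
    "\<And>x. c (E x) \<bullet> E x \<le> 0" "\<And>x. 0 \<le> c (x - E x) \<bullet> (x - E x)"
    "\<And>x. c x = 0 \<Longrightarrow> E x = x"
proof -
  have pos: "positive_op (c o\<^sub>L c)"
    using c symmetric_opD[OF c, of "c _"] inner_ge_zero
    unfolding positive_op_def symmetric_op_def blinfun_apply_blinfun_compose by metis
  obtain S where S: "positive_op S" "S \<in> bicomm (c o\<^sub>L c)" "S o\<^sub>L S = c o\<^sub>L c"
    by (rule positive_op_sqrt[OF pos])
  have SS: "S (S x) = c (c x)" for x
    using S(3) by (metis blinfun_apply_blinfun_compose)
  have Sc: "S \<in> bicomm c"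
    by (rule bicomm_trans[OF S(2) bicomm_compose[OF bicomm_self bicomm_self]])
  have comm: "S (c x) = c (S x)" for x by (rule bicomm_commute_self[OF Sc])
  have symS: "symmetric_op S" using S(1) by (simp add: positive_op_def)
  define D where "D = S + c"
  have symD: "symmetric_op D" unfolding D_def by (intro symmetric_op_add symS c)
  obtain E :: "'h \<Rightarrow>\<^sub>L 'h" where E: "ortho_proj E" "E \<in> bicomm D" "\<And>x. D (E x) = 0"
      "\<And>x. D x = 0 \<Longrightarrow> E x = x"
      "\<And>(C :: 'h \<Rightarrow>\<^sub>L 'h) x. (\<And>y. C (D y) = 0) \<Longrightarrow> C (E x) = C x"
    by (rule projection_onto_kernel[OF symD]) blast
  have neg: "c (E x) = - S (E x)" for x
    using E(3)[of x] by (simp add: D_def blinfun.bilinear_simps add_eq_0_iff)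
  have "(S - c) (D y) = 0" for y
    by (simp add: D_def blinfun.bilinear_simps SS comm)
  then have "(S - c) (E x) = (S - c) x" for x by (rule E(5))
  then have pos: "c (x - E x) = S (x - E x)" for x
    by (simp add: blinfun.bilinear_simps algebra_simps)
  have S0: "0 \<le> S x \<bullet> x" for x using S(1) by (simp add: positive_op_def)
  show ?thesis
  proof (rule that[OF E(1)])
    show "E \<in> bicomm c"
      using bicomm_trans[OF E(2)] bicomm_add[OF Sc bicomm_self] unfolding D_def by blast
    show "c (E x) \<bullet> E x \<le> 0" for x using S0[of "E x"] by (simp add: neg)
    show "0 \<le> c (x - E x) \<bullet> (x - E x)" for x using S0[of "x - E x"] by (simp add: pos)
    show "E x = x" if "c x = 0" for x
    proof (rule E(4))
      have "S x \<bullet> S x = S (S x) \<bullet> x" using symS by (simp add: symmetric_op_def)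
      also have "\<dots> = 0" by (simp add: SS that)
      finally show "D x = 0" by (simp add: D_def blinfun.bilinear_simps that)
    qed
  qed
qed

text \<open>
  The last clause puts the eigenspace of \<open>t\<close> into the range of \<open>E\<close>. So \<open>E\<close> belongs to \<open>(-\<infinity>,t]\<close> rather than
  to \<open>(-\<infinity>,t)\<close>, which makes the family right-continuous in \<open>t\<close>.
\<close>

definition is_spectral_cut :: "('h::real_inner \<Rightarrow>\<^sub>L 'h) \<Rightarrow> real \<Rightarrow> ('h \<Rightarrow>\<^sub>L 'h) \<Rightarrow> bool" where
  "is_spectral_cut c t E \<longleftrightarrow> ortho_proj E \<and> E \<in> bicomm c \<and>
     (\<forall>x. c (E x) \<bullet> E x \<le> t * (E x \<bullet> E x)) \<and>
     (\<forall>x. t * ((x - E x) \<bullet> (x - E x)) \<le> c (x - E x) \<bullet> (x - E x)) \<and>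
     (\<forall>x. c x = t *\<^sub>R x \<longrightarrow> E x = x)"

lemma spectral_cut_exists:
  fixes c :: "'h::{real_inner,complete_space} \<Rightarrow>\<^sub>L 'h"
  assumes c: "symmetric_op c"
  shows "\<exists>E. is_spectral_cut c t E"
proof -
  let ?c = "c - t *\<^sub>R id_blinfun"
  have "symmetric_op ?c"
    by (intro symmetric_op_diff symmetric_op_scaleR symmetric_op_id c)
  then obtain E where E: "ortho_proj E" "E \<in> bicomm ?c"
    "\<And>x. ?c (E x) \<bullet> E x \<le> 0" "\<And>x. 0 \<le> ?c (x - E x) \<bullet> (x - E x)"
    "\<And>x. ?c x = 0 \<Longrightarrow> E x = x"
    by (rule spectral_cut_zero) blast
  have "?c \<in> bicomm c"
    by (intro bicomm_diff bicomm_scaleR bicomm_id bicomm_self)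
  with E(2) have "E \<in> bicomm c" by (rule bicomm_trans)
  then have "is_spectral_cut c t E"
    unfolding is_spectral_cut_def
    using E(1,3-5) by (auto simp: blinfun.diff_left blinfun.scaleR_left inner_diff_left)
  then show ?thesis ..
qed

text \<open>
  On the intersection of the ranges of \<open>p\<close> and \<open>1 - e\<close> both \<open>c \<le> s\<close> and \<open>c \<ge> t\<close> hold, so it is trivial.
  This gives the monotonicity of the spectral family, and also the uniqueness of the spectral
  resolution.
\<close>

lemma spectral_cut_comparison:
  fixes c p e :: "'h::real_inner \<Rightarrow>\<^sub>L 'h"
  assumes comm: "\<And>x. p (e x) = e (p x)" and "s < t"
    and p: "\<And>x. c (p x) \<bullet> p x \<le> s * (p x \<bullet> p x)"
    and e: "\<And>x. t * ((x - e x) \<bullet> (x - e x)) \<le> c (x - e x) \<bullet> (x - e x)"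
  shows "e (p x) = p x"
proof -
  define y where "y = p x - e (p x)"
  have "p (x - e x) = y" by (simp add: y_def blinfun.bilinear_simps comm)
  then have "c y \<bullet> y \<le> s * (y \<bullet> y)" using p[of "x - e x"] by simp
  moreover have "t * (y \<bullet> y) \<le> c y \<bullet> y" using e[of "p x"] by (simp add: y_def)
  ultimately have "(t - s) * (y \<bullet> y) \<le> 0" by (simp add: algebra_simps)
  then have "y \<bullet> y \<le> 0" using \<open>s < t\<close> by (simp add: mult_le_0_iff)
  then have "y = 0" by (rule inner_self_nonpos)
  then show ?thesis by (simp add: y_def)
qed

definition spectral_family :: "('h::real_inner \<Rightarrow>\<^sub>L 'h) \<Rightarrow> real \<Rightarrow> ('h \<Rightarrow>\<^sub>L 'h)" where
  "spectral_family c t = (SOME E. is_spectral_cut c t E)"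

lemma spectral_family_cut:
  fixes c :: "'h::{real_inner,complete_space} \<Rightarrow>\<^sub>L 'h"
  shows "symmetric_op c \<Longrightarrow> is_spectral_cut c t (spectral_family c t)"
  unfolding spectral_family_def using spectral_cut_exists by (rule someI_ex)

lemma spectral_family:
  fixes c :: "'h::{real_inner,complete_space} \<Rightarrow>\<^sub>L 'h"
  assumes "symmetric_op c"
  shows "ortho_proj (spectral_family c t)" "spectral_family c t \<in> bicomm c"
    and "c (spectral_family c t x) \<bullet> spectral_family c t x
      \<le> t * (spectral_family c t x \<bullet> spectral_family c t x)"
    and "t * ((x - spectral_family c t x) \<bullet> (x - spectral_family c t x))
      \<le> c (x - spectral_family c t x) \<bullet> (x - spectral_family c t x)"
    and "c x = t *\<^sub>R x \<Longrightarrow> spectral_family c t x = x"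
  using spectral_family_cut[OF assms, of t] unfolding is_spectral_cut_def by blast+

lemma spectral_family_mono:
  fixes c :: "'h::{real_inner,complete_space} \<Rightarrow>\<^sub>L 'h"
  assumes c: "symmetric_op c" and "s \<le> t"
  shows "spectral_family c t (spectral_family c s x) = spectral_family c s x"
proof (cases "s = t")
  case True
  then show ?thesis using ortho_projD(1)[OF spectral_family(1)[OF c]] by simp
next
  case False
  then have "s < t" using \<open>s \<le> t\<close> by simp
  show ?thesis
    by (rule spectral_cut_comparison[OF _ \<open>s < t\<close> spectral_family(3,4)[OF c]])
      (rule bicomm_commute[OF spectral_family(2,2)[OF c]])
qed

lemma form_bound:
  fixes c :: "'h::real_inner \<Rightarrow>\<^sub>L 'h"
  shows "\<bar>c x \<bullet> x\<bar> \<le> norm c * (x \<bullet> x)"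
proof -
  have "\<bar>c x \<bullet> x\<bar> \<le> norm (c x) * norm x" by (rule Cauchy_Schwarz_ineq2)
  also have "\<dots> \<le> norm c * norm x * norm x" by (rule mult_right_mono[OF norm_blinfun]) simp
  finally show ?thesis by (simp add: power2_norm_eq_inner[symmetric] power2_eq_square mult.assoc)
qed

lemma spectral_family_below:
  fixes c :: "'h::{real_inner,complete_space} \<Rightarrow>\<^sub>L 'h"
  assumes c: "symmetric_op c" and t: "t < - norm c"
  shows "spectral_family c t x = 0"
proof -
  define y where "y = spectral_family c t x"
  have "- norm c * (y \<bullet> y) \<le> t * (y \<bullet> y)"
    using spectral_family(3)[OF c, of t x] form_bound[of c y] by (simp add: y_def)
  then have "y \<bullet> y \<le> 0" using t by (meson inner_ge_zero linorder_not_less mult_strict_right_mono)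
  then have "y = 0" by (rule inner_self_nonpos)
  then show ?thesis by (simp add: y_def)
qed

lemma spectral_family_above:
  fixes c :: "'h::{real_inner,complete_space} \<Rightarrow>\<^sub>L 'h"
  assumes c: "symmetric_op c" and t: "norm c < t"
  shows "spectral_family c t x = x"
proof -
  define y where "y = x - spectral_family c t x"
  have "t * (y \<bullet> y) \<le> norm c * (y \<bullet> y)"
    using spectral_family(4)[OF c, of t x] form_bound[of c y] by (simp add: y_def)
  then have "y \<bullet> y \<le> 0" using t by (meson inner_ge_zero linorder_not_less mult_strict_right_mono)
  then have "y = 0" by (rule inner_self_nonpos)
  then show ?thesis by (simp add: y_def)
qed

lemma spectral_family_form_mono:
  fixes c :: "'h::{real_inner,complete_space} \<Rightarrow>\<^sub>L 'h"
  assumes c: "symmetric_op c" and "s \<le> t"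
  shows "spectral_family c s x \<bullet> x \<le> spectral_family c t x \<bullet> x"
proof -
  let ?s = "spectral_family c s" and ?t = "spectral_family c t"
  have "?s (?t x) = ?s x"
    by (rule ortho_proj_absorb[OF spectral_family(1)[OF c] spectral_family(1)[OF c]
        spectral_family_mono[OF assms]])
  then have "?s x \<bullet> x = ?s (?t x) \<bullet> ?t x"
    using ortho_projD[OF spectral_family(1)[OF c]] by metis
  also have "\<dots> \<le> ?t x \<bullet> ?t x"
    by (rule ortho_proj_form_le[OF spectral_family(1)[OF c]])
  finally show ?thesis using ortho_projD(3)[OF spectral_family(1)[OF c], of t x] by simp
qed

text \<open>
  The projections \<open>E(a + 1/n)\<close> decrease to a projection \<open>G\<close> above \<open>E(a)\<close>. On the range of \<open>R = G - E(a)\<close> both \<open>c \<le> a\<close>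
  and \<open>c \<ge> a\<close> hold, so \<open>c = a\<close> there. But \<open>E(a)\<close> contains the eigenspace of \<open>a\<close>, and \<open>R = 0\<close> follows.
\<close>

lemma spectral_family_right_continuous:
  fixes c :: "'h::{real_inner,complete_space} \<Rightarrow>\<^sub>L 'h"
  assumes c: "symmetric_op c"
  shows "(\<lambda>n. spectral_family c (a + 1 / real (Suc n)) x) \<longlonglongrightarrow> spectral_family c a x"
proof -
  define q where "q n = spectral_family c (a + 1 / real (Suc n))" for n
  define E where "E = spectral_family c a"
  have proj: "ortho_proj (q n)" "ortho_proj (id_blinfun - q n)" "ortho_proj E" for n
    unfolding q_def E_def by (intro ortho_proj_compl spectral_family(1)[OF c])+
  have E: "E \<in> bicomm c" unfolding E_def by (rule spectral_family(2)[OF c])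
  have qc: "q n \<in> bicomm c" for n unfolding q_def by (rule spectral_family(2)[OF c])
  have qE: "q n (E x) = E x" for n x
    unfolding q_def E_def by (rule spectral_family_mono[OF c]) simp
  have dec: "q m (q n x) = q n x" if "m \<le> n" for m n x
    unfolding q_def by (rule spectral_family_mono[OF c]) (use that in \<open>simp add: frac_le\<close>)
  have "(id_blinfun - q n) ((id_blinfun - q m) x) = (id_blinfun - q m) x" if "m \<le> n" for m n x
    using ortho_proj_absorb[OF proj(1) proj(1) dec[OF that]]
    by (simp add: blinfun.bilinear_simps)
  then obtain T where T: "ortho_proj T" "\<And>x. (\<lambda>n. (id_blinfun - q n) x) \<longlonglongrightarrow> T x"
    using increasing_projections_limit[of "\<lambda>n. id_blinfun - q n", OF proj(2)] by blast
  define G where "G = id_blinfun - T"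
  have G: "(\<lambda>n. q n x) \<longlonglongrightarrow> G x" for x
    using tendsto_diff[OF tendsto_const[of x] T(2)[of x]] by (simp add: G_def blinfun.bilinear_simps)
  have projG: "ortho_proj G" unfolding G_def by (rule ortho_proj_compl[OF T(1)])
  define R where "R = G - E"
  have R: "(\<lambda>n. q n x - E x) \<longlonglongrightarrow> R x" for x
    unfolding R_def blinfun.diff_left by (intro tendsto_intros G)
  have Rc: "R \<in> bicomm c"
    unfolding R_def by (intro bicomm_diff bicomm_limit[OF qc G] E)
  have GE: "G (E x) = E x" for x
    using G[of "E x"] by (simp add: qE LIMSEQ_const_iff)
  have EG: "E (G x) = E x" for x
    by (rule ortho_proj_absorb[OF proj(3) projG GE])
  have projR: "ortho_proj R"
    using projG proj(3)
    by (auto simp: ortho_proj_def R_def blinfun.bilinear_simps GE EG intro: symmetric_op_diff)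
  have form: "c (R x) \<bullet> R x = a * (R x \<bullet> R x)" for x
  proof (rule antisym)
    \<comment> \<open>\<open>y n\<close> lies in the ranges of \<open>q n\<close> and of \<open>1 - E\<close>, so that \<open>c\<close> is squeezed from both sides\<close>
    define y where "y n = q n x - E x" for n
    have y: "y \<longlonglongrightarrow> R x" unfolding y_def by (rule R)
    have Eq: "E (q n x) = E x" for n
      by (rule ortho_proj_absorb[OF proj(3) proj(1) qE])
    have "q n (x - E x) = y n" for n by (simp add: y_def blinfun.bilinear_simps qE)
    then have up: "c (y n) \<bullet> y n \<le> (a + 1 / real (Suc n)) * (y n \<bullet> y n)" for n
      using spectral_family(3)[OF c, of "a + 1 / real (Suc n)" "x - E x"] unfolding q_def by metis
    have lo: "a * (y n \<bullet> y n) \<le> c (y n) \<bullet> y n" for n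
      using spectral_family(4)[OF c, of a "q n x"] Eq[of n] by (simp add: y_def E_def)
    show "a * (R x \<bullet> R x) \<le> c (R x) \<bullet> R x"
      by (rule LIMSEQ_le[OF tendsto_mult[OF tendsto_const tendsto_inner[OF y y]]
            tendsto_inner[OF blinfun.tendsto[OF tendsto_const y] y]]) (use lo in auto)
    have "(\<lambda>n. (a + 1 / real (Suc n)) * (y n \<bullet> y n)) \<longlonglongrightarrow> (a + 0) * (R x \<bullet> R x)"
      using LIMSEQ_inverse_real_of_nat
      by (intro tendsto_intros y) (simp add: inverse_eq_divide)
    then show "c (R x) \<bullet> R x \<le> a * (R x \<bullet> R x)"
      using LIMSEQ_le[OF tendsto_inner[OF blinfun.tendsto[OF tendsto_const y] y]] up by fastforce
  qed
  have comm: "R (c x) = c (R x)" for x by (rule bicomm_commute_self[OF Rc])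
  have "c o\<^sub>L R = a *\<^sub>R R"
  proof (rule symmetric_op_form_eqI)
    show "symmetric_op (c o\<^sub>L R)"
      using c ortho_projD(2)[OF projR] comm by (simp add: symmetric_op_def)
    show "symmetric_op (a *\<^sub>R R)"
      using projR by (simp add: ortho_proj_def symmetric_op_scaleR)
    show "(c o\<^sub>L R) x \<bullet> x = (a *\<^sub>R R) x \<bullet> x" for x
    proof -
      have "c (R x) \<bullet> x = R (c (R x)) \<bullet> x" by (simp add: comm ortho_projD(1)[OF projR])
      also have "\<dots> = a * (R x \<bullet> R x)" by (simp add: ortho_projD(2)[OF projR] form)
      finally show ?thesis using ortho_projD(3)[OF projR, of x] by (simp add: blinfun.bilinear_simps)
    qed
  qed
  then have "c (R x) = a *\<^sub>R R x" for x
    by (metis blinfun.scaleR_left blinfun_apply_blinfun_compose)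
  then have "E (R x) = R x" unfolding E_def by (rule spectral_family(5)[OF c])
  moreover have "E (R x) = 0"
    by (simp add: R_def blinfun.bilinear_simps EG ortho_projD(1)[OF proj(3)])
  ultimately have "G x = E x" by (simp add: R_def blinfun.bilinear_simps)
  then show ?thesis using G[of x] by (simp add: q_def E_def)
qed

section \<open>Integrals determined by their increments\<close>

text \<open>
  Cutting \<open>[a,b]\<close> into \<open>n\<close> equal pieces bounds \<open>\<bar>f b - f a\<bar>\<close> by \<open>(b - a)(F b - F a)/n\<close>. Jumps of \<open>F\<close> do no
  harm, because only its total increment enters.
\<close>

lemma constant_from_increments:
  fixes f F :: "real \<Rightarrow> real"
  assumes "a \<le> b"
    and incr: "\<And>s t. a \<le> s \<Longrightarrow> s \<le> t \<Longrightarrow> t \<le> b \<Longrightarrow> \<bar>f t - f s\<bar> \<le> (t - s) * (F t - F s)"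
  shows "f b = f a"
proof -
  have bound: "\<bar>f b - f a\<bar> * real n \<le> (b - a) * (F b - F a)" for n
  proof (cases "n = 0")
    case True
    have "0 \<le> (b - a) * (F b - F a)" using incr[of a b] \<open>a \<le> b\<close> by linarith
    then show ?thesis using True by simp
  next
    case False
    define u where "u k = a + real k * ((b - a) / real n)" for k
    have u0: "u 0 = a" and un: "u n = b" using False by (auto simp: u_def)
    have step: "u (Suc k) - u k = (b - a) / real n" for k
      by (simp only: u_def of_nat_Suc distrib_right)
    have mono: "u k \<le> u l" if "k \<le> l" for k l
      unfolding u_def using that \<open>a \<le> b\<close>
      by (intro add_left_mono mult_right_mono divide_nonneg_nonneg) auto
    have "\<bar>f b - f a\<bar> = \<bar>\<Sum>k<n. f (u (Suc k)) - f (u k)\<bar>"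
      using sum_lessThan_telescope[of "\<lambda>k. f (u k)" n] by (simp add: u0 un)
    also have "\<dots> \<le> (\<Sum>k<n. \<bar>f (u (Suc k)) - f (u k)\<bar>)" by (rule sum_abs)
    also have "\<dots> \<le> (\<Sum>k<n. (b - a) / real n * (F (u (Suc k)) - F (u k)))"
    proof (rule sum_mono)
      fix k assume "k \<in> {..<n}"
      then have "a \<le> u k" "u k \<le> u (Suc k)" "u (Suc k) \<le> b"
        using mono[of 0 k] mono[of k "Suc k"] mono[of "Suc k" n] by (auto simp: u0 un)
      then show "\<bar>f (u (Suc k)) - f (u k)\<bar> \<le> (b - a) / real n * (F (u (Suc k)) - F (u k))"
        using incr step by metis
    qed
    also have "\<dots> = (b - a) / real n * (F b - F a)"
      using sum_lessThan_telescope[of "\<lambda>k. F (u k)" n]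
      by (simp only: sum_distrib_left[symmetric] u0 un)
    finally show ?thesis using False by (simp add: field_simps)
  qed
  have "\<not> \<bar>f b - f a\<bar> > 0"
  proof
    assume "\<bar>f b - f a\<bar> > 0"
    then obtain n :: nat where "(b - a) * (F b - F a) < real n * \<bar>f b - f a\<bar>"
      using reals_Archimedean3 by blast
    then show False using bound[of n] by (simp add: mult.commute)
  qed
  then show ?thesis by simp
qed

text \<open>
  Both \<open>g t - g s\<close> and the integral of \<open>u\<close> over \<open>(s,t]\<close> lie between \<open>s N(s,t]\<close> and \<open>t N(s,t]\<close>, so their
  difference is at most \<open>(t - s) N(s,t]\<close>.
\<close>

lemma integral_from_increments:
  fixes N :: "real measure" and g :: "real \<Rightarrow> real"
  assumes "finite_measure N" and sets: "sets N = sets borel" and "a \<le> b"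
    and lower: "\<And>s t. a \<le> s \<Longrightarrow> s \<le> t \<Longrightarrow> t \<le> b \<Longrightarrow> s * measure N {s<..t} \<le> g t - g s"
    and upper: "\<And>s t. a \<le> s \<Longrightarrow> s \<le> t \<Longrightarrow> t \<le> b \<Longrightarrow> g t - g s \<le> t * measure N {s<..t}"
  shows "(\<integral>u. indicator {a<..b} u * u \<partial>N) = g b - g a"
proof -
  interpret finite_measure N by fact
  have [measurable_cong]: "sets N = sets borel" by (rule sets)
  have [simp]: "space N = UNIV" using sets_eq_imp_space_eq[OF sets] by simp
  have int: "integrable N (\<lambda>u. indicator {s<..t} u * u)" for s t
    by (rule integrable_const_bound[of _ "\<bar>s\<bar> + \<bar>t\<bar>"]) (auto simp: indicator_def)
  have intc: "integrable N (\<lambda>u. indicator {s<..t} u * k)" for s t k :: real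
    by (rule integrable_const_bound[of _ "\<bar>k\<bar>"]) (auto simp: indicator_def)
  have meas: "measure N {s<..t} = measure N {..t} - measure N {..s}" if "s \<le> t" for s t
  proof -
    have "{s<..t} = {..t} - {..s}" by auto
    then show ?thesis using that by (simp add: finite_measure_Diff sets)
  qed
  have I: "s * measure N {s<..t} \<le> (\<integral>u. indicator {s<..t} u * u \<partial>N)"
      "(\<integral>u. indicator {s<..t} u * u \<partial>N) \<le> t * measure N {s<..t}" for s t
  proof -
    have "(\<integral>u. indicator {s<..t} u * s \<partial>N) \<le> (\<integral>u. indicator {s<..t} u * u \<partial>N)"
      "(\<integral>u. indicator {s<..t} u * u \<partial>N) \<le> (\<integral>u. indicator {s<..t} u * t \<partial>N)"
      by (intro integral_mono int intc; simp add: indicator_def)+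
    then show "s * measure N {s<..t} \<le> (\<integral>u. indicator {s<..t} u * u \<partial>N)"
      "(\<integral>u. indicator {s<..t} u * u \<partial>N) \<le> t * measure N {s<..t}"
      by (simp_all add: mult.commute)
  qed
  define f where "f t = g t - (\<integral>u. indicator {a<..t} u * u \<partial>N)" for t
  have "f b = f a"
  proof (rule constant_from_increments[where F = "\<lambda>t. measure N {..t}", OF \<open>a \<le> b\<close>])
    fix s t assume st: "a \<le> s" "s \<le> t" "t \<le> b"
    have "(\<integral>u. indicator {a<..t} u * u \<partial>N)
        = (\<integral>u. indicator {a<..s} u * u + indicator {s<..t} u * u \<partial>N)"
      using st by (intro Bochner_Integration.integral_cong) (auto simp: indicator_def)
    also have "\<dots> = (\<integral>u. indicator {a<..s} u * u \<partial>N) + (\<integral>u. indicator {s<..t} u * u \<partial>N)"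
      by (intro Bochner_Integration.integral_add int)
    finally have "f t - f s = (g t - g s) - (\<integral>u. indicator {s<..t} u * u \<partial>N)"
      by (simp add: f_def)
    then have "\<bar>f t - f s\<bar> \<le> (t - s) * measure N {s<..t}"
      using lower[OF st] upper[OF st] I[of s t] by (simp add: abs_le_iff algebra_simps)
    then show "\<bar>f t - f s\<bar> \<le> (t - s) * (measure N {..t} - measure N {..s})"
      by (simp add: meas[OF st(2)])
  qed
  then show ?thesis by (simp add: f_def)
qed

section \<open>Spectral projections of Borel sets\<close>

lemma borel_atMost_induct [consumes 1, case_names atMost empty compl union]:
  fixes A :: "real set"
  assumes A: "A \<in> sets borel"
    and basic: "\<And>t. P {..t}" and empty: "P {}"
    and compl: "\<And>A. A \<in> sets borel \<Longrightarrow> P A \<Longrightarrow> P (- A)"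
    and union: "\<And>A. disjoint_family A \<Longrightarrow> range A \<subseteq> sets borel \<Longrightarrow> (\<And>i::nat. P (A i))
      \<Longrightarrow> P (\<Union>i. A i)"
  shows "P A"
proof -
  have borel: "sets borel = sigma_sets UNIV (range (\<lambda>a::real. {..a}))"
    by (subst borel_eq_atMost) (simp add: sets_measure_of)
  have stable: "Int_stable (range (\<lambda>a::real. {..a}))"
    by (auto simp: Int_stable_def)
  have closed: "range (\<lambda>a::real. {..a}) \<subseteq> Pow UNIV" by simp
  have "A \<in> sigma_sets UNIV (range (\<lambda>a::real. {..a}))"
    using A by (simp only: borel)
  from stable closed this show ?thesis
  proof (induction rule: sigma_sets_induct_disjoint)
    case (compl A)
    then show ?case using assms(4)[of A] by (simp add: borel Compl_eq_Diff_UNIV)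
  next
    case (union A)
    then show ?case by (intro assms(5)) (auto simp: borel)
  qed (use basic empty in auto)
qed

lemma ortho_proj_form_mono:
  fixes p q :: "'h::real_inner \<Rightarrow>\<^sub>L 'h"
  assumes p: "ortho_proj p" and q: "ortho_proj q" and le: "\<And>x. q (p x) = p x"
  shows "p x \<bullet> x \<le> q x \<bullet> x"
proof -
  have "p (q x) = p x" by (rule ortho_proj_absorb[OF p q le])
  then have "p x \<bullet> x = p (q x) \<bullet> q x"
    using ortho_projD[OF p] ortho_projD[OF q] by metis
  also have "\<dots> \<le> q x \<bullet> q x" by (rule ortho_proj_form_le[OF p])
  finally show ?thesis using ortho_projD(3)[OF q, of x] by simp
qed

text \<open>
  For \<open>y = q x\<close> the hypothesis reads \<open>\<parallel>p y\<parallel>\<^sup>2 + \<parallel>y\<parallel>\<^sup>2 \<le> \<parallel>y\<parallel>\<^sup>2\<close>.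
\<close>

lemma ortho_proj_orthogonal:
  fixes p q :: "'h::real_inner \<Rightarrow>\<^sub>L 'h"
  assumes p: "ortho_proj p" and q: "ortho_proj q" and sum: "\<And>x. p x \<bullet> x + q x \<bullet> x \<le> x \<bullet> x"
  shows "p (q x) = 0"
proof -
  have "p (q x) \<bullet> q x \<le> 0"
    using sum[of "q x"] ortho_projD(1)[OF q] by simp
  then show ?thesis using ortho_projD(3)[OF p, of "q x"] inner_self_nonpos by metis
qed

lemma orthogonal_projections_sum:
  fixes p :: "nat \<Rightarrow> 'h::{real_inner,complete_space} \<Rightarrow>\<^sub>L 'h"
  assumes p: "\<And>n. ortho_proj (p n)" and orth: "\<And>m n x. m \<noteq> n \<Longrightarrow> p m (p n x) = 0"
  obtains T :: "'h \<Rightarrow>\<^sub>L 'h" where "ortho_proj T" "\<And>x. (\<lambda>n. p n x) sums T x"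
proof -
  define q where "q n = (\<Sum>i<n. p i)" for n
  have q0: "q 0 = 0" and qS: "q (Suc n) = q n + p n" for n by (simp_all add: q_def)
  have pq: "p m (q n x) = 0" and qp: "q n (p m x) = 0" if "n \<le> m" for m n x
    using that by (induction n) (auto simp: q0 qS blinfun.bilinear_simps orth)
  have proj: "ortho_proj (q n)" for n
  proof (induction n)
    case (Suc n)
    then show ?case using p[of n]
      by (auto simp: ortho_proj_def qS blinfun.bilinear_simps pq qp intro: symmetric_op_add)
  qed (simp add: q0 ortho_proj_zero)
  have inc: "q n (q m x) = q m x" if "m \<le> n" for m n x
    using that
  proof (induction rule: dec_induct)
    case base
    show ?case by (rule ortho_projD(1)[OF proj])
  next
    case (step n)
    then show ?case by (simp add: qS blinfun.add_left pq)
  qed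
  obtain T :: "'h \<Rightarrow>\<^sub>L 'h" where T: "ortho_proj T" "\<And>x. (\<lambda>n. q n x) \<longlonglongrightarrow> T x"
    by (rule increasing_projections_limit[of q, OF proj inc]) (assumption, rule that)
  have "(\<lambda>n. p n x) sums T x" for x
    using T(2)[of x] by (simp add: sums_def q_def blinfun.sum_left)
  then show ?thesis by (rule that[OF T(1)])
qed

text \<open>
  The measure with distribution function \<open>t \<mapsto> \<langle>E(t) x, x\<rangle>\<close>. Only its values on half-lines refer to projections
  at this stage.
\<close>

definition spectral_distribution :: "('h::real_inner \<Rightarrow>\<^sub>L 'h) \<Rightarrow> 'h \<Rightarrow> real measure" where
  "spectral_distribution c x = interval_measure (\<lambda>t. spectral_family c t x \<bullet> x)"

lemma spectral_distribution:
  fixes c :: "'h::{real_inner,complete_space} \<Rightarrow>\<^sub>L 'h"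
  assumes c: "symmetric_op c"
  shows "finite_measure (spectral_distribution c x)"
    and "sets (spectral_distribution c x) = sets borel"
    and "measure (spectral_distribution c x) {..t} = spectral_family c t x \<bullet> x"
    and "measure (spectral_distribution c x) UNIV = x \<bullet> x"
proof -
  let ?F = "\<lambda>t. spectral_family c t x \<bullet> x"
  have mono: "?F s \<le> ?F t" if "s \<le> t" for s t
    by (rule spectral_family_form_mono[OF c that])
  have right: "continuous (at_right a) ?F" for a
  proof (rule iffD2[OF continuous_at_right_real_increasing[where f = ?F, OF mono]], assumption, intro allI impI)
    fix e :: real assume "e > 0"
    have "(\<lambda>n. ?F (a + 1 / real (Suc n))) \<longlonglongrightarrow> ?F a"
      by (intro tendsto_intros spectral_family_right_continuous[OF c])
    then obtain n where "\<bar>?F (a + 1 / real (Suc n)) - ?F a\<bar> < e"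
      using \<open>e > 0\<close> unfolding LIMSEQ_def dist_real_def by blast
    then show "\<exists>d>0. ?F (a + d) - ?F a < e"
      by (intro exI[of _ "1 / real (Suc n)"]) auto
  qed
  have bot: "(?F \<longlongrightarrow> 0) at_bot"
    by (rule tendsto_eventually) (auto simp: eventually_at_bot_dense spectral_family_below[OF c] intro!: exI[of _ "- norm c"])
  have top: "(?F \<longlongrightarrow> x \<bullet> x) at_top"
    by (rule tendsto_eventually) (auto simp: eventually_at_top_dense spectral_family_above[OF c] intro!: exI[of _ "norm c"])
  have "finite_borel_measure (spectral_distribution c x)"
    unfolding spectral_distribution_def
    by (rule finite_borel_measure_interval_measure[OF mono right bot top]) auto
  then show "finite_measure (spectral_distribution c x)"
    by (simp add: finite_borel_measure_def)
  show "sets (spectral_distribution c x) = sets borel"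
    by (simp add: spectral_distribution_def)
  show "measure (spectral_distribution c x) {..t} = spectral_family c t x \<bullet> x"
    unfolding spectral_distribution_def
    by (rule measure_interval_measure_Iic[OF mono right bot])
  show "measure (spectral_distribution c x) UNIV = x \<bullet> x"
    unfolding spectral_distribution_def measure_def
    by (subst interval_measure_UNIV[OF mono right bot top]) auto
qed

text \<open>
  The Borel sets \<open>A\<close> for which some projection in the bicommutant has the quadratic form \<open>x \<mapsto> \<mu>\<^sub>x(A)\<close> form a
  Dynkin class. For a disjoint union, the projections are mutually orthogonal since the sum of two of
  their forms is at most \<open>\<parallel>x\<parallel>\<^sup>2\<close>, and so their series converges strongly to a projection.
\<close>

lemma borel_projection_exists:
  fixes c :: "'h::{real_inner,complete_space} \<Rightarrow>\<^sub>L 'h"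
  assumes c: "symmetric_op c" and A: "A \<in> sets borel"
  shows "\<exists>p. ortho_proj p \<and> p \<in> bicomm c \<and>
    (\<forall>x. p x \<bullet> x = measure (spectral_distribution c x) A)"
  using A
proof (induction rule: borel_atMost_induct)
  case (atMost t)
  then show ?case using spectral_family(1,2)[OF c] spectral_distribution(3)[OF c] by metis
next
  case empty
  show ?case by (intro exI[of _ 0]) (simp add: ortho_proj_zero bicomm_zero)
next
  case (compl A)
  then obtain p where p: "ortho_proj p" "p \<in> bicomm c"
    "\<And>x. p x \<bullet> x = measure (spectral_distribution c x) A" by blast
  have "(id_blinfun - p) x \<bullet> x = measure (spectral_distribution c x) (- A)" for x
  proof -
    interpret finite_measure "spectral_distribution c x" by (rule spectral_distribution(1)[OF c])
    have "space (spectral_distribution c x) = UNIV"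
      using sets_eq_imp_space_eq[OF spectral_distribution(2)[OF c]] by simp
    then show ?thesis
      using finite_measure_compl[of A] compl(1) spectral_distribution(2,4)[OF c] p(3)[of x]
      by (simp add: Compl_eq_Diff_UNIV blinfun.bilinear_simps inner_diff_left)
  qed
  then show ?case
    using p by (intro exI[of _ "id_blinfun - p"]) (auto intro: ortho_proj_compl bicomm_diff bicomm_id)
next
  case (union A)
  then obtain p where p: "\<And>i. ortho_proj (p i)" "\<And>i. p i \<in> bicomm c"
    "\<And>i x. p i x \<bullet> x = measure (spectral_distribution c x) (A i)" by metis
  have orth: "p m (p n x) = 0" if "m \<noteq> n" for m n x
  proof (rule ortho_proj_orthogonal[OF p(1) p(1)])
    fix x
    interpret finite_measure "spectral_distribution c x" by (rule spectral_distribution(1)[OF c])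
    have "measure (spectral_distribution c x) (A m \<union> A n)
        = measure (spectral_distribution c x) (A m) + measure (spectral_distribution c x) (A n)"
      by (rule finite_measure_Union)
        (use union that spectral_distribution(2)[OF c] in \<open>auto simp: disjoint_family_on_def\<close>)
    moreover have "measure (spectral_distribution c x) (A m \<union> A n) \<le> x \<bullet> x"
      using finite_measure_mono[of "A m \<union> A n" UNIV] spectral_distribution(2,4)[OF c] by simp
    ultimately show "p m x \<bullet> x + p n x \<bullet> x \<le> x \<bullet> x" by (simp add: p(3))
  qed
  obtain T :: "'h \<Rightarrow>\<^sub>L 'h" where T: "ortho_proj T" "\<And>x. (\<lambda>n. p n x) sums T x"
    by (rule orthogonal_projections_sum[of p, OF p(1) orth]) (assumption, rule that)
  have "T x \<bullet> x = measure (spectral_distribution c x) (\<Union>i. A i)" for x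
  proof -
    interpret finite_measure "spectral_distribution c x" by (rule spectral_distribution(1)[OF c])
    have "(\<lambda>i. p i x \<bullet> x) sums (T x \<bullet> x)"
      by (rule bounded_linear.sums[OF bounded_linear_inner_left T(2)])
    moreover have "(\<lambda>i. p i x \<bullet> x) sums measure (spectral_distribution c x) (\<Union>i. A i)"
      unfolding p(3)
      by (rule finite_measure_UNION) (use union spectral_distribution(2)[OF c] in auto)
    ultimately show ?thesis by (rule sums_unique2)
  qed
  moreover have "T \<in> bicomm c"
  proof (rule bicomm_limit)
    show "(\<Sum>i<n. p i) \<in> bicomm c" for n
      by (induction n) (auto intro: bicomm_zero bicomm_add p(2))
    show "(\<lambda>n. (\<Sum>i<n. p i) x) \<longlonglongrightarrow> T x" for x
      using T(2)[of x] by (simp add: sums_def blinfun.sum_left)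
  qed
  ultimately show ?case using T(1) by blast
qed

text \<open>
  This is \<open>1\<^sub>A(c)\<close> for Borel sets \<open>A\<close>. By polarization, the quadratic form determines it.
\<close>

definition borel_projection :: "('h::real_inner \<Rightarrow>\<^sub>L 'h) \<Rightarrow> real set \<Rightarrow> ('h \<Rightarrow>\<^sub>L 'h)" where
  "borel_projection c A = (SOME p. ortho_proj p \<and> p \<in> bicomm c \<and>
    (\<forall>x. p x \<bullet> x = measure (spectral_distribution c x) A))"

lemma borel_projection:
  fixes c :: "'h::{real_inner,complete_space} \<Rightarrow>\<^sub>L 'h"
  assumes "symmetric_op c" and "A \<in> sets borel"
  shows "ortho_proj (borel_projection c A)" "borel_projection c A \<in> bicomm c"
    and "borel_projection c A x \<bullet> x = measure (spectral_distribution c x) A"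
  using someI_ex[OF borel_projection_exists[OF assms]] unfolding borel_projection_def by blast+

lemma borel_projection_atMost:
  fixes c :: "'h::{real_inner,complete_space} \<Rightarrow>\<^sub>L 'h"
  assumes c: "symmetric_op c"
  shows "borel_projection c {..t} = spectral_family c t"
  by (rule symmetric_op_form_eqI)
    (use borel_projection[OF c, of "{..t}"] spectral_family(1)[OF c] spectral_distribution(3)[OF c]
      in \<open>auto simp: ortho_proj_def\<close>)

text \<open>
  The part of \<open>projection_valued_measure\<close> that makes sense on a real space.
\<close>

definition proj_measure :: "(real set \<Rightarrow> 'h::real_inner \<Rightarrow>\<^sub>L 'h) \<Rightarrow> bool" where
  "proj_measure Q \<longleftrightarrow> (\<forall>A\<in>sets borel. ortho_proj (Q A)) \<and> Q UNIV = id_blinfun \<and>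
    (\<forall>A\<in>sets borel. \<forall>B\<in>sets borel. Q (A \<inter> B) = Q A o\<^sub>L Q B) \<and>
    (\<forall>A :: nat \<Rightarrow> real set. range A \<subseteq> sets borel \<longrightarrow> disjoint_family A \<longrightarrow>
      (\<forall>x. (\<lambda>n. Q (A n) x) sums Q (\<Union>n. A n) x))"

lemma proj_measureD:
  fixes Q :: "real set \<Rightarrow> 'h::real_inner \<Rightarrow>\<^sub>L 'h"
  assumes "proj_measure Q"
  shows "A \<in> sets borel \<Longrightarrow> ortho_proj (Q A)" "Q UNIV = id_blinfun"
    "A \<in> sets borel \<Longrightarrow> B \<in> sets borel \<Longrightarrow> Q (A \<inter> B) = Q A o\<^sub>L Q B"
    "range A' \<subseteq> sets borel \<Longrightarrow> disjoint_family A' \<Longrightarrow> (\<lambda>n. Q (A' n) x) sums Q (\<Union>n. A' n) x"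
  using assms unfolding proj_measure_def by blast+

definition form_measure :: "(real set \<Rightarrow> 'h::real_inner \<Rightarrow>\<^sub>L 'h) \<Rightarrow> 'h \<Rightarrow> real measure" where
  "form_measure Q x = measure_of UNIV (sets borel) (\<lambda>A. ennreal (Q A x \<bullet> x))"

lemma proj_measure_empty:
  fixes Q :: "real set \<Rightarrow> 'h::real_inner \<Rightarrow>\<^sub>L 'h"
  assumes Q: "proj_measure Q"
  shows "Q {} = 0"
proof (rule blinfun_eqI)
  fix x
  have "(\<lambda>n. Q {} x) sums Q (\<Union>n::nat. {}) x"
    by (rule proj_measureD(4)[OF Q]) (auto simp: disjoint_family_on_def)
  then have "(\<lambda>n. Q {} x) \<longlonglongrightarrow> 0" using summable_LIMSEQ_zero sums_summable by blast
  then show "Q {} x = (0 :: 'h \<Rightarrow>\<^sub>L 'h) x" by (simp add: LIMSEQ_const_iff)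
qed

lemma proj_measure_union:
  fixes Q :: "real set \<Rightarrow> 'h::real_inner \<Rightarrow>\<^sub>L 'h"
  assumes Q: "proj_measure Q" and AB: "A \<in> sets borel" "B \<in> sets borel" "A \<inter> B = {}"
  shows "Q (A \<union> B) = Q A + Q B"
proof (rule blinfun_eqI)
  fix x
  have "(\<lambda>n. Q (binaryset A B n) x) sums Q (\<Union>n. binaryset A B n) x"
    by (rule proj_measureD(4)[OF Q])
      (use AB in \<open>auto simp: disjoint_family_on_def binaryset_def\<close>)
  moreover have "(\<lambda>n. Q (binaryset A B n) x) sums (\<Sum>n<2. Q (binaryset A B n) x)"
    by (rule sums_finite) (auto simp: binaryset_def proj_measure_empty[OF Q])
  ultimately show "Q (A \<union> B) x = (Q A + Q B) x"
    using sums_unique2 by (fastforce simp: numeral_2_eq_2 binaryset_def UN_binaryset_eq blinfun.add_left)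
qed

lemma proj_measure_compl:
  fixes Q :: "real set \<Rightarrow> 'h::real_inner \<Rightarrow>\<^sub>L 'h"
  assumes Q: "proj_measure Q" and A: "A \<in> sets borel"
  shows "Q (- A) = id_blinfun - Q A"
  using proj_measure_union[OF Q A, of "- A"] A proj_measureD(2)[OF Q]
  by (simp add: Compl_eq_Diff_UNIV algebra_simps)

lemma form_measure:
  fixes Q :: "real set \<Rightarrow> 'h::real_inner \<Rightarrow>\<^sub>L 'h"
  assumes Q: "proj_measure Q"
  shows "sets (form_measure Q x) = sets borel" "space (form_measure Q x) = UNIV"
    and "A \<in> sets borel \<Longrightarrow> emeasure (form_measure Q x) A = ennreal (Q A x \<bullet> x)"
    and "A \<in> sets borel \<Longrightarrow> measure (form_measure Q x) A = Q A x \<bullet> x"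
    and "finite_measure (form_measure Q x)"
proof -
  have nonneg: "0 \<le> Q A x \<bullet> x" if "A \<in> sets borel" for A
    by (rule ortho_proj_form_ge[OF proj_measureD(1)[OF Q that]])
  show sets: "sets (form_measure Q x) = sets borel" "space (form_measure Q x) = UNIV"
    using sets.sigma_sets_eq[of "borel :: real measure"]
    by (simp_all add: form_measure_def)
  have em: "emeasure (form_measure Q x) A = ennreal (Q A x \<bullet> x)" if "A \<in> sets borel" for A
  proof (rule emeasure_measure_of[OF form_measure_def])
    show "positive (sets (form_measure Q x)) (\<lambda>A. ennreal (Q A x \<bullet> x))"
      by (simp add: positive_def proj_measure_empty[OF Q])
    show "countably_additive (sets (form_measure Q x)) (\<lambda>A. ennreal (Q A x \<bullet> x))"
    proof (rule countably_additiveI)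
      fix A :: "nat \<Rightarrow> real set"
      assume A: "range A \<subseteq> sets (form_measure Q x)" "disjoint_family A"
      then have "(\<lambda>n. Q (A n) x \<bullet> x) sums (Q (\<Union>n. A n) x \<bullet> x)"
        by (intro bounded_linear.sums[OF bounded_linear_inner_left] proj_measureD(4)[OF Q])
          (auto simp: sets)
      then show "(\<Sum>i. ennreal (Q (A i) x \<bullet> x)) = ennreal (Q (\<Union>i. A i) x \<bullet> x)"
        using A nonneg by (intro suminf_ennreal_eq) (auto simp: sets)
    qed
  qed (use that sets in auto)
  then show "A \<in> sets borel \<Longrightarrow> emeasure (form_measure Q x) A = ennreal (Q A x \<bullet> x)"
    by blast
  show "A \<in> sets borel \<Longrightarrow> measure (form_measure Q x) A = Q A x \<bullet> x"
    by (simp add: measure_def em nonneg)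
  show "finite_measure (form_measure Q x)"
    by (rule finite_measureI) (simp add: sets em)
qed

lemma borel_projection_add:
  fixes c :: "'h::{real_inner,complete_space} \<Rightarrow>\<^sub>L 'h"
  assumes c: "symmetric_op c" and A: "A \<in> sets borel" "B \<in> sets borel" "A \<inter> B = {}"
  shows "borel_projection c (A \<union> B) = borel_projection c A + borel_projection c B"
proof (rule symmetric_op_form_eqI)
  have P: "symmetric_op (borel_projection c A)" if "A \<in> sets borel" for A
    using borel_projection(1)[OF c that] by (simp add: ortho_proj_def)
  show "symmetric_op (borel_projection c (A \<union> B))"
    "symmetric_op (borel_projection c A + borel_projection c B)"
    using A by (auto intro!: P symmetric_op_add)
  fix x
  interpret finite_measure "spectral_distribution c x" by (rule spectral_distribution(1)[OF c])
  show "borel_projection c (A \<union> B) x \<bullet> x = (borel_projection c A + borel_projection c B) x \<bullet> x"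
    using A finite_measure_Union[of A B] spectral_distribution(2)[OF c]
    by (simp add: blinfun.add_left inner_add_left borel_projection(3)[OF c])
qed

lemma borel_projection_orthogonal:
  fixes c :: "'h::{real_inner,complete_space} \<Rightarrow>\<^sub>L 'h"
  assumes c: "symmetric_op c" and A: "A \<in> sets borel" "B \<in> sets borel" "A \<inter> B = {}"
  shows "borel_projection c A (borel_projection c B x) = 0"
proof (rule ortho_proj_orthogonal[OF borel_projection(1)[OF c A(1)] borel_projection(1)[OF c A(2)]])
  fix x
  have AB: "A \<union> B \<in> sets borel" using A by simp
  have "borel_projection c A x \<bullet> x + borel_projection c B x \<bullet> x = borel_projection c (A \<union> B) x \<bullet> x"
    by (simp add: borel_projection_add[OF c A] blinfun.add_left inner_add_left)
  also have "\<dots> \<le> x \<bullet> x" by (rule ortho_proj_form_le[OF borel_projection(1)[OF c AB]])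
  finally show "borel_projection c A x \<bullet> x + borel_projection c B x \<bullet> x \<le> x \<bullet> x" .
qed

text \<open>
  Multiplicativity follows from additivity: split \<open>A\<close> and \<open>B\<close> along \<open>A \<inter> B\<close>, and use that the projections of
  disjoint sets are orthogonal.
\<close>

lemma proj_measure_borel_projection:
  fixes c :: "'h::{real_inner,complete_space} \<Rightarrow>\<^sub>L 'h"
  assumes c: "symmetric_op c"
  shows "proj_measure (borel_projection c)"
  unfolding proj_measure_def
proof (intro conjI ballI allI impI)
  let ?P = "borel_projection c"
  show "ortho_proj (?P A)" if "A \<in> sets borel" for A by (rule borel_projection(1)[OF c that])
  show "?P UNIV = id_blinfun"
    by (rule symmetric_op_form_eqI)
      (use borel_projection[OF c, of UNIV] spectral_distribution(4)[OF c] symmetric_op_id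
        in \<open>auto simp: ortho_proj_def\<close>)
  show "?P (A \<inter> B) = ?P A o\<^sub>L ?P B" if AB: "A \<in> sets borel" "B \<in> sets borel" for A B
  proof (rule blinfun_eqI)
    fix x
    have A: "?P A = ?P (A \<inter> B) + ?P (A - B)"
      using borel_projection_add[OF c, of "A \<inter> B" "A - B"] AB by (auto simp: Int_Diff_Un)
    have B: "?P B = ?P (A \<inter> B) + ?P (B - A)"
      using borel_projection_add[OF c, of "A \<inter> B" "B - A"] AB
      by (auto simp: Int_commute[of A] Int_Diff_Un)
    have disj: "A \<inter> B \<inter> (B - A) = {}" "(A - B) \<inter> (A \<inter> B) = {}" "(A - B) \<inter> (B - A) = {}"
      by auto
    have meas: "A \<inter> B \<in> sets borel" "A - B \<in> sets borel" "B - A \<in> sets borel"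
      using AB by auto
    have "?P A (?P B x) = ?P (A \<inter> B) (?P (A \<inter> B) x)"
      unfolding A B
      by (simp add: blinfun.bilinear_simps borel_projection_orthogonal[OF c] disj meas)
    then show "?P (A \<inter> B) x = (?P A o\<^sub>L ?P B) x"
      using ortho_projD(1)[OF borel_projection(1)[OF c, of "A \<inter> B"]] AB by simp
  qed
  show "(\<lambda>n. ?P (A n) x) sums ?P (\<Union>n. A n) x"
    if A: "range A \<subseteq> sets borel" "disjoint_family A" for A :: "nat \<Rightarrow> real set" and x
  proof -
    have An: "A n \<in> sets borel" for n using A(1) by auto
    then have AU: "(\<Union>n. A n) \<in> sets borel" by auto
    have orth: "?P (A m) (?P (A n) x) = 0" if "m \<noteq> n" for m n x
      using borel_projection_orthogonal[OF c An An, of m n] A(2) that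
      by (auto simp: disjoint_family_on_def)
    obtain T :: "'h \<Rightarrow>\<^sub>L 'h" where T: "ortho_proj T" "\<And>x. (\<lambda>n. ?P (A n) x) sums T x"
      by (rule orthogonal_projections_sum[of "\<lambda>n. ?P (A n)", OF borel_projection(1)[OF c An] orth]) (assumption, rule that)
    have "T = ?P (\<Union>n. A n)"
    proof (rule symmetric_op_form_eqI)
      show "symmetric_op T" "symmetric_op (?P (\<Union>n. A n))"
        using T(1) borel_projection(1)[OF c AU] by (auto simp: ortho_proj_def)
      fix x
      interpret finite_measure "spectral_distribution c x" by (rule spectral_distribution(1)[OF c])
      have "(\<lambda>n. ?P (A n) x \<bullet> x) sums (T x \<bullet> x)"
        by (rule bounded_linear.sums[OF bounded_linear_inner_left T(2)])
      moreover have "(\<lambda>n. ?P (A n) x \<bullet> x) sums (?P (\<Union>n. A n) x \<bullet> x)"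
        unfolding borel_projection(3)[OF c An] borel_projection(3)[OF c AU]
        by (rule finite_measure_UNION) (use A spectral_distribution(2)[OF c] in auto)
      ultimately show "T x \<bullet> x = ?P (\<Union>n. A n) x \<bullet> x" by (rule sums_unique2)
    qed
    then show ?thesis using T(2) by simp
  qed
qed

section \<open>The spectral theorem\<close>

definition spectral_resolution ::
  "('h::real_inner \<Rightarrow>\<^sub>L 'h) \<Rightarrow> (real set \<Rightarrow> 'h \<Rightarrow>\<^sub>L 'h) \<Rightarrow> bool" where
  "spectral_resolution c Q \<longleftrightarrow> proj_measure Q \<and> (\<exists>K. compact K \<and> Q K = id_blinfun) \<and>
    (\<forall>x. c x \<bullet> x = (\<integral>t. t \<partial>form_measure Q x))"

lemma borel_projection_split:
  fixes c :: "'h::{real_inner,complete_space} \<Rightarrow>\<^sub>L 'h"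
  assumes "symmetric_op c" and st: "s \<le> t"
  shows "borel_projection c {..t} = borel_projection c {..s} + borel_projection c {s<..t}"
proof -
  have "{..t} = {..s} \<union> {s<..t}" "{..s} \<inter> {s<..t} = {}" using st by auto
  then show ?thesis using borel_projection_add[OF assms(1), of "{..s}" "{s<..t}"] by simp
qed

lemma borel_projection_interval_form:
  fixes c :: "'h::{real_inner,complete_space} \<Rightarrow>\<^sub>L 'h"
  assumes c: "symmetric_op c" and st: "s \<le> t"
  defines "R \<equiv> borel_projection c {s<..t}"
  shows "s * (R x \<bullet> R x) \<le> c (R x) \<bullet> R x" "c (R x) \<bullet> R x \<le> t * (R x \<bullet> R x)"
proof -
  let ?E = "spectral_family c"
  have R: "R x = ?E t x - ?E s x" 
    using borel_projection_split[OF c st] by (simp add: R_def borel_projection_atMost[OF c] blinfun.add_left)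
  have "?E s (?E t x) = ?E s x"
    by (rule ortho_proj_absorb[OF spectral_family(1)[OF c] spectral_family(1)[OF c]
          spectral_family_mono[OF c st]])
  then have "R x = ?E t x - ?E s (?E t x)" by (simp add: R)
  then show "s * (R x \<bullet> R x) \<le> c (R x) \<bullet> R x" using spectral_family(4)[OF c] by simp
  have "R x = ?E t (x - ?E s x)"
    by (simp add: R blinfun.diff_right spectral_family_mono[OF c st])
  then show "c (R x) \<bullet> R x \<le> t * (R x \<bullet> R x)" using spectral_family(3)[OF c] by simp
qed

lemma borel_projection_outside:
  fixes c :: "'h::{real_inner,complete_space} \<Rightarrow>\<^sub>L 'h"
  assumes c: "symmetric_op c" and k: "norm c < k"
  shows "borel_projection c {-k<..k} = id_blinfun"
proof -
  have "- k \<le> k" using k norm_ge_zero[of c] by linarith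
  then have "borel_projection c {..k} = borel_projection c {..-k} + borel_projection c {-k<..k}"
    by (rule borel_projection_split[OF c])
  then show ?thesis
    using spectral_family_above[OF c, of k] spectral_family_below[OF c, of "- k"] k
    by (intro blinfun_eqI) (simp add: borel_projection_atMost[OF c] blinfun.add_left)
qed

text \<open>
  As \<open>p\<close> commutes with \<open>A\<close>, the operator \<open>A p\<close> equals the compression \<open>p A p\<close>.
\<close>

lemma positive_op_compression:
  fixes A p :: "'h::real_inner \<Rightarrow>\<^sub>L 'h"
  assumes A: "symmetric_op A" and p: "ortho_proj p" and comm: "\<And>x. p (A x) = A (p x)"
    and pos: "\<And>x. 0 \<le> A (p x) \<bullet> p x"
  shows "positive_op (A o\<^sub>L p)"
proof -
  have "A (p x) \<bullet> p x = A (p x) \<bullet> x" for x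
  proof -
    have "A (p x) \<bullet> p x = p (A (p x)) \<bullet> x" by (rule ortho_projD(2)[OF p, symmetric])
    also have "\<dots> = A (p x) \<bullet> x" by (simp only: comm ortho_projD(1)[OF p])
    finally show ?thesis .
  qed
  moreover have "symmetric_op (A o\<^sub>L p)"
    using A ortho_projD(2)[OF p] comm by (simp add: symmetric_op_def)
  ultimately show ?thesis using pos by (simp add: positive_op_def)
qed

text \<open>
  Stated for an arbitrary positive functional on the bicommutant, since it is needed for the functionals
  \<open>A \<mapsto> \<langle>A x, x\<rangle>\<close>, to recover \<open>c\<close> from its spectral projections, and for the trace. With \<open>R = 1\<^bsub>(s,t]\<^esub>(c)\<close>, positivity
  and \<open>s R \<le> c R \<le> t R\<close> bound the increments of \<open>t \<mapsto> \<phi>(c 1\<^bsub>(-\<infinity>,t]\<^esub>(c))\<close>.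
\<close>

lemma spectral_integral:
  fixes c :: "'h::{real_inner,complete_space} \<Rightarrow>\<^sub>L 'h" and \<phi> :: "('h \<Rightarrow>\<^sub>L 'h) \<Rightarrow> real"
  assumes c: "symmetric_op c"
    and add: "\<And>A B. A \<in> bicomm c \<Longrightarrow> B \<in> bicomm c \<Longrightarrow> \<phi> (A + B) = \<phi> A + \<phi> B"
    and scale: "\<And>A r. A \<in> bicomm c \<Longrightarrow> \<phi> (r *\<^sub>R A) = r * \<phi> A"
    and pos: "\<And>A. A \<in> bicomm c \<Longrightarrow> positive_op A \<Longrightarrow> 0 \<le> \<phi> A"
    and N: "finite_measure N" "sets N = sets borel"
      "\<And>A. A \<in> sets borel \<Longrightarrow> measure N A = \<phi> (borel_projection c A)"
    and k: "norm c < k" "-k \<le> b"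
  shows "(\<integral>u. indicator {-k<..b} u * u \<partial>N) = \<phi> (c o\<^sub>L borel_projection c {..b})"
proof -
  let ?P = "borel_projection c"
  define g where "g t = \<phi> (c o\<^sub>L ?P {..t})" for t
  have Pc: "c o\<^sub>L ?P A \<in> bicomm c" if "A \<in> sets borel" for A
    by (intro bicomm_compose bicomm_self borel_projection(2)[OF c that])
  have incr: "s * measure N {s<..t} \<le> g t - g s \<and> g t - g s \<le> t * measure N {s<..t}"
    if "s \<le> t" for s t
  proof -
    let ?R = "?P {s<..t}"
    have "?P {..t} = ?P {..s} + ?R" by (rule borel_projection_split[OF c that])
    then have "c o\<^sub>L ?P {..t} = (c o\<^sub>L ?P {..s}) + (c o\<^sub>L ?R)"
      by (intro blinfun_eqI) (simp add: blinfun.bilinear_simps)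
    then have g: "g t - g s = \<phi> (c o\<^sub>L ?R)"
      by (simp add: g_def add Pc)
    have R: "?R \<in> bicomm c" "ortho_proj ?R" using borel_projection(1,2)[OF c, of "{s<..t}"] by auto
    have comm: "?R (c x) = c (?R x)" for x by (rule bicomm_commute_self[OF R(1)])
    have cR: "c o\<^sub>L ?R \<in> bicomm c" by (rule Pc) simp
    have shift: "(c - r *\<^sub>R id_blinfun) o\<^sub>L ?R = (c o\<^sub>L ?R) - r *\<^sub>R ?R"
      "(r *\<^sub>R id_blinfun - c) o\<^sub>L ?R = r *\<^sub>R ?R - (c o\<^sub>L ?R)" for r
      by (intro blinfun_eqI; simp add: blinfun.bilinear_simps)+
    have diff: "\<phi> (A - B) = \<phi> A - \<phi> B" if "A \<in> bicomm c" "B \<in> bicomm c" for A B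
      using add[OF bicomm_diff[OF that] that(2)] by simp
    have "positive_op ((c - s *\<^sub>R id_blinfun) o\<^sub>L ?R)"
      by (rule positive_op_compression[OF symmetric_op_diff[OF c symmetric_op_scaleR[OF symmetric_op_id]] R(2)])
        (use borel_projection_interval_form(1)[OF c \<open>s \<le> t\<close>] in
          \<open>auto simp: blinfun.bilinear_simps inner_diff_left comm\<close>)
    then have "0 \<le> \<phi> ((c o\<^sub>L ?R) - s *\<^sub>R ?R)"
      unfolding shift by (intro pos bicomm_diff bicomm_scaleR cR R)
    moreover have "positive_op ((t *\<^sub>R id_blinfun - c) o\<^sub>L ?R)"
      by (rule positive_op_compression[OF symmetric_op_diff[OF symmetric_op_scaleR[OF symmetric_op_id] c] R(2)])
        (use borel_projection_interval_form(2)[OF c \<open>s \<le> t\<close>] in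
          \<open>auto simp: blinfun.bilinear_simps inner_diff_left comm\<close>)
    then have "0 \<le> \<phi> (t *\<^sub>R ?R - (c o\<^sub>L ?R))"
      unfolding shift by (intro pos bicomm_diff bicomm_scaleR cR R)
    ultimately show ?thesis
      by (simp add: diff cR scale R(1) bicomm_scaleR g N(3))
  qed
  have "(\<integral>u. indicator {-k<..b} u * u \<partial>N) = g b - g (- k)"
    by (rule integral_from_increments[OF N(1,2) k(2)]) (use incr in blast)+
  moreover have "?P {..-k} = 0"
    using spectral_family_below[OF c, of "- k"] k(1)
    by (intro blinfun_eqI) (simp add: borel_projection_atMost[OF c])
  then have "g (- k) = 0"
    using scale[of 0 0] by (simp add: g_def bicomm_zero)
  ultimately show ?thesis by (simp add: g_def)
qed

lemma spectral_resolution_borel_projection: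
  fixes c :: "'h::{real_inner,complete_space} \<Rightarrow>\<^sub>L 'h"
  assumes c: "symmetric_op c"
  shows "spectral_resolution c (borel_projection c)"
  unfolding spectral_resolution_def
proof (intro conjI allI)
  let ?P = "borel_projection c"
  define k where "k = norm c + 1"
  have k: "norm c < k" "- k \<le> k" by (simp_all add: k_def)
  show P: "proj_measure ?P" by (rule proj_measure_borel_projection[OF c])
  have id: "?P {-k<..k} = id_blinfun" by (rule borel_projection_outside[OF c k(1)])
  have "?P {-k..k} = id_blinfun"
  proof -
    have "{-k<..k} \<inter> {-k..k} = {-k<..k}" by auto
    then have "?P {-k<..k} = ?P {-k<..k} o\<^sub>L ?P {-k..k}"
      using proj_measureD(3)[OF P, of "{-k<..k}" "{-k..k}"] by simp
    then show ?thesis unfolding id by (intro blinfun_eqI) (metis blinfun_apply_blinfun_compose blinfun_apply_id_blinfun id_apply)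
  qed
  then show "\<exists>K. compact K \<and> ?P K = id_blinfun" by (intro exI[of _ "{-k..k}"]) simp
  show "c x \<bullet> x = (\<integral>t. t \<partial>form_measure ?P x)" for x
  proof -
    let ?N = "form_measure ?P x"
    interpret finite_measure ?N by (rule form_measure(5)[OF P])
    have "(\<integral>u. indicator {-k<..k} u * u \<partial>?N) = (c o\<^sub>L ?P {..k}) x \<bullet> x"
      by (rule spectral_integral[OF c, where \<phi> = "\<lambda>A. A x \<bullet> x"])
        (use form_measure[OF P, where x = x] k in
          \<open>auto simp: blinfun.bilinear_simps inner_add_left positive_op_def\<close>)
    also have "\<dots> = c x \<bullet> x"
      using spectral_family_above[OF c k(1)] by (simp add: borel_projection_atMost[OF c])
    also have "(\<integral>u. indicator {-k<..k} u * u \<partial>?N) = (\<integral>t. t \<partial>?N)"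
    proof (rule integral_cong_AE)
      have "measure ?N {-k<..k} = measure ?N UNIV"
        using form_measure(4)[OF P, of _ x] id proj_measureD(2)[OF P] by simp
      then have "measure ?N (UNIV - {-k<..k}) = 0"
        using finite_measure_compl[of "{-k<..k}"] form_measure(1,2)[OF P, of x] by simp
      then have "UNIV - {-k<..k} \<in> null_sets ?N"
        using form_measure(1)[OF P, of x] by (intro null_setsI) (auto simp: emeasure_eq_measure)
      then have "AE t in ?N. t \<notin> UNIV - {-k<..k}" by (rule AE_not_in)
      then show "AE t in ?N. indicator {-k<..k} t * t = t" by eventually_elim auto
    qed (simp_all add: measurable_cong_sets[OF form_measure(1)[OF P] refl])
    finally show ?thesis by simp
  qed
qed

text \<open>
  The measure of the vector \<open>Q(A) x\<close> is the measure of \<open>x\<close> restricted to \<open>A\<close>.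
\<close>

lemma spectral_resolution_restrict:
  fixes c :: "'h::real_inner \<Rightarrow>\<^sub>L 'h"
  assumes Q: "spectral_resolution c Q" and A: "A \<in> sets borel"
  shows "c (Q A x) \<bullet> Q A x = (\<integral>t. indicator A t * t \<partial>form_measure Q x)"
    and "integrable (form_measure Q x) (\<lambda>t. indicator A t * t)"
proof -
  let ?N = "form_measure Q x"
  have P: "proj_measure Q" using Q by (simp add: spectral_resolution_def)
  note F = form_measure[OF P]
  have [measurable_cong]: "sets ?N = sets borel" by (rule F)
  have "form_measure Q (Q A x) = density ?N (\<lambda>t. ennreal (indicator A t))"
  proof (rule measure_eqI)
    fix B assume "B \<in> sets (form_measure Q (Q A x))"
    then have B: "B \<in> sets borel" by (simp add: F)
    have "Q B (Q A x) \<bullet> Q A x = Q (A \<inter> B) x \<bullet> x"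
      using proj_measureD(3)[OF P A B] proj_measureD(3)[OF P B A] 
        ortho_projD[OF proj_measureD(1)[OF P A]] ortho_projD[OF proj_measureD(1)[OF P B]]
      by (metis (no_types, lifting) Int_commute blinfun_apply_blinfun_compose)
    then have "emeasure (form_measure Q (Q A x)) B = emeasure ?N (A \<inter> B)"
      using A B by (simp add: F)
    also have "\<dots> = (\<integral>\<^sup>+t. indicator (A \<inter> B) t \<partial>?N)"
      using A B by (simp add: F(1))
    also have "\<dots> = (\<integral>\<^sup>+t. ennreal (indicator A t) * indicator B t \<partial>?N)"
      by (intro nn_integral_cong) (simp add: indicator_def)
    also have "\<dots> = emeasure (density ?N (\<lambda>t. ennreal (indicator A t))) B"
      using A B by (subst emeasure_density) (auto simp: F(1))
    finally show "emeasure (form_measure Q (Q A x)) B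
        = emeasure (density ?N (\<lambda>t. ennreal (indicator A t))) B" .
  qed (simp add: F)
  then have "c (Q A x) \<bullet> Q A x = (\<integral>t. t \<partial>density ?N (\<lambda>t. ennreal (indicator A t)))"
    using Q by (simp add: spectral_resolution_def)
  also have "\<dots> = (\<integral>t. indicator A t *\<^sub>R t \<partial>?N)"
    using A by (intro integral_density) auto
  finally show "c (Q A x) \<bullet> Q A x = (\<integral>t. indicator A t * t \<partial>?N)" by simp
  obtain K where K: "compact K" "Q K = id_blinfun" using Q by (auto simp: spectral_resolution_def)
  interpret finite_measure ?N by (rule F)
  obtain r where r: "\<And>t. t \<in> K \<Longrightarrow> \<bar>t\<bar> \<le> r"
    using compact_imp_bounded[OF K(1)] by (auto simp: bounded_iff)
  have Kb: "K \<in> sets borel" using K(1) by (simp add: borel_closed compact_imp_closed)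
  have "measure ?N K = measure ?N UNIV"
    using F(4)[OF Kb, of x] F(4)[of UNIV x] K(2) proj_measureD(2)[OF P] by simp
  then have "measure ?N (UNIV - K) = 0"
    using finite_measure_compl[of K] Kb F(1,2)[of x] by simp
  then have "UNIV - K \<in> null_sets ?N"
    using F(1)[of x] Kb by (intro null_setsI) (auto simp: emeasure_eq_measure)
  then have "AE t in ?N. t \<notin> UNIV - K" by (rule AE_not_in)
  then have "AE t in ?N. norm (indicator A t * t) \<le> \<bar>r\<bar>"
    by eventually_elim (use r in \<open>force simp: indicator_def\<close>)
  then show "integrable ?N (\<lambda>t. indicator A t * t)"
    using A by (intro integrable_const_bound[of _ "\<bar>r\<bar>"]) auto
qed

text \<open>
  The integral representation is additive over \<open>A\<close> and its complement, so
  \<open>\<langle>c z, z\<rangle> = \<langle>c Q(A) z, Q(A) z\<rangle> + \<langle>c Q(-A) z, Q(-A) z\<rangle>\<close>. The cross terms therefore vanish, and \<open>c\<close> leaves both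
  ranges invariant.
\<close>

lemma spectral_resolution_commute:
  fixes c :: "'h::real_inner \<Rightarrow>\<^sub>L 'h"
  assumes c: "symmetric_op c" and Q: "spectral_resolution c Q" and A: "A \<in> sets borel"
  shows "c (Q A x) = Q A (c x)"
proof -
  have P: "proj_measure Q" using Q by (simp add: spectral_resolution_def)
  have cA: "- A \<in> sets borel" using A by auto
  note p = proj_measureD(1)[OF P A]
  have cross: "c (Q A x) \<bullet> (y - Q A y) = 0" for x y
  proof -
    define u v where "u = Q A x" and "v = y - Q A y"
    have Qu: "Q A (u + v) = u" and Qv: "Q (- A) (u + v) = v"
      by (simp_all add: u_def v_def proj_measure_compl[OF P A] blinfun.bilinear_simps ortho_projD(1)[OF p])
    have "c (u + v) \<bullet> (u + v) = (\<integral>t. indicator A t * t + indicator (- A) t * t \<partial>form_measure Q (u + v))"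
      using Q by (auto simp: spectral_resolution_def indicator_def intro!: Bochner_Integration.integral_cong)
    also have "\<dots> = c u \<bullet> u + c v \<bullet> v"
      using spectral_resolution_restrict[OF Q A, of "u + v"]
        spectral_resolution_restrict[OF Q cA, of "u + v"]
      by (simp only: Bochner_Integration.integral_add Qu Qv)
    finally have "c u \<bullet> v + c v \<bullet> u = 0"
      by (simp add: blinfun.bilinear_simps inner_simps)
    moreover have "c v \<bullet> u = c u \<bullet> v"
      using symmetric_opD[OF c, of v u] by (simp add: inner_commute)
    ultimately show ?thesis by (simp add: u_def v_def)
  qed
  define w where "w = c (Q A x) - Q A (c (Q A x))"
  have "w \<bullet> w = c (Q A x) \<bullet> w - Q A (c (Q A x)) \<bullet> w" by (simp add: w_def inner_diff_left)
  also have "c (Q A x) \<bullet> w = 0" unfolding w_def by (rule cross)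
  also have "Q A (c (Q A x)) \<bullet> w = c (Q A x) \<bullet> Q A w" by (rule ortho_projD(2)[OF p])
  also have "Q A w = 0" by (simp add: w_def blinfun.diff_right ortho_projD(1)[OF p])
  finally have 1: "c (Q A x) = Q A (c (Q A x))" by (simp add: w_def)
  define z where "z = Q A (c (x - Q A x))"
  have "z \<bullet> z = c (x - Q A x) \<bullet> Q A z" unfolding z_def by (rule ortho_projD(2)[OF p])
  also have "\<dots> = (x - Q A x) \<bullet> c (Q A z)" by (rule symmetric_opD[OF c])
  also have "\<dots> = 0" using cross[of z x] by (simp add: inner_commute)
  finally have "Q A (c x) = Q A (c (Q A x))" by (simp add: z_def blinfun.diff_right)
  then show ?thesis using 1 by simp
qed

text \<open>
  The projections \<open>Q(-\<infinity>,s]\<close> cut \<open>c\<close> at \<open>s\<close>, and they commute with the spectral family, which lies in the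
  bicommutant. By comparison \<open>Q(-\<infinity>,s] \<le> E(t)\<close> and \<open>E(s) \<le> Q(-\<infinity>,t]\<close> for \<open>s < t\<close>, and both families are
  right-continuous.
\<close>

lemma spectral_resolution_unique_atMost:
  fixes c :: "'h::{real_inner,complete_space} \<Rightarrow>\<^sub>L 'h"
  assumes c: "symmetric_op c" and Q: "spectral_resolution c Q"
  shows "Q {..a} = spectral_family c a"
proof (rule symmetric_op_form_eqI)
  have P: "proj_measure Q" using Q by (simp add: spectral_resolution_def)
  have p: "ortho_proj (Q A)" if "A \<in> sets borel" for A by (rule proj_measureD(1)[OF P that])
  let ?E = "spectral_family c"
  have e: "ortho_proj (?E t)" for t by (rule spectral_family(1)[OF c])
  show "symmetric_op (Q {..a})" "symmetric_op (?E a)"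
    using p[of "{..a}"] e by (auto simp: ortho_proj_def)
  have comm: "?E t (Q {..s} x) = Q {..s} (?E t x)" for s t x
    using bicommD[OF spectral_family(2)[OF c], of "Q {..s}"]
      spectral_resolution_commute[OF c Q, of "{..s}"] by simp
  have below: "c (Q {..s} x) \<bullet> Q {..s} x \<le> s * (Q {..s} x \<bullet> Q {..s} x)" for s x
  proof -
    interpret finite_measure "form_measure Q x" by (rule form_measure(5)[OF P])
    have "(\<integral>t. indicator {..s} t * t \<partial>form_measure Q x) \<le> (\<integral>t. indicator {..s} t * s \<partial>form_measure Q x)"
      by (intro integral_mono spectral_resolution_restrict(2)[OF Q] integrable_mult_left integrable_real_indicator)
        (auto simp: indicator_def emeasure_eq_measure form_measure(1)[OF P])
    also have "\<dots> = s * measure (form_measure Q x) {..s}"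
      using form_measure(2)[OF P, of x] by simp
    also have "\<dots> = s * (Q {..s} x \<bullet> Q {..s} x)"
      using form_measure(4)[OF P, of "{..s}" x] ortho_projD(3)[OF p, of "{..s}" x] by simp
    finally show ?thesis using spectral_resolution_restrict(1)[OF Q, of "{..s}" x] by simp
  qed
  have above: "s * ((x - Q {..s} x) \<bullet> (x - Q {..s} x)) \<le> c (x - Q {..s} x) \<bullet> (x - Q {..s} x)" for s x
  proof -
    interpret finite_measure "form_measure Q x" by (rule form_measure(5)[OF P])
    have R: "x - Q {..s} x = Q (- {..s}) x"
      by (subst proj_measure_compl[OF P]) (simp_all add: blinfun.diff_left)
    have "s * measure (form_measure Q x) (- {..s}) = (\<integral>t. indicator (- {..s}) t * s \<partial>form_measure Q x)"
      using form_measure(2)[OF P, of x] by simp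
    also have "\<dots> \<le> (\<integral>t. indicator (- {..s}) t * t \<partial>form_measure Q x)"
      by (intro integral_mono spectral_resolution_restrict(2)[OF Q] integrable_mult_left integrable_real_indicator)
        (auto simp: indicator_def emeasure_eq_measure form_measure(1)[OF P])
    finally have "s * measure (form_measure Q x) (- {..s}) \<le> c (Q (- {..s}) x) \<bullet> Q (- {..s}) x"
      using spectral_resolution_restrict(1)[OF Q, of "- {..s}" x] by simp
    then show ?thesis
      using form_measure(4)[OF P, of "- {..s}" x] ortho_projD(3)[OF p, of "- {..s}" x]
      by (simp add: R)
  qed
  fix x
  have le1: "Q {..s} x \<bullet> x \<le> ?E t x \<bullet> x" if "s < t" for s t
    by (rule ortho_proj_form_mono[OF p e], simp,
        rule spectral_cut_comparison[OF comm[symmetric] that below spectral_family(4)[OF c]])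
  have le2: "?E s x \<bullet> x \<le> Q {..t} x \<bullet> x" if "s < t" for s t
    by (rule ortho_proj_form_mono[OF e p], simp,
        rule spectral_cut_comparison[OF comm that spectral_family(3)[OF c] above])
  show "Q {..a} x \<bullet> x = ?E a x \<bullet> x"
  proof (rule antisym)
    have "(\<lambda>n. ?E (a + 1 / real (Suc n)) x \<bullet> x) \<longlonglongrightarrow> ?E a x \<bullet> x"
      by (intro tendsto_intros spectral_family_right_continuous[OF c])
    then show "Q {..a} x \<bullet> x \<le> ?E a x \<bullet> x"
      by (rule LIMSEQ_le_const) (auto intro!: le1)
    interpret finite_measure "form_measure Q x" by (rule form_measure(5)[OF P])
    have "(\<lambda>n. measure (form_measure Q x) {..a + 1 / real (Suc n)})
        \<longlonglongrightarrow> measure (form_measure Q x) (\<Inter>n. {..a + 1 / real (Suc n)})"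
    proof (rule finite_Lim_measure_decseq)
      show "decseq (\<lambda>n. {..a + 1 / real (Suc n)})"
        by (rule decseq_SucI) (auto intro: order_trans simp: frac_le)
    qed (auto simp: form_measure(1)[OF P])
    moreover have "(\<Inter>n. {..a + 1 / real (Suc n)}) = {..a}"
    proof (intro equalityI subsetI)
      fix t assume t: "t \<in> (\<Inter>n. {..a + 1 / real (Suc n)})"
      show "t \<in> {..a}"
      proof (rule ccontr)
        assume "t \<notin> {..a}"
        then obtain n where "1 / real (Suc n) < t - a"
          using reals_Archimedean[of "t - a"] by (auto simp: inverse_eq_divide)
        then show False using t by (auto dest: spec[of _ n])
      qed
    qed (auto intro: order_trans)
    ultimately have "(\<lambda>n. Q {..a + 1 / real (Suc n)} x \<bullet> x) \<longlonglongrightarrow> Q {..a} x \<bullet> x"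
      by (simp add: form_measure(4)[OF P])
    then show "?E a x \<bullet> x \<le> Q {..a} x \<bullet> x"
      by (rule LIMSEQ_le_const) (auto intro!: le2)
  qed
qed

lemma spectral_resolution_unique:
  fixes c :: "'h::{real_inner,complete_space} \<Rightarrow>\<^sub>L 'h"
  assumes c: "symmetric_op c" and Q: "spectral_resolution c Q" and A: "A \<in> sets borel"
  shows "Q A = borel_projection c A"
proof -
  have P: "proj_measure Q" using Q by (simp add: spectral_resolution_def)
  have P': "proj_measure (borel_projection c)" by (rule proj_measure_borel_projection[OF c])
  show ?thesis
    using A
  proof (induction rule: borel_atMost_induct)
    case (atMost t)
    show ?case
      by (simp add: spectral_resolution_unique_atMost[OF c Q] borel_projection_atMost[OF c])
  next
    case empty
    show ?case by (simp add: proj_measure_empty[OF P] proj_measure_empty[OF P'])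
  next
    case (compl A)
    then show ?case by (simp add: proj_measure_compl[OF P] proj_measure_compl[OF P'])
  next
    case (union A)
    show ?case
    proof (rule blinfun_eqI)
      fix x
      have "(\<lambda>n. Q (A n) x) sums Q (\<Union>n. A n) x"
        by (rule proj_measureD(4)[OF P union(2,1)])
      moreover have "(\<lambda>n. borel_projection c (A n) x) sums borel_projection c (\<Union>n. A n) x"
        by (rule proj_measureD(4)[OF P' union(2,1)])
      ultimately show "Q (\<Union>n. A n) x = borel_projection c (\<Union>n. A n) x"
        using union(3) sums_unique2 by fastforce
    qed
  qed
qed

section \<open>Von Neumann algebras\<close>

lemma Im_cinner: "Im (cinner x y) = ((- \<i>) *\<^sub>C x) \<bullet> y" for x y :: "'h::complex_hilbert"
  by (simp add: Re_cinner[symmetric] cinner_scaleC_left)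

lemma symmetric_op_self_adjoint:
  fixes A :: "'h::complex_hilbert \<Rightarrow>\<^sub>L 'h"
  assumes "self_adjoint A"
  shows "symmetric_op A"
  using assms unfolding self_adjoint_def is_adjoint_def symmetric_op_def
  by (metis Re_cinner)

lemma self_adjoint_symmetric_op:
  fixes A :: "'h::complex_hilbert \<Rightarrow>\<^sub>L 'h"
  assumes "A \<in> bounded_ops" "symmetric_op A"
  shows "self_adjoint A"
  unfolding self_adjoint_def is_adjoint_def
proof (intro allI complex_eqI)
  fix x y
  show "Re (cinner (A x) y) = Re (cinner x (A y))"
    using assms(2) by (simp add: Re_cinner symmetric_op_def)
  have "(- \<i>) *\<^sub>C A x = A ((- \<i>) *\<^sub>C x)"
    using assms(1) by (simp add: bounded_ops_def)
  then show "Im (cinner (A x) y) = Im (cinner x (A y))"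
    using assms(2) by (simp add: Im_cinner symmetric_op_def)
qed

text \<open>
  Multiplication by the scalar \<open>z\<close> is a bounded real-linear operator that commutes with \<open>c\<close>.
\<close>

lemma bicomm_bounded_ops:
  fixes c :: "'h::complex_hilbert \<Rightarrow>\<^sub>L 'h"
  assumes c: "c \<in> bounded_ops" and T: "T \<in> bicomm c"
  shows "T \<in> bounded_ops"
  unfolding bounded_ops_def mem_Collect_eq
proof (intro allI)
  fix z x
  have "scaleC_op z id_blinfun (T x) = T (scaleC_op z id_blinfun x)"
    by (rule bicommD[OF T]) (use c in \<open>simp add: scaleC_op.rep_eq bounded_ops_def\<close>)
  then show "T (z *\<^sub>C x) = z *\<^sub>C T x" by (simp add: scaleC_op.rep_eq)
qed

lemma commutantD:
  fixes S :: "('h::complex_hilbert \<Rightarrow>\<^sub>L 'h) set"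
    and T A :: "'h \<Rightarrow>\<^sub>L 'h"
  assumes "T \<in> commutant S"
  shows "T \<in> bounded_ops" "A \<in> S \<Longrightarrow> T (A x) = A (T x)"
  using assms unfolding commutant_def
  by (blast, metis (mono_tags, lifting) blinfun_apply_blinfun_compose mem_Collect_eq)

lemma commutantI:
  fixes S :: "('h::complex_hilbert \<Rightarrow>\<^sub>L 'h) set"
    and T :: "'h \<Rightarrow>\<^sub>L 'h"
  assumes "T \<in> bounded_ops" "\<And>(A :: 'h \<Rightarrow>\<^sub>L 'h) x. A \<in> S \<Longrightarrow> T (A x) = A (T x)"
  shows "T \<in> commutant S"
  using assms unfolding commutant_def by (auto intro: blinfun_eqI)

lemma
  fixes M :: "('h::complex_hilbert \<Rightarrow>\<^sub>L 'h) set"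
  assumes M: "von_neumann_algebra M"
  shows von_neumann_algebra_bounded_ops: "A \<in> M \<Longrightarrow> A \<in> bounded_ops"
    and von_neumann_algebra_id: "id_blinfun \<in> M"
    and von_neumann_algebra_add: "A \<in> M \<Longrightarrow> B \<in> M \<Longrightarrow> A + B \<in> M"
    and von_neumann_algebra_compose: "A \<in> M \<Longrightarrow> B \<in> M \<Longrightarrow> A o\<^sub>L B \<in> M"
    and von_neumann_algebra_scaleR: "A \<in> M \<Longrightarrow> r *\<^sub>R A \<in> M"
    and von_neumann_algebra_bicomm: "A \<in> M \<Longrightarrow> T \<in> bicomm A \<Longrightarrow> T \<in> M"
proof -
  let ?M' = "commutant M"
  have eq: "commutant ?M' = M" using M by (simp add: von_neumann_algebra_def)
  have b: "A \<in> bounded_ops" if "A \<in> M" for A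
    using commutantD(1)[of A ?M'] that eq by simp
  have comm: "A (S x) = S (A x)" if "A \<in> M" "S \<in> ?M'" for A S x
    using commutantD(2)[of A ?M' S x] that eq by simp
  show "A \<in> bounded_ops" if "A \<in> M" by (rule b[OF that])
  show "id_blinfun \<in> M"
    by (subst eq[symmetric], rule commutantI) (simp_all add: bounded_ops_def)
  show "A + B \<in> M" if "A \<in> M" "B \<in> M"
    by (subst eq[symmetric], rule commutantI)
      (use b[OF that(1)] b[OF that(2)] comm[OF that(1)] comm[OF that(2)] in
        \<open>auto simp: bounded_ops_def blinfun.bilinear_simps scaleC_add_right\<close>)
  show "A o\<^sub>L B \<in> M" if "A \<in> M" "B \<in> M"
    by (subst eq[symmetric], rule commutantI)
      (use b[OF that(1)] b[OF that(2)] comm[OF that(1)] comm[OF that(2)] in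
        \<open>auto simp: bounded_ops_def\<close>)
  have swap: "r *\<^sub>R (z *\<^sub>C x) = z *\<^sub>C (r *\<^sub>R x)" for r z and x :: 'h
    by (metis mult.commute scaleC_of_real scaleC_scaleC)
  show "r *\<^sub>R A \<in> M" if "A \<in> M"
    by (subst eq[symmetric], rule commutantI)
      (use b[OF that] comm[OF that] in
        \<open>auto simp: bounded_ops_def blinfun.bilinear_simps swap\<close>)
  show "T \<in> M" if "A \<in> M" "T \<in> bicomm A"
  proof (subst eq[symmetric], rule commutantI)
    show "T \<in> bounded_ops" by (rule bicomm_bounded_ops[OF b[OF that(1)] that(2)])
    show "T (S x) = S (T x)" if "S \<in> ?M'" for S x
      using bicommD[OF \<open>T \<in> bicomm A\<close>, of S x] comm[OF \<open>A \<in> M\<close> that] by simp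
  qed
qed

lemma von_neumann_algebra_diff:
  fixes M :: "('h::complex_hilbert \<Rightarrow>\<^sub>L 'h) set"
  assumes M: "von_neumann_algebra M" and "A \<in> M" "B \<in> M"
  shows "A - B \<in> M"
  using von_neumann_algebra_add[OF M assms(2) von_neumann_algebra_scaleR[OF M assms(3), of "- 1"]]
  by simp

lemma scalar_spectral_measure_eq_form_measure: "scalar_spectral_measure P x = form_measure P x"
  by (simp add: scalar_spectral_measure_def form_measure_def Re_cinner)

lemma spectral_resolution_of_is_spectral_measure:
  fixes c :: "'h::complex_hilbert \<Rightarrow>\<^sub>L 'h"
  assumes "is_spectral_measure c P"
  shows "spectral_resolution c P"
proof -
  have P: "projection_valued_measure P" and int: "\<And>x. cinner (c x) x = complex_of_real (\<integral>t. t \<partial>form_measure P x)"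
    and K: "\<exists>K. compact K \<and> P K = id_blinfun"
    using assms by (auto simp: is_spectral_measure_def scalar_spectral_measure_eq_form_measure)
  have "ortho_proj (P A)" if "A \<in> sets borel" for A
  proof (rule ortho_projI)
    show "symmetric_op (P A)"
      using P that by (intro symmetric_op_self_adjoint) (simp add: projection_valued_measure_def)
    show "P A (P A x) = P A x" for x
      using P that unfolding projection_valued_measure_def by (metis blinfun_apply_blinfun_compose)
  qed
  then have "proj_measure P"
    using P by (simp add: proj_measure_def projection_valued_measure_def)
  moreover have "c x \<bullet> x = (\<integral>t. t \<partial>form_measure P x)" for x
    using arg_cong[OF int[of x], of Re] by (simp add: Re_cinner)
  ultimately show ?thesis using K by (simp add: spectral_resolution_def)
qed

lemma is_spectral_measure_borel_projection:
  fixes c :: "'h::complex_hilbert \<Rightarrow>\<^sub>L 'h"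
  assumes c: "c \<in> bounded_ops" "self_adjoint c"
  shows "is_spectral_measure c (borel_projection c)"
proof -
  have sym: "symmetric_op c" by (rule symmetric_op_self_adjoint[OF c(2)])
  have R: "spectral_resolution c (borel_projection c)"
    by (rule spectral_resolution_borel_projection[OF sym])
  have P: "borel_projection c A \<in> bounded_ops \<and> self_adjoint (borel_projection c A) \<and>
      borel_projection c A o\<^sub>L borel_projection c A = borel_projection c A" if A: "A \<in> sets borel" for A
  proof -
    have b: "borel_projection c A \<in> bounded_ops"
      by (rule bicomm_bounded_ops[OF c(1) borel_projection(2)[OF sym A]])
    then show ?thesis
      using borel_projection(1)[OF sym A] self_adjoint_symmetric_op[OF b]
      by (auto simp: ortho_proj_def intro: blinfun_eqI)
  qed
  have "cinner (c x) x = complex_of_real (\<integral>t. t \<partial>form_measure (borel_projection c) x)" for x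
  proof -
    have "cinner (c x) x = cnj (cinner (c x) x)"
      using c(2) cinner_commute[of "c x" x] by (simp add: self_adjoint_def is_adjoint_def)
    then have "Im (cinner (c x) x) = 0" by (simp add: complex_eq_iff)
    then show ?thesis
      using R by (simp add: complex_eq_iff Re_cinner spectral_resolution_def)
  qed
  then show ?thesis
    using R P by (simp add: is_spectral_measure_def projection_valued_measure_def
        spectral_resolution_def proj_measure_def scalar_spectral_measure_eq_form_measure)
qed

lemma spectral_projection_eq_borel_projection:
  fixes c :: "'h::complex_hilbert \<Rightarrow>\<^sub>L 'h"
  assumes c: "c \<in> bounded_ops" "self_adjoint c" and A: "A \<in> sets borel"
  shows "spectral_projection c A = borel_projection c A"
  unfolding spectral_projection_def
proof (rule the_equality)
  show "\<exists>P. is_spectral_measure c P \<and> borel_projection c A = P A"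
    using is_spectral_measure_borel_projection[OF c] by blast
  show "p = borel_projection c A" if "\<exists>P. is_spectral_measure c P \<and> p = P A" for p
    using that spectral_resolution_unique[OF symmetric_op_self_adjoint[OF c(2)] _ A]
      spectral_resolution_of_is_spectral_measure by blast
qed

section \<open>Normal tracial states\<close>

text \<open>
  The factor 2 comes from estimating real and imaginary part separately. Any constant suffices for
  dominated convergence.
\<close>

lemma norm_cinner_le: "cmod (cinner x y) \<le> 2 * (norm x * norm y)" for x y :: "'h::complex_hilbert"
proof -
  have "\<bar>Re (cinner x y)\<bar> \<le> norm x * norm y"
    by (simp add: Re_cinner Cauchy_Schwarz_ineq2)
  moreover have "\<bar>Im (cinner x y)\<bar> \<le> norm x * norm y"
    using Cauchy_Schwarz_ineq2[of "(- \<i>) *\<^sub>C x" y] by (simp add: Im_cinner norm_scaleC)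
  ultimately show ?thesis using cmod_le[of "cinner x y"] by linarith
qed

lemma tendsto_cinner_left:
  fixes y :: "'h::complex_hilbert"
  assumes "(f \<longlongrightarrow> x) F"
  shows "((\<lambda>n. cinner (f n) y) \<longlongrightarrow> cinner x y) F"
  unfolding tendsto_complex_iff Re_cinner Im_cinner
  by (intro conjI tendsto_inner tendsto_const assms
      bounded_linear.tendsto[OF bounded_linear_scaleC])

text \<open>
  Dominated convergence for series: on the unit ball of \<open>M\<close> the terms \<open>\<langle>A \<xi>\<^sub>k, \<eta>\<^sub>k\<rangle>\<close> are bounded by the summable
  sequence \<open>\<parallel>\<xi>\<^sub>k\<parallel>\<^sup>2 + \<parallel>\<eta>\<^sub>k\<parallel>\<^sup>2\<close>.
\<close>

lemma predual_strongly_continuous: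
  fixes A :: "nat \<Rightarrow> 'h::complex_hilbert \<Rightarrow>\<^sub>L 'h" and T :: "'h \<Rightarrow>\<^sub>L 'h"
  assumes \<tau>: "\<tau> \<in> predual M" and A: "\<And>n. A n \<in> M" "\<And>n. norm (A n) \<le> 1"
    and T: "T \<in> M" "\<And>x. (\<lambda>n. A n x) \<longlonglongrightarrow> T x"
  shows "(\<lambda>n. \<tau> (A n)) \<longlonglongrightarrow> \<tau> T"
proof -
  obtain \<xi> \<eta> :: "nat \<Rightarrow> 'h" where s: "summable (\<lambda>n. (norm (\<xi> n))\<^sup>2)" "summable (\<lambda>n. (norm (\<eta> n))\<^sup>2)"
    and \<tau>: "\<And>B. B \<in> M \<Longrightarrow> \<tau> B = (\<Sum>n. cinner (B (\<xi> n)) (\<eta> n))"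
    using \<tau> unfolding predual_def by blast
  have "(\<lambda>n. \<Sum>k. cinner (A n (\<xi> k)) (\<eta> k)) \<longlonglongrightarrow> (\<Sum>k. cinner (T (\<xi> k)) (\<eta> k))"
  proof (rule conjunct2[OF conjunct2[OF tannerys_theorem]])
    show "(\<lambda>n. cinner (A n (\<xi> k)) (\<eta> k)) \<longlonglongrightarrow> cinner (T (\<xi> k)) (\<eta> k)" for k
      by (rule tendsto_cinner_left[OF T(2)])
    show "summable (\<lambda>k. (norm (\<xi> k))\<^sup>2 + (norm (\<eta> k))\<^sup>2)"
      by (rule summable_add[OF s])
    have "norm (cinner (A n (\<xi> k)) (\<eta> k)) \<le> (norm (\<xi> k))\<^sup>2 + (norm (\<eta> k))\<^sup>2" for k n
    proof -
      have "norm (A n (\<xi> k)) \<le> norm (\<xi> k)"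
        using order_trans[OF norm_blinfun mult_right_mono[OF A(2) norm_ge_zero]] by simp
      then have "2 * (norm (A n (\<xi> k)) * norm (\<eta> k)) \<le> 2 * (norm (\<xi> k) * norm (\<eta> k))"
        by (simp add: mult_right_mono)
      also have "\<dots> \<le> (norm (\<xi> k))\<^sup>2 + (norm (\<eta> k))\<^sup>2"
        using sum_squares_bound[of "norm (\<xi> k)" "norm (\<eta> k)"] by simp
      finally show ?thesis using norm_cinner_le[of "A n (\<xi> k)" "\<eta> k"] by linarith
    qed
    then show "\<forall>\<^sub>F (k, n) in at_top \<times>\<^sub>F sequentially.
        norm (cinner (A n (\<xi> k)) (\<eta> k)) \<le> (norm (\<xi> k))\<^sup>2 + (norm (\<eta> k))\<^sup>2"
      by (intro always_eventually) auto
  qed simp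
  then show ?thesis using A(1) T(1) by (simp add: \<tau>)
qed

context
  fixes M :: "('h::complex_hilbert \<Rightarrow>\<^sub>L 'h) set" and \<tau> :: "('h \<Rightarrow>\<^sub>L 'h) \<Rightarrow> complex"
  assumes M: "von_neumann_algebra M" and \<tau>: "faithful_normal_tracial_state M \<tau>"
begin

lemma trace_add: "A \<in> M \<Longrightarrow> B \<in> M \<Longrightarrow> Re (\<tau> (A + B)) = Re (\<tau> A) + Re (\<tau> B)"
  using \<tau> by (simp add: faithful_normal_tracial_state_def)

lemma trace_scaleR:
  assumes "A \<in> M"
  shows "Re (\<tau> (r *\<^sub>R A)) = r * Re (\<tau> A)"
proof -
  have "r *\<^sub>R A = scaleC_op (complex_of_real r) A"
    by (rule blinfun_eqI) (simp add: scaleC_op.rep_eq scaleC_of_real blinfun.bilinear_simps)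
  then show ?thesis using \<tau> assms by (simp add: faithful_normal_tracial_state_def)
qed

lemma trace_diff: "A \<in> M \<Longrightarrow> B \<in> M \<Longrightarrow> Re (\<tau> (A - B)) = Re (\<tau> A) - Re (\<tau> B)"
  using trace_add[of "A - B" B] von_neumann_algebra_diff[OF M] by simp

lemma trace_id: "Re (\<tau> id_blinfun) = 1"
  using \<tau> by (simp add: faithful_normal_tracial_state_def)

lemma trace_commute: "A \<in> M \<Longrightarrow> B \<in> M \<Longrightarrow> Re (\<tau> (A o\<^sub>L B)) = Re (\<tau> (B o\<^sub>L A))"
  using \<tau> by (simp add: faithful_normal_tracial_state_def)

text \<open>
  The defining positivity of a state concerns elements \<open>B\<^sup>* B\<close>. A positive \<open>A\<close> has this form with
  \<open>B = sqrt A\<close>, which belongs to \<open>M\<close> because it lies in the bicommutant of \<open>A\<close>.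
\<close>

lemma trace_positive:
  assumes A: "A \<in> M" "positive_op A"
  shows "0 \<le> Re (\<tau> A)"
proof -
  obtain S where S: "positive_op S" "S \<in> bicomm A" "S o\<^sub>L S = A"
    by (rule positive_op_sqrt[OF A(2)])
  have SM: "S \<in> M" by (rule von_neumann_algebra_bicomm[OF M A(1) S(2)])
  have "self_adjoint S"
    using von_neumann_algebra_bounded_ops[OF M SM] S(1)
    by (intro self_adjoint_symmetric_op) (auto simp: positive_op_def)
  then have "\<tau> (S o\<^sub>L S) \<in> \<real>\<^sub>\<ge>\<^sub>0"
    using \<tau> SM unfolding faithful_normal_tracial_state_def self_adjoint_def by blast
  then show ?thesis by (simp add: S(3) complex_nonneg_Reals_iff)
qed

text \<open>
  By the trace property, \<open>\<tau>(A p) = \<tau>(A p p) = \<tau>(p A p)\<close>. The operator \<open>A p\<close> itself is in general not symmetric.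
\<close>

lemma trace_positive_projection:
  assumes A: "A \<in> M" "positive_op A" and p: "p \<in> M" "ortho_proj p"
  shows "0 \<le> Re (\<tau> (A o\<^sub>L p))"
proof -
  have pAp: "p o\<^sub>L (A o\<^sub>L p) \<in> M" by (intro von_neumann_algebra_compose[OF M] A p)
  have "0 \<le> p (A (p x)) \<bullet> x" for x
    using A(2) by (subst ortho_projD(2)[OF p(2)]) (simp add: positive_op_def)
  moreover have "symmetric_op (p o\<^sub>L (A o\<^sub>L p))"
    using A(2) by (simp add: positive_op_def symmetric_op_def ortho_projD(2)[OF p(2)])
  ultimately have "positive_op (p o\<^sub>L (A o\<^sub>L p))" by (simp add: positive_op_def)
  then have "0 \<le> Re (\<tau> (p o\<^sub>L (A o\<^sub>L p)))" by (rule trace_positive[OF pAp])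
  also have "Re (\<tau> (p o\<^sub>L (A o\<^sub>L p))) = Re (\<tau> ((A o\<^sub>L p) o\<^sub>L p))"
    by (rule trace_commute) (intro von_neumann_algebra_compose[OF M] A p)+
  also have "(A o\<^sub>L p) o\<^sub>L p = A o\<^sub>L p"
    by (rule blinfun_eqI) (simp add: ortho_projD(1)[OF p(2)])
  finally show ?thesis .
qed

context
  fixes c :: "'h \<Rightarrow>\<^sub>L 'h"
  assumes cM: "c \<in> M" and c: "self_adjoint c"
begin

lemma symmetric_op_c: "symmetric_op c"
  by (rule symmetric_op_self_adjoint[OF c])

lemma borel_projection_in_algebra: "A \<in> sets borel \<Longrightarrow> borel_projection c A \<in> M"
  by (rule von_neumann_algebra_bicomm[OF M cM borel_projection(2)[OF symmetric_op_c]])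

lemma trace_projection_nonneg:
  assumes "A \<in> sets borel"
  shows "0 \<le> Re (\<tau> (borel_projection c A))"
  using trace_positive[OF borel_projection_in_algebra[OF assms]] borel_projection(1)[OF symmetric_op_c assms]
    ortho_proj_form_ge by (auto simp: positive_op_def ortho_proj_def)

text \<open>
  Normality enters here: the projections of the finite unions are contractions that converge strongly.
\<close>

lemma trace_projection_sums:
  assumes A: "range A \<subseteq> sets borel" "disjoint_family (A :: nat \<Rightarrow> real set)"
  shows "(\<lambda>n. Re (\<tau> (borel_projection c (A n)))) sums Re (\<tau> (borel_projection c (\<Union>n. A n)))"
proof -
  let ?P = "borel_projection c"
  have P: "proj_measure ?P" by (rule proj_measure_borel_projection[OF symmetric_op_c])
  define U where "U n = (\<Union>i<n. A i)" for n
  have An: "A n \<in> sets borel" for n using A(1) by auto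
  have U: "U n \<in> sets borel" for n using An by (auto simp: U_def)
  have step: "?P (U (Suc n)) = ?P (U n) + ?P (A n)" for n
  proof -
    have "A i \<inter> A n = {}" if "i < n" for i
      using A(2) that by (simp add: disjoint_family_on_def)
    then have "U n \<inter> A n = {}" unfolding U_def by blast
    moreover have "U (Suc n) = U n \<union> A n" by (auto simp: U_def lessThan_Suc)
    ultimately show ?thesis using proj_measure_union[OF P U An] by simp
  qed
  have U0: "?P (U 0) = 0" by (simp add: U_def proj_measure_empty[OF P])
  have "(\<lambda>n. ?P (U n) x) \<longlonglongrightarrow> ?P (\<Union>n. A n) x" for x
  proof -
    have "?P (U n) x = (\<Sum>i<n. ?P (A i) x)" for n
      by (induction n) (simp_all add: U0 step blinfun.add_left)
    then show ?thesis using proj_measureD(4)[OF P A, of x] by (simp add: sums_def)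
  qed
  moreover have "(\<Union>n. A n) \<in> sets borel" using An by auto
  ultimately have "(\<lambda>n. \<tau> (?P (U n))) \<longlonglongrightarrow> \<tau> (?P (\<Union>n. A n))"
    using \<tau> U unfolding faithful_normal_tracial_state_def
    by (intro predual_strongly_continuous[of \<tau> M] borel_projection_in_algebra ortho_proj_norm
        borel_projection(1)[OF symmetric_op_c]) auto
  then have "(\<lambda>n. Re (\<tau> (?P (U n)))) \<longlonglongrightarrow> Re (\<tau> (?P (\<Union>n. A n)))"
    by (rule tendsto_Re)
  moreover have "Re (\<tau> (?P (U n))) = (\<Sum>i<n. Re (\<tau> (?P (A i))))" for n
  proof (induction n)
    case 0
    then show ?case using trace_scaleR[OF cM, of 0] by (simp add: U0)
  next
    case (Suc n)
    then show ?case by (simp add: step trace_add borel_projection_in_algebra U An)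
  qed
  ultimately show ?thesis by (simp add: sums_def)
qed

lemma distribution_sets: "sets (distribution \<tau> c) = sets borel"
  and distribution_space: "space (distribution \<tau> c) = UNIV"
  using sets.sigma_sets_eq[of "borel :: real measure"] by (simp_all add: distribution_def)

lemma distribution_emeasure:
  assumes A: "A \<in> sets borel"
  shows "emeasure (distribution \<tau> c) A = ennreal (Re (\<tau> (borel_projection c A)))"
proof -
  have eq: "spectral_projection c A = borel_projection c A" if "A \<in> sets borel" for A
    by (rule spectral_projection_eq_borel_projection[OF von_neumann_algebra_bounded_ops[OF M cM] c that])
  let ?f = "\<lambda>A. ennreal (Re (\<tau> (spectral_projection c A)))"
  have "emeasure (distribution \<tau> c) A = ?f A"
  proof (rule emeasure_measure_of[OF distribution_def])
    show "positive (sets (distribution \<tau> c)) ?f"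
      using trace_scaleR[OF cM, of 0]
      by (simp add: positive_def eq proj_measure_empty[OF proj_measure_borel_projection[OF symmetric_op_c]])
    show "countably_additive (sets (distribution \<tau> c)) ?f"
    proof (rule countably_additiveI)
      fix A :: "nat \<Rightarrow> real set"
      assume A: "range A \<subseteq> sets (distribution \<tau> c)" "disjoint_family A"
        "(\<Union>n. A n) \<in> sets (distribution \<tau> c)"
      then have An: "A n \<in> sets borel" for n by (auto simp: distribution_sets)
      have "(\<Sum>n. ennreal (Re (\<tau> (borel_projection c (A n))))) = ennreal (Re (\<tau> (borel_projection c (\<Union>n. A n))))"
        using A by (intro suminf_ennreal_eq trace_projection_nonneg trace_projection_sums An)
          (auto simp: distribution_sets)
      then show "(\<Sum>n. ?f (A n)) = ?f (\<Union>n. A n)"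
        using A(3) by (simp add: eq An distribution_sets)
    qed
  qed (use A distribution_sets in auto)
  then show ?thesis by (simp add: eq A)
qed

lemma distribution_measure:
  assumes A: "A \<in> sets borel"
  shows "measure (distribution \<tau> c) A = Re (\<tau> (borel_projection c A))"
  by (simp add: measure_def distribution_emeasure[OF A] trace_projection_nonneg[OF A])

lemma distribution_prob_space: "prob_space (distribution \<tau> c)"
  by (rule prob_spaceI)
    (simp add: distribution_space distribution_emeasure trace_id
      proj_measureD(2)[OF proj_measure_borel_projection[OF symmetric_op_c]])

lemma distribution_bounded_support:
  assumes k: "norm c < k"
  shows "measure (distribution \<tau> c) {-k<..k} = 1"
  by (simp add: distribution_measure borel_projection_outside[OF symmetric_op_c k] trace_id)

lemma distribution_integral:
  assumes k: "norm c < k" "-k \<le> b"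
  shows "(\<integral>u. indicator {-k<..b} u * u \<partial>distribution \<tau> c) = Re (\<tau> (c o\<^sub>L borel_projection c {..b}))"
proof (rule spectral_integral[OF symmetric_op_c, where \<phi> = "\<lambda>A. Re (\<tau> A)"])
  note inM = von_neumann_algebra_bicomm[OF M cM]
  show "Re (\<tau> (A + B)) = Re (\<tau> A) + Re (\<tau> B)" if "A \<in> bicomm c" "B \<in> bicomm c" for A B
    by (intro trace_add inM that)
  show "Re (\<tau> (r *\<^sub>R A)) = r * Re (\<tau> A)" if "A \<in> bicomm c" for A r
    by (intro trace_scaleR inM that)
  show "0 \<le> Re (\<tau> A)" if "A \<in> bicomm c" "positive_op A" for A
    by (intro trace_positive inM that)
  show "finite_measure (distribution \<tau> c)"
    using distribution_prob_space by (simp add: prob_space_def)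
qed (use k distribution_sets distribution_measure in auto)

end

end

section \<open>Quantile functions\<close>

text \<open>
  The bound \<open>k\<close> on the support keeps the quantile function bounded, hence integrable. The functions defined below
  depend on \<open>N\<close> alone. In the comments, \<open>F\<close> is the left-continuous distribution function of \<open>N\<close> and \<open>X\<close> its
  quantile function.
\<close>

locale bounded_distribution = prob_space N for N :: "real measure" +
  fixes k :: real
  assumes N_borel: "sets N = sets borel" and N_support: "measure N {-k<..k} = 1"
begin

definition quantile_fun :: "real \<Rightarrow> real" where
  "quantile_fun s = Inf {t. measure N {..<t} > s}"

definition shortfall :: "real \<Rightarrow> real" where
  "shortfall t = (\<integral>u. max 0 (t - u) \<partial>N)"

lemma space_N: "space N = UNIV"
  using sets_eq_imp_space_eq[OF N_borel] by simp

lemma AE_support: "AE u in N. u \<in> {-k<..k}"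
  using N_support prob_eq_1[of "{-k<..k}"] N_borel by simp

lemma F_mono: "s \<le> t \<Longrightarrow> measure N {..<s} \<le> measure N {..<t}"
  by (rule finite_measure_mono) (auto simp: N_borel)

lemma F_below: "t \<le> -k \<Longrightarrow> measure N {..<t} = 0"
proof -
  assume t: "t \<le> -k"
  have "measure N ({..<t} \<union> {-k<..k}) = measure N {..<t} + measure N {-k<..k}"
    using t by (intro finite_measure_Union) (auto simp: N_borel)
  then show ?thesis using N_support prob_le_1[of "{..<t} \<union> {-k<..k}"] measure_nonneg[of N "{..<t}"] by simp
qed

lemma F_above: "k < t \<Longrightarrow> measure N {..<t} = 1"
proof -
  assume "k < t"
  then have "measure N {-k<..k} \<le> measure N {..<t}"
    by (intro finite_measure_mono) (auto simp: N_borel)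
  then show ?thesis using N_support prob_le_1[of "{..<t}"] by simp
qed

lemma F_left_continuous:
  assumes "s < measure N {..<t}"
  shows "\<exists>t'<t. s < measure N {..<t'}"
proof -
  have "(\<lambda>n. measure N {..<t - 1 / real (Suc n)}) \<longlonglongrightarrow> measure N (\<Union>n. {..<t - 1 / real (Suc n)})"
  proof (rule finite_Lim_measure_incseq)
    show "incseq (\<lambda>n. {..<t - 1 / real (Suc n)})"
      by (rule incseq_SucI) (auto intro: less_le_trans simp: frac_le)
  qed (auto simp: N_borel)
  also have "(\<Union>n. {..<t - 1 / real (Suc n)}) = {..<t}"
  proof (intro equalityI subsetI)
    fix u assume "u \<in> {..<t}"
    then obtain n where "1 / real (Suc n) < t - u"
      using reals_Archimedean[of "t - u"] by (auto simp: inverse_eq_divide)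
    then show "u \<in> (\<Union>n. {..<t - 1 / real (Suc n)})" by (auto intro!: exI[of _ n])
  qed (auto intro: less_trans)
  finally have "\<forall>\<^sub>F n in sequentially. s < measure N {..<t - 1 / real (Suc n)}"
    by (rule order_tendstoD(1)) (rule assms)
  from eventually_happens'[OF sequentially_bot this]
  obtain n where "s < measure N {..<t - 1 / real (Suc n)}" by blast
  then show ?thesis by (intro exI[of _ "t - 1 / real (Suc n)"]) simp
qed

text \<open>
  The implication from right to left needs the left continuity of the distribution function.
\<close>

lemma quantile_fun_less_iff:
  assumes s: "0 \<le> s" "s < 1"
  shows "quantile_fun s < t \<longleftrightarrow> s < measure N {..<t}"
proof -
  let ?S = "{t. measure N {..<t} > s}"
  have ne: "?S \<noteq> {}" using F_above[of "k + 1"] s by (auto intro!: exI[of _ "k + 1"])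
  have bdd: "bdd_below ?S"
  proof (rule bdd_belowI)
    fix t assume "t \<in> ?S"
    then show "-k \<le> t" using F_below[of t] s by (cases "-k \<le> t") auto
  qed
  show ?thesis
  proof
    assume "quantile_fun s < t"
    then obtain t' where "t' \<in> ?S" "t' < t"
      unfolding quantile_fun_def using cInf_less_iff[OF ne bdd] by blast
    then show "s < measure N {..<t}" using F_mono[of t' t] by simp
  next
    assume "s < measure N {..<t}"
    then obtain t' where t': "t' < t" "s < measure N {..<t'}" using F_left_continuous by blast
    then have "quantile_fun s \<le> t'" unfolding quantile_fun_def by (intro cInf_lower bdd) simp
    then show "quantile_fun s < t" using t' by simp
  qed
qed

lemma quantile_fun_mono:
  assumes "0 \<le> s" "s \<le> t" "t < 1"
  shows "quantile_fun s \<le> quantile_fun t"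
proof (rule ccontr)
  assume "\<not> quantile_fun s \<le> quantile_fun t"
  then have "t < measure N {..<quantile_fun s}" using quantile_fun_less_iff[of t "quantile_fun s"] assms by simp
  then have "quantile_fun s < quantile_fun s" using quantile_fun_less_iff[of s "quantile_fun s"] assms by simp
  then show False by simp
qed

abbreviation "unit_interval \<equiv> restrict_space lborel {0..<1::real}"

lemma space_unit_interval: "space unit_interval = {0..<1}"
  by (simp add: space_restrict_space)

lemma F_less_1: "s < measure N {..<t} \<Longrightarrow> s < 1"
  using prob_le_1[of "{..<t}"] by linarith

lemma quantile_fun_set: "{s \<in> space unit_interval. quantile_fun s < t} = {0..<measure N {..<t}}"
proof (rule set_eqI)
  fix s show "s \<in> {s \<in> space unit_interval. quantile_fun s < t} \<longleftrightarrow> s \<in> {0..<measure N {..<t}}"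
    using quantile_fun_less_iff[of s t] F_less_1[of s t] by (auto simp: space_unit_interval)
qed

lemma quantile_fun_measurable [measurable]: "quantile_fun \<in> borel_measurable unit_interval"
proof (rule borel_measurableI_less)
  fix t
  have "{0..<measure N {..<t}} \<in> sets unit_interval"
    by (subst sets_restrict_space_iff) (auto dest: F_less_1)
  then show "{s \<in> space unit_interval. quantile_fun s < t} \<in> sets unit_interval" by (simp only: quantile_fun_set)
qed

text \<open>
  The set where \<open>X < t\<close> is \<open>[0, F(t))\<close>, whose length is \<open>F(t) = N(-\<infinity>,t)\<close>.
\<close>

lemma distr_quantile_fun: "distr unit_interval borel quantile_fun = N"
proof (rule measure_eqI_generator_eq[where E = "range lessThan" and \<Omega> = UNIV and A = "\<lambda>i. {..<real i}"])
  have "{..<a} \<inter> {..<b} = {..<min a b}" for a b :: real by auto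
  then show "Int_stable (range (lessThan :: real \<Rightarrow> _))"
    by (auto simp: Int_stable_def)
  have em: "emeasure (distr unit_interval borel quantile_fun) {..<t} = emeasure N {..<t}" for t
  proof -
    have "emeasure (distr unit_interval borel quantile_fun) {..<t} = emeasure unit_interval (quantile_fun -` {..<t} \<inter> space unit_interval)"
      by (rule emeasure_distr) simp_all
    also have "quantile_fun -` {..<t} \<inter> space unit_interval = {s \<in> space unit_interval. quantile_fun s < t}"
      unfolding vimage_def by blast
    also have "\<dots> = {0..<measure N {..<t}}" by (rule quantile_fun_set)
    also have "emeasure unit_interval \<dots> = emeasure lborel {0..<measure N {..<t}}"
      by (intro emeasure_restrict_space) (auto dest: F_less_1)
    also have "\<dots> = emeasure N {..<t}" by (simp add: emeasure_eq_measure)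
    finally show ?thesis .
  qed
  show "emeasure (distr unit_interval borel quantile_fun) A = emeasure N A" if "A \<in> range lessThan" for A
    using that em by auto
  have borel: "sets borel = sigma_sets UNIV (range (lessThan :: real \<Rightarrow> _))"
    by (subst borel_Iio) (simp add: sets_measure_of)
  show "sets (distr unit_interval borel quantile_fun) = sigma_sets UNIV (range lessThan)"
    "sets N = sigma_sets UNIV (range lessThan)"
    by (simp_all add: N_borel borel)
  show "emeasure (distr unit_interval borel quantile_fun) {..<real i} \<noteq> \<infinity>" for i
    by (simp add: em emeasure_eq_measure)
  show "(\<Union>i. {..<real i}) = UNIV"
    using reals_Archimedean2 by auto
qed auto

lemma quantile_fun_bounded:
  assumes "s \<in> {0..<1}"
  shows "\<bar>quantile_fun s\<bar> \<le> \<bar>k\<bar>"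
proof -
  have "\<not> quantile_fun s < -k" using quantile_fun_less_iff[of s "-k"] F_below[of "-k"] assms by simp
  moreover have "quantile_fun s \<le> k"
  proof (rule dense_ge)
    fix t assume "k < t"
    then have "quantile_fun s < t" using quantile_fun_less_iff[of s t] F_above[of t] assms by simp
    then show "quantile_fun s \<le> t" by simp
  qed
  ultimately show ?thesis by linarith
qed

lemma unit_interval_finite: "finite_measure unit_interval"
  by (rule finite_measureI) (simp add: space_unit_interval emeasure_restrict_space)

lemma quantile_fun_integrable: "integrable unit_interval quantile_fun"
  by (rule finite_measure.integrable_const_bound[OF unit_interval_finite, of _ "\<bar>k\<bar>"])
    (use quantile_fun_bounded in \<open>auto simp: space_unit_interval intro!: AE_I2\<close>)

lemma unit_interval_set_integral:
  fixes f :: "real \<Rightarrow> real"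
  assumes "s \<le> 1"
  shows "(LINT u:{0..<s}|lborel. f u) = (\<integral>u. indicator {0..<s} u * f u \<partial>unit_interval)"
proof -
  have "(\<integral>u. indicator {0..<s} u * f u \<partial>unit_interval)
      = (\<integral>u. indicator {0..<1} u *\<^sub>R (indicator {0..<s} u * f u) \<partial>lborel)"
    by (rule integral_restrict_space) simp
  also have "\<dots> = (\<integral>u. indicator {0..<s} u *\<^sub>R f u \<partial>lborel)"
    using assms by (intro Bochner_Integration.integral_cong) (auto simp: indicator_def)
  finally show ?thesis by (simp add: set_lebesgue_integral_def)
qed

lemma quantile_fun_set_integrable:
  assumes "s \<le> 1"
  shows "set_integrable lborel {0..<s} quantile_fun"
proof (rule set_integrable_subset)
  show "set_integrable lborel {0..<1} quantile_fun"
    using quantile_fun_integrable by (simp add: set_integrable_def integrable_restrict_space)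
qed (use assms in auto)

lemma integral_quantile_fun: "(LINT s:{0..<1}|lborel. quantile_fun s) = (\<integral>u. u \<partial>N)"
proof -
  have "(LINT s:{0..<1}|lborel. quantile_fun s) = (\<integral>s. quantile_fun s \<partial>unit_interval)"
    unfolding unit_interval_set_integral[OF order_refl]
    by (intro Bochner_Integration.integral_cong) (auto simp: space_unit_interval)
  also have "\<dots> = (\<integral>u. u \<partial>distr unit_interval borel quantile_fun)"
    by (rule integral_distr[symmetric]) simp_all
  finally show ?thesis by (simp add: distr_quantile_fun)
qed

lemma shortfall_quantile_fun: "shortfall t = (\<integral>u. max 0 (t - quantile_fun u) \<partial>unit_interval)"
proof -
  have "(\<integral>u. max 0 (t - u) \<partial>distr unit_interval borel quantile_fun) = (\<integral>u. max 0 (t - quantile_fun u) \<partial>unit_interval)"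
    by (rule integral_distr) simp_all
  then show ?thesis by (simp add: shortfall_def distr_quantile_fun)
qed

lemma partial_integral:
  assumes s: "0 \<le> s" "s \<le> 1"
  shows "(\<integral>u. indicator {0..<s} u * (t - quantile_fun u) \<partial>unit_interval) = s * t - (LINT u:{0..<s}|lborel. quantile_fun u)"
    and "integrable unit_interval (\<lambda>u. indicator {0..<s} u * (t - quantile_fun u))"
proof -
  have meas: "{0..<s} \<in> sets unit_interval"
    using s by (subst sets_restrict_space_iff) (auto simp: subset_eq)
  have iX: "integrable unit_interval (\<lambda>u. indicator {0..<s} u * quantile_fun u)"
    using integrable_mult_indicator[OF meas quantile_fun_integrable] by simp
  have fin: "emeasure unit_interval {0..<s} < \<infinity>" and m: "measure unit_interval {0..<s} = s"
    using s emeasure_restrict_space[of "{0..<1}" lborel "{0..<s}"]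
    by (auto simp: measure_def subset_eq)
  have it: "integrable unit_interval (\<lambda>u. indicator {0..<s} u * t)"
    by (intro integrable_mult_left integrable_real_indicator meas fin)
  have eq: "(\<lambda>u. indicator {0..<s} u * (t - quantile_fun u)) = (\<lambda>u. indicator {0..<s} u * t - indicator {0..<s} u * quantile_fun u)"
    by (simp add: fun_eq_iff algebra_simps)
  show "integrable unit_interval (\<lambda>u. indicator {0..<s} u * (t - quantile_fun u))"
    unfolding eq by (intro Bochner_Integration.integrable_diff it iX)
  have "(\<integral>u. indicator {0..<s} u * t \<partial>unit_interval) = s * t"
    using s meas m by (simp add: space_unit_interval Int_absorb2 subset_eq)
  then show "(\<integral>u. indicator {0..<s} u * (t - quantile_fun u) \<partial>unit_interval) = s * t - (LINT u:{0..<s}|lborel. quantile_fun u)"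
    unfolding eq by (subst Bochner_Integration.integral_diff[OF it iX]) (simp add: unit_interval_set_integral[OF s(2)])
qed

lemma max_integrable: "integrable unit_interval (\<lambda>u. max 0 (t - quantile_fun u))"
  by (intro integrable_max Bochner_Integration.integrable_diff quantile_fun_integrable integrable_const
      finite_measure.integrable_const[OF unit_interval_finite] integrable_zero)

text \<open>
  Drop the part of the integral of \<open>max 0 (t - X)\<close> over \<open>[s,1)\<close>, and bound the integrand below by \<open>t - X\<close> on \<open>[0,s)\<close>.
\<close>

lemma integral_quantile_fun_ge:
  assumes s: "0 \<le> s" "s \<le> 1"
  shows "s * t - shortfall t \<le> (LINT u:{0..<s}|lborel. quantile_fun u)"
proof -
  have "(\<integral>u. indicator {0..<s} u * (t - quantile_fun u) \<partial>unit_interval) \<le> shortfall t"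
    unfolding shortfall_quantile_fun
    by (intro integral_mono partial_integral(2) s max_integrable) (auto simp: indicator_def)
  then show ?thesis by (simp add: partial_integral(1)[OF s])
qed

text \<open>
  For \<open>t = X(s)\<close> nothing is lost: \<open>X \<le> t\<close> on \<open>[0,s)\<close> and \<open>X \<ge> t\<close> on \<open>[s,1)\<close>.
\<close>

lemma integral_quantile_fun_eq:
  assumes s: "0 \<le> s" "s < 1"
  shows "(LINT u:{0..<s}|lborel. quantile_fun u) = s * quantile_fun s - shortfall (quantile_fun s)"
proof -
  have "shortfall (quantile_fun s) = (\<integral>u. indicator {0..<s} u * (quantile_fun s - quantile_fun u) \<partial>unit_interval)"
    unfolding shortfall_quantile_fun
  proof (intro Bochner_Integration.integral_cong refl)
    fix u assume "u \<in> space unit_interval"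
    then show "max 0 (quantile_fun s - quantile_fun u) = indicator {0..<s} u * (quantile_fun s - quantile_fun u)"
      using quantile_fun_mono[of u s] quantile_fun_mono[of s u] s by (auto simp: space_unit_interval indicator_def)
  qed
  then show ?thesis using partial_integral(1)[of s "quantile_fun s"] s by simp
qed

end

section \<open>The shortfall as a trace\<close>

context
  fixes M :: "('h::complex_hilbert \<Rightarrow>\<^sub>L 'h) set" and \<tau> :: "('h \<Rightarrow>\<^sub>L 'h) \<Rightarrow> complex"
  assumes M: "von_neumann_algebra M" and \<tau>: "faithful_normal_tracial_state M \<tau>"
begin

lemma bounded_distribution:
  assumes "c \<in> M" "self_adjoint c" "norm c < k"
  shows "bounded_distribution (distribution \<tau> c) k"
  using distribution_prob_space[OF M \<tau> assms(1,2)] distribution_sets[OF M \<tau> assms(1,2)]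
    distribution_bounded_support[OF M \<tau> assms]
  by (simp add: bounded_distribution_def bounded_distribution_axioms_def)

lemma distribution_mean:
  assumes c: "c \<in> M" "self_adjoint c"
  shows "(\<integral>u. u \<partial>distribution \<tau> c) = Re (\<tau> c)"
proof -
  define k where "k = norm c + 1"
  have k: "norm c < k" "-k \<le> k" by (simp_all add: k_def)
  interpret D: bounded_distribution "distribution \<tau> c" k by (rule bounded_distribution[OF c k(1)])
  have "c o\<^sub>L borel_projection c {..k} = c"
    using spectral_family_above[OF symmetric_op_c[OF M \<tau> c] k(1)]
    by (intro blinfun_eqI) (simp add: borel_projection_atMost[OF symmetric_op_c[OF M \<tau> c]])
  then have "Re (\<tau> c) = (\<integral>u. indicator {-k<..k} u * u \<partial>distribution \<tau> c)"
    by (simp add: distribution_integral[OF M \<tau> c k])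
  also have "\<dots> = (\<integral>u. u \<partial>distribution \<tau> c)"
    by (rule integral_cong_AE)
      (use D.AE_support in \<open>auto simp: measurable_cong_sets[OF D.N_borel refl]\<close>)
  finally show ?thesis by simp
qed

lemma shortfall_trace:
  assumes c: "c \<in> M" "self_adjoint c" and k: "norm c < k"
  shows "bounded_distribution.shortfall (distribution \<tau> c) t
    = Re (\<tau> ((t *\<^sub>R id_blinfun - c) o\<^sub>L borel_projection c {..t}))"
proof -
  \<comment> \<open>\<open>(-r,r]\<close> carries the distribution, and \<open>t\<close> may not lie below \<open>-r\<close> in the integral over \<open>(-r,t]\<close>\<close>
  define r where "r = max k \<bar>t\<bar>"
  have r: "norm c < r" "-r \<le> t" using k by (auto simp: r_def)
  interpret D: bounded_distribution "distribution \<tau> c" r by (rule bounded_distribution[OF c r(1)])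
  let ?P = "borel_projection c {..t}"
  note [measurable_cong] = D.N_borel
  have P: "?P \<in> M" by (rule borel_projection_in_algebra[OF M \<tau> c]) simp
  have "D.shortfall t = (\<integral>u. indicator {..t} u * t - indicator {-r<..t} u * u \<partial>distribution \<tau> c)"
    unfolding D.shortfall_def
  proof (rule integral_cong_AE)
    show "AE u in distribution \<tau> c. max 0 (t - u) = indicator {..t} u * t - indicator {-r<..t} u * u"
      using D.AE_support by eventually_elim (auto simp: indicator_def)
  qed simp_all
  also have "\<dots> = (\<integral>u. indicator {..t} u * t \<partial>distribution \<tau> c) - (\<integral>u. indicator {-r<..t} u * u \<partial>distribution \<tau> c)"
  proof (rule Bochner_Integration.integral_diff)
    show "integrable (distribution \<tau> c) (\<lambda>u. indicator {..t} u * t)"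
      by (rule D.integrable_const_bound[of _ "\<bar>t\<bar>"]) (auto simp: indicator_def)
    show "integrable (distribution \<tau> c) (\<lambda>u. indicator {-r<..t} u * u)"
    proof (rule D.integrable_const_bound)
      have "0 < r" using r(1) norm_ge_zero[of c] by linarith
      then have "norm (indicator {-r<..t} u * u) \<le> r + \<bar>t\<bar>" for u
        by (cases "u \<in> {-r<..t}") auto
      then show "AE u in distribution \<tau> c. norm (indicator {-r<..t} u * u) \<le> r + \<bar>t\<bar>"
        by simp
    qed simp
  qed
  also have "(\<integral>u. indicator {..t} u * t \<partial>distribution \<tau> c) = t * Re (\<tau> ?P)"
    using D.space_N D.N_borel distribution_measure[OF M \<tau> c, of "{..t}"] by simp
  also have "(\<integral>u. indicator {-r<..t} u * u \<partial>distribution \<tau> c) = Re (\<tau> (c o\<^sub>L ?P))"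
    by (rule distribution_integral[OF M \<tau> c r])
  also have "t * Re (\<tau> ?P) - Re (\<tau> (c o\<^sub>L ?P)) = Re (\<tau> (t *\<^sub>R ?P - (c o\<^sub>L ?P)))"
    by (simp add: trace_diff[OF M \<tau>] trace_scaleR[OF M \<tau>] P c
        von_neumann_algebra_compose[OF M] von_neumann_algebra_scaleR[OF M])
  also have "t *\<^sub>R ?P - (c o\<^sub>L ?P) = (t *\<^sub>R id_blinfun - c) o\<^sub>L ?P"
    by (rule blinfun_eqI) (simp add: blinfun.bilinear_simps)
  finally show ?thesis .
qed

text \<open>
  Put \<open>x = t - c\<close> and let \<open>E\<close> be the spectral projection of \<open>(-\<infinity>,t]\<close>, so that \<open>x E \<ge> 0\<close> and \<open>x (1 - E) \<le> 0\<close>. Then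
  \<open>\<tau>(x E) - \<tau>(x p) = \<tau>(x E (1 - p)) - \<tau>(x (1 - E) p) \<ge> 0\<close>.
\<close>

lemma shortfall_variational:
  assumes c: "c \<in> M" "self_adjoint c" and k: "norm c < k" and p: "p \<in> M" "ortho_proj p"
  shows "Re (\<tau> ((t *\<^sub>R id_blinfun - c) o\<^sub>L p))
    \<le> bounded_distribution.shortfall (distribution \<tau> c) t"
proof -
  let ?E = "borel_projection c {..t}" and ?x = "t *\<^sub>R id_blinfun - c" and ?y = "c - t *\<^sub>R id_blinfun"
  note sym = symmetric_op_c[OF M \<tau> c]
  have E: "?E \<in> M" "ortho_proj ?E" "?E \<in> bicomm c"
    using borel_projection_in_algebra[OF M \<tau> c] borel_projection[OF sym] by simp_all
  have comm: "?E (c x) = c (?E x)" for x by (rule bicomm_commute_self[OF E(3)])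
  have cE: "c (?E x) \<bullet> ?E x \<le> t * (?E x \<bullet> ?E x)"
    and cE': "t * ((x - ?E x) \<bullet> (x - ?E x)) \<le> c (x - ?E x) \<bullet> (x - ?E x)" for x
    using spectral_family(3,4)[OF sym] by (simp_all add: borel_projection_atMost[OF sym])
  define q where "q = id_blinfun - p"
  define E' where "E' = id_blinfun - ?E"
  have qM: "q \<in> M" "ortho_proj q" "E' \<in> M" "ortho_proj E'"
    unfolding q_def E'_def
    by (intro von_neumann_algebra_diff[OF M] von_neumann_algebra_id[OF M] p E ortho_proj_compl)+
  have xM: "?x \<in> M" and yM: "?y \<in> M"
    by (intro von_neumann_algebra_diff[OF M] von_neumann_algebra_scaleR[OF M] von_neumann_algebra_id[OF M] c)+
  have symx: "symmetric_op ?x" and symy: "symmetric_op ?y"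
    by (intro symmetric_op_diff symmetric_op_scaleR symmetric_op_id sym)+
  have commE': "E' (c x) = c (E' x)" for x by (simp add: E'_def comm blinfun.bilinear_simps)
  have pos: "positive_op (?x o\<^sub>L ?E)"
    by (rule positive_op_compression[OF symx E(2)])
      (use cE in \<open>auto simp: blinfun.bilinear_simps inner_diff_left comm\<close>)
  have pos': "positive_op (?y o\<^sub>L E')"
    by (rule positive_op_compression[OF symy qM(4)])
      (use cE' in \<open>auto simp: blinfun.bilinear_simps inner_diff_left comm E'_def algebra_simps\<close>)
  have comp: "A o\<^sub>L B \<in> M" if "A \<in> M" "B \<in> M" for A B
    by (rule von_neumann_algebra_compose[OF M that])
  have "?x o\<^sub>L ?E = (?x o\<^sub>L p) + (((?x o\<^sub>L ?E) o\<^sub>L q) + ((?y o\<^sub>L E') o\<^sub>L p))"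
    by (rule blinfun_eqI) (simp add: q_def E'_def blinfun.bilinear_simps algebra_simps)
  from arg_cong[OF this, of "\<lambda>A. Re (\<tau> A)"]
  have "Re (\<tau> (?x o\<^sub>L ?E)) = Re (\<tau> (?x o\<^sub>L p)) +
      (Re (\<tau> ((?x o\<^sub>L ?E) o\<^sub>L q)) + Re (\<tau> ((?y o\<^sub>L E') o\<^sub>L p)))"
    by (simp only: trace_add[OF M \<tau>] comp xM yM E qM p von_neumann_algebra_add[OF M])
  moreover have "0 \<le> Re (\<tau> ((?x o\<^sub>L ?E) o\<^sub>L q))"
    by (rule trace_positive_projection[OF M \<tau> comp[OF xM E(1)] pos qM(1,2)])
  moreover have "0 \<le> Re (\<tau> ((?y o\<^sub>L E') o\<^sub>L p))"
    by (rule trace_positive_projection[OF M \<tau> comp[OF yM qM(3)] pos' p])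
  ultimately show ?thesis by (simp add: shortfall_trace[OF c k])
qed

text \<open>
  At the optimal projection for \<open>a + b\<close> the trace splits into two terms, each of which is bounded by the
  corresponding maximum over all projections.
\<close>

lemma shortfall_subadditive:
  assumes a: "a \<in> M" "self_adjoint a" and b: "b \<in> M" "self_adjoint b"
    and k: "norm a < k" "norm b < k" "norm (a + b) < k"
  shows "bounded_distribution.shortfall (distribution \<tau> (a + b)) (s + t)
    \<le> bounded_distribution.shortfall (distribution \<tau> a) s
      + bounded_distribution.shortfall (distribution \<tau> b) t"
proof -
  have ab: "a + b \<in> M" by (rule von_neumann_algebra_add[OF M a(1) b(1)])
  have sab: "self_adjoint (a + b)"
    by (rule self_adjoint_symmetric_op[OF von_neumann_algebra_bounded_ops[OF M ab]
          symmetric_op_add[OF a(2)[THEN symmetric_op_self_adjoint] b(2)[THEN symmetric_op_self_adjoint]]])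
  define p where "p = borel_projection (a + b) {..s + t}"
  have p: "p \<in> M" "ortho_proj p"
    unfolding p_def using borel_projection_in_algebra[OF M \<tau> ab sab] borel_projection(1)[OF symmetric_op_c[OF M \<tau> ab sab]]
    by simp_all
  have inM: "(r *\<^sub>R id_blinfun - c) o\<^sub>L p \<in> M" if "c \<in> M" for r c
    by (intro von_neumann_algebra_compose[OF M] von_neumann_algebra_diff[OF M]
        von_neumann_algebra_scaleR[OF M] von_neumann_algebra_id[OF M] that p)
  have "bounded_distribution.shortfall (distribution \<tau> (a + b)) (s + t)
      = Re (\<tau> (((s + t) *\<^sub>R id_blinfun - (a + b)) o\<^sub>L p))"
    unfolding p_def by (rule shortfall_trace[OF ab sab k(3)])
  also have "((s + t) *\<^sub>R id_blinfun - (a + b)) o\<^sub>L p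
      = ((s *\<^sub>R id_blinfun - a) o\<^sub>L p) + ((t *\<^sub>R id_blinfun - b) o\<^sub>L p)"
    by (rule blinfun_eqI) (simp add: blinfun.bilinear_simps algebra_simps)
  also have "Re (\<tau> \<dots>) = Re (\<tau> ((s *\<^sub>R id_blinfun - a) o\<^sub>L p)) + Re (\<tau> ((t *\<^sub>R id_blinfun - b) o\<^sub>L p))"
    by (rule trace_add[OF M \<tau> inM[OF a(1)] inM[OF b(1)]])
  also have "\<dots> \<le> bounded_distribution.shortfall (distribution \<tau> a) s
      + bounded_distribution.shortfall (distribution \<tau> b) t"
    by (rule add_mono[OF shortfall_variational[OF a k(1) p] shortfall_variational[OF b k(2) p]])
  finally show ?thesis .
qed

end

theorem lemma3p7:
  fixes M :: "('h::complex_hilbert \<Rightarrow>\<^sub>L 'h) set"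
    and \<tau> :: "('h \<Rightarrow>\<^sub>L 'h) \<Rightarrow> complex"
    and a b :: "'h \<Rightarrow>\<^sub>L 'h"
  assumes "von_neumann_algebra M"
    and "separable_predual M"
    and "faithful_normal_tracial_state M \<tau>"
    and "a \<in> M" and "self_adjoint a"
    and "b \<in> M" and "self_adjoint b"
    and "non_atomic (distribution \<tau> a)"
    and "non_atomic (distribution \<tau> b)"
  shows "(\<forall>s\<in>{0..<1::real}.
            (LINT t:{0..<s}|lborel. quantile \<tau> (a + b) t)
              \<ge> (LINT t:{0..<s}|lborel. quantile \<tau> a t + quantile \<tau> b t)) \<and>
         (LINT t:{0..<1}|lborel. quantile \<tau> (a + b) t)
           = (LINT t:{0..<1}|lborel. quantile \<tau> a t + quantile \<tau> b t)"
proof -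
  note M = assms(1) and \<tau> = assms(3) and a = assms(4,5) and b = assms(6,7)
  have ab: "a + b \<in> M" by (rule von_neumann_algebra_add[OF M a(1) b(1)])
  have sab: "self_adjoint (a + b)"
    by (rule self_adjoint_symmetric_op[OF von_neumann_algebra_bounded_ops[OF M ab]
          symmetric_op_add[OF a(2)[THEN symmetric_op_self_adjoint] b(2)[THEN symmetric_op_self_adjoint]]])
  define k where "k = norm a + norm b + 1"
  have k: "norm a < k" "norm b < k" "norm (a + b) < k"
    using norm_triangle_ineq[of a b] norm_ge_zero[of a] norm_ge_zero[of b] unfolding k_def by linarith+
  interpret A: bounded_distribution "distribution \<tau> a" k by (rule bounded_distribution[OF M \<tau> a k(1)])
  interpret B: bounded_distribution "distribution \<tau> b" k by (rule bounded_distribution[OF M \<tau> b k(2)])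
  interpret C: bounded_distribution "distribution \<tau> (a + b)" k
    by (rule bounded_distribution[OF M \<tau> ab sab k(3)])
  have qa: "quantile \<tau> a = A.quantile_fun" and qb: "quantile \<tau> b = B.quantile_fun" and qc: "quantile \<tau> (a + b) = C.quantile_fun"
    by (simp_all add: fun_eq_iff quantile_def distribution_function_def A.quantile_fun_def B.quantile_fun_def C.quantile_fun_def)
  have sum: "(LINT t:{0..<s}|lborel. A.quantile_fun t + B.quantile_fun t)
      = (LINT t:{0..<s}|lborel. A.quantile_fun t) + (LINT t:{0..<s}|lborel. B.quantile_fun t)" if "s \<le> 1" for s
    by (rule set_integral_add(2)[OF A.quantile_fun_set_integrable[OF that] B.quantile_fun_set_integrable[OF that]])
  show ?thesis
    unfolding qa qb qc
  proof (intro conjI ballI)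
    fix s :: real assume s: "s \<in> {0..<1}"
    have "(LINT t:{0..<s}|lborel. A.quantile_fun t + B.quantile_fun t)
        = s * (A.quantile_fun s + B.quantile_fun s) - (A.shortfall (A.quantile_fun s) + B.shortfall (B.quantile_fun s))"
      using s by (simp add: sum A.integral_quantile_fun_eq B.integral_quantile_fun_eq algebra_simps)
    also have "\<dots> \<le> s * (A.quantile_fun s + B.quantile_fun s) - C.shortfall (A.quantile_fun s + B.quantile_fun s)"
      using shortfall_subadditive[OF M \<tau> a b k, of "A.quantile_fun s" "B.quantile_fun s"] by simp
    also have "\<dots> \<le> (LINT t:{0..<s}|lborel. C.quantile_fun t)"
      using s by (intro C.integral_quantile_fun_ge) auto
    finally show "(LINT t:{0..<s}|lborel. C.quantile_fun t) \<ge> (LINT t:{0..<s}|lborel. A.quantile_fun t + B.quantile_fun t)" .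
  next
    show "(LINT t:{0..<1}|lborel. C.quantile_fun t) = (LINT t:{0..<1}|lborel. A.quantile_fun t + B.quantile_fun t)"
      by (simp add: sum A.integral_quantile_fun B.integral_quantile_fun C.integral_quantile_fun distribution_mean[OF M \<tau> ab sab]
          distribution_mean[OF M \<tau> a] distribution_mean[OF M \<tau> b] trace_add[OF M \<tau> a(1) b(1)])
  qed
qed

end
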